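(* Let $(B,g_B)$ and $(F,g_F)$ be pseudo-Riemannian manifolds of dimensions $m$ and $k$, let $c,w:B\to(0,\infty)$ be smooth, and equip $B\times F$ with the metric $g=c^2g_B+w^2g_F$. Let $X,Y\in\mathfrak{L}(B)$ and $V,W\in\mathfrak{L}(F)$. Then the Ricci tensor $\mathrm{Ric}$ of $(B\times F,g)$ satisfies: (1) $$\begin{aligned}\mathrm{Ric}(X,Y)={}&\mathrm{Ric}_B(X,Y)-(m-2)\frac1c\mathrm{H}_B^c(X,Y)+2(m-2)\frac{1}{c^2}X(c)Y(c)\\&-\left[(m-3)\frac{g_B(\nabla^Bc,\nabla^Bc)}{c^2}+\frac{\Delta_Bc}{c}\right]g_B(X,Y)\\&-k\frac1w\mathrm{H}_B^w(X,Y)-k\frac{g_B(\nabla^Bw,\nabla^Bc)}{wc}g_B(X,Y)+k\frac{X(c)}{c}\frac{Y(w)}{w}+k\frac{Y(c)}{c}\frac{X(w)}{w};\end{aligned}$$ (2) $\mathrm{Ric}(X,V)=0$; (3) $$\mathrm{Ric}(V,W)=\mathrm{Ric}_F(V,W)-\frac{w^2}{c^2}g_F(V,W)\left[(m-2)\frac{g_B(\nabla^Bw,\nabla^Bc)}{wc}+\frac{\Delta_Bw}{w}+(k-1)\frac{g_B(\nabla^Bw,\nabla^Bw)}{w^2}\right].$$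
   Context: $g=(c\circ\pi)^2\pi^*g_B+(w\circ\pi)^2\sigma^*g_F$ where $\pi:B\times F\to B$ and $\sigma:B\times F\to F$ are the projections (a "base conformal warped product"). $\mathfrak{L}(B)$ and $\mathfrak{L}(F)$ denote the sets of lifts to $B\times F$ of vector fields on $B$ and on $F$; objects on $B$, $F$ are identified with their lifts/pullbacks. $\nabla^B$, $\mathrm{H}_B$, $\Delta_B$, $\mathrm{Ric}_B$ are gradient, Hessian ($\mathrm{H}_B^v(X,Y)=XYv-(\nabla^B_XY)v$), Laplace–Beltrami operator (trace of the Hessian) and Ricci tensor of $(B,g_B)$; $\mathrm{Ric}_F$ is the Ricci tensor of $(F,g_F)$. Sign convention: $R(X,Y)Z=\nabla_X\nabla_YZ-\nabla_Y\nabla_XZ-\nabla_{[X,Y]}Z$, $\mathrm{Ric}(X,Y)=\sum_i h(E_i,E_i)\,h(R(E_i,Y)X,E_i)$ for an orthonormal frame $\{E_i\}$ of a pseudo-Riemannian metric $h$. *)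

theory Defs
  imports "HOL-Analysis.Analysis"
begin

section \<open>Smooth manifolds\<close>

fun Ck_on :: "nat \<Rightarrow> 'a::euclidean_space set \<Rightarrow> ('a \<Rightarrow> 'b::real_normed_vector) \<Rightarrow> bool" where
  "Ck_on 0 S f \<longleftrightarrow> continuous_on S f"
| "Ck_on (Suc n) S f \<longleftrightarrow>
     (\<forall>x\<in>S. f differentiable (at x)) \<and>
     (\<forall>v. Ck_on n S (\<lambda>x. frechet_derivative f (at x) v))"

text \<open>Only used for open \<open>S\<close>.\<close>
definition smooth_on :: "'a::euclidean_space set \<Rightarrow> ('a \<Rightarrow> 'b::real_normed_vector) \<Rightarrow> bool" where
  "smooth_on S f \<longleftrightarrow> (\<forall>n. Ck_on n S f)"

text \<open>
  A chart is a pair of its domain and a map into the model space \<open>'a\<close>, so the dimension of the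
  manifold is \<open>DIM('a)\<close>. A manifold is given by an atlas (not necessarily maximal); its points are
  those in the union of the chart domains, an open subset of the topological space \<open>'p\<close>.
\<close>
type_synonym ('p, 'a) atlas = "('p set \<times> ('p \<Rightarrow> 'a)) set"

definition points :: "('p, 'a) atlas \<Rightarrow> 'p set" where
  "points A = (\<Union>(U, \<phi>)\<in>A. U)"

definition smooth_atlas ::
    "('p::{t2_space,second_countable_topology}, 'a::euclidean_space) atlas \<Rightarrow> bool" where
  "smooth_atlas A \<longleftrightarrow>
     (\<forall>(U, \<phi>)\<in>A. open U \<and> open (\<phi> ` U) \<and> homeomorphism U (\<phi> ` U) \<phi> (inv_into U \<phi>)) \<and>
     (\<forall>(U, \<phi>)\<in>A. \<forall>(V, \<psi>)\<in>A. smooth_on (\<phi> ` (U \<inter> V)) (\<psi> \<circ> inv_into U \<phi>))"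

definition open_in :: "('p::{t2_space,second_countable_topology}, 'a::euclidean_space) atlas \<Rightarrow> 'p set \<Rightarrow> bool" where
  "open_in A W \<longleftrightarrow> open W \<and> W \<subseteq> points A"

definition smooth_fun ::
    "('p::{t2_space,second_countable_topology}, 'a::euclidean_space) atlas \<Rightarrow> 'p set \<Rightarrow> ('p \<Rightarrow> real) \<Rightarrow> bool" where
  "smooth_fun A W f \<longleftrightarrow> (\<forall>(U, \<phi>)\<in>A. smooth_on (\<phi> ` (U \<inter> W)) (f \<circ> inv_into U \<phi>))"

definition smooth_near ::
    "('p::{t2_space,second_countable_topology}, 'a::euclidean_space) atlas \<Rightarrow> 'p \<Rightarrow> ('p \<Rightarrow> real) \<Rightarrow> bool" where
  "smooth_near A p f \<longleftrightarrow> (\<exists>W. open_in A W \<and> p \<in> W \<and> smooth_fun A W f)"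

definition product_atlas :: "('p, 'a) atlas \<Rightarrow> ('q, 'b) atlas \<Rightarrow> ('p \<times> 'q, 'a \<times> 'b) atlas" where
  "product_atlas A A' = {(U \<times> V, map_prod \<phi> \<psi>) | U \<phi> V \<psi>. (U, \<phi>) \<in> A \<and> (V, \<psi>) \<in> A'}"


section \<open>Tangent vectors and vector fields\<close>

text \<open>
  A tangent vector at \<open>p\<close> is a directional derivative, acting on the functions that are smooth
  near \<open>p\<close>. As HOL functions are total, the value on all other functions is set to \<open>0\<close>; thus
  tangent vectors are equal iff they agree on all functions smooth near \<open>p\<close>. The application
  \<open>X p f\<close> of a vector field is \<open>(X f)(p)\<close>.
\<close>
type_synonym 'p tangent = "('p \<Rightarrow> real) \<Rightarrow> real"
type_synonym 'p vfield = "'p \<Rightarrow> 'p tangent"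

definition chart_derivative ::
    "('p::{t2_space,second_countable_topology}, 'a::euclidean_space) atlas \<Rightarrow>
       'p set \<Rightarrow> ('p \<Rightarrow> 'a) \<Rightarrow> 'p \<Rightarrow> 'a \<Rightarrow> 'p tangent" where
  "chart_derivative A U \<phi> p v =
     (\<lambda>f. if smooth_near A p f then frechet_derivative (f \<circ> inv_into U \<phi>) (at (\<phi> p)) v else 0)"

definition tangent_space ::
    "('p::{t2_space,second_countable_topology}, 'a::euclidean_space) atlas \<Rightarrow> 'p \<Rightarrow> 'p tangent set" where
  "tangent_space A p = {chart_derivative A U \<phi> p v | U \<phi> v. (U, \<phi>) \<in> A \<and> p \<in> U}"

text \<open>
  \<open>vector_field A W X\<close>: \<open>X\<close> restricts to a smooth vector field on the open set \<open>W\<close>; the values of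
  \<open>X\<close> outside \<open>W\<close> are irrelevant.
\<close>
definition vector_field ::
    "('p::{t2_space,second_countable_topology}, 'a::euclidean_space) atlas \<Rightarrow> 'p set \<Rightarrow> 'p vfield \<Rightarrow> bool" where
  "vector_field A W X \<longleftrightarrow>
     (\<forall>p\<in>W. X p \<in> tangent_space A p) \<and>
     (\<forall>V f. open_in A V \<and> V \<subseteq> W \<and> smooth_fun A V f \<longrightarrow> smooth_fun A V (\<lambda>p. X p f))"

definition lie_bracket ::
    "('p::{t2_space,second_countable_topology}, 'a::euclidean_space) atlas \<Rightarrow> 'p vfield \<Rightarrow> 'p vfield \<Rightarrow> 'p vfield" where
  "lie_bracket A X Y =
     (\<lambda>p f. if smooth_near A p f then X p (\<lambda>q. Y q f) - Y p (\<lambda>q. X q f) else 0)"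

text \<open>
  The differential at \<open>p\<close> of a smooth map \<open>h\<close> into the manifold with atlas \<open>N\<close>, applied to a
  tangent vector \<open>x\<close> at \<open>p\<close>.
\<close>
definition differential ::
    "('q::{t2_space,second_countable_topology}, 'b::euclidean_space) atlas \<Rightarrow>
       ('p \<Rightarrow> 'q) \<Rightarrow> 'p \<Rightarrow> 'p tangent \<Rightarrow> 'q tangent" where
  "differential N h p x = (\<lambda>f. if smooth_near N (h p) f then x (f \<circ> h) else 0)"

text \<open>
  The lifts to the product of a vector field on the first and on the second factor: the tangent
  vector at \<open>(p, q)\<close> is the image of \<open>X p\<close> under the inclusion of the leaf through \<open>(p, q)\<close>.
\<close>
definition lift_base ::
    "('p::{t2_space,second_countable_topology}, 'a::euclidean_space) atlas \<Rightarrow>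
     ('q::{t2_space,second_countable_topology}, 'b::euclidean_space) atlas \<Rightarrow>
       'p vfield \<Rightarrow> ('p \<times> 'q) vfield" where
  "lift_base A A' X = (\<lambda>(p, q). differential (product_atlas A A') (\<lambda>p'. (p', q)) p (X p))"

definition lift_fiber ::
    "('p::{t2_space,second_countable_topology}, 'a::euclidean_space) atlas \<Rightarrow>
     ('q::{t2_space,second_countable_topology}, 'b::euclidean_space) atlas \<Rightarrow>
       'q vfield \<Rightarrow> ('p \<times> 'q) vfield" where
  "lift_fiber A A' V = (\<lambda>(p, q). differential (product_atlas A A') (\<lambda>q'. (p, q')) q (V q))"


section \<open>Pseudo-Riemannian metrics\<close>

type_synonym 'p metric = "'p \<Rightarrow> 'p tangent \<Rightarrow> 'p tangent \<Rightarrow> real"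

definition pseudo_riemannian ::
    "('p::{t2_space,second_countable_topology}, 'a::euclidean_space) atlas \<Rightarrow> 'p metric \<Rightarrow> bool" where
  "pseudo_riemannian A g \<longleftrightarrow>
     smooth_atlas A \<and>
     (\<forall>p\<in>points A.
        (\<forall>x\<in>tangent_space A p. \<forall>y\<in>tangent_space A p. g p x y = g p y x) \<and>
        (\<forall>x\<in>tangent_space A p. \<forall>y\<in>tangent_space A p. \<forall>z\<in>tangent_space A p. \<forall>a b.
           g p (\<lambda>f. a * x f + b * y f) z = a * g p x z + b * g p y z) \<and>
        (\<forall>x\<in>tangent_space A p. (\<forall>y\<in>tangent_space A p. g p x y = 0) \<longrightarrow> x = (\<lambda>_. 0))) \<and>
     (\<forall>W X Y. open_in A W \<and> vector_field A W X \<and> vector_field A W Y \<longrightarrow>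
        smooth_fun A W (\<lambda>p. g p (X p) (Y p)))"

definition base_conformal_warped ::
    "('p::{t2_space,second_countable_topology}, 'a::euclidean_space) atlas \<Rightarrow>
     ('q::{t2_space,second_countable_topology}, 'b::euclidean_space) atlas \<Rightarrow>
       ('p \<Rightarrow> real) \<Rightarrow> ('p \<Rightarrow> real) \<Rightarrow> 'p metric \<Rightarrow> 'q metric \<Rightarrow> ('p \<times> 'q) metric" where
  "base_conformal_warped A A' c w g g' = (\<lambda>z x y.
     (c (fst z))\<^sup>2 * g (fst z) (differential A fst z x) (differential A fst z y) +
     (w (fst z))\<^sup>2 * g' (snd z) (differential A' snd z x) (differential A' snd z y))"

definition affine_connection ::
    "('p::{t2_space,second_countable_topology}, 'a::euclidean_space) atlas \<Rightarrow>
       ('p vfield \<Rightarrow> 'p vfield \<Rightarrow> 'p vfield) \<Rightarrow> bool" where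
  "affine_connection A D \<longleftrightarrow>
     (\<forall>W. open_in A W \<longrightarrow>
       (\<forall>X Y. vector_field A W X \<and> vector_field A W Y \<longrightarrow> vector_field A W (D X Y)) \<and>
       (\<forall>X X' Y h h'. vector_field A W X \<and> vector_field A W X' \<and> vector_field A W Y \<and>
           smooth_fun A W h \<and> smooth_fun A W h' \<longrightarrow>
         (\<forall>p\<in>W. D (\<lambda>q f. h q * X q f + h' q * X' q f) Y p =
                  (\<lambda>f. h p * D X Y p f + h' p * D X' Y p f))) \<and>
       (\<forall>X Y Y'. vector_field A W X \<and> vector_field A W Y \<and> vector_field A W Y' \<longrightarrow>
         (\<forall>p\<in>W. D X (\<lambda>q f. Y q f + Y' q f) p = (\<lambda>f. D X Y p f + D X Y' p f))) \<and>
       (\<forall>X Y h. vector_field A W X \<and> vector_field A W Y \<and> smooth_fun A W h \<longrightarrow>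
         (\<forall>p\<in>W. D X (\<lambda>q f. h q * Y q f) p = (\<lambda>f. X p h * Y p f + h p * D X Y p f))))"

text \<open>
  Connections act on vector fields defined on arbitrary open sets \<open>W\<close>, compatibly with restriction.
\<close>
definition is_levi_civita ::
    "('p::{t2_space,second_countable_topology}, 'a::euclidean_space) atlas \<Rightarrow> 'p metric \<Rightarrow>
       ('p vfield \<Rightarrow> 'p vfield \<Rightarrow> 'p vfield) \<Rightarrow> bool" where
  "is_levi_civita A g D \<longleftrightarrow>
     affine_connection A D \<and>
     (\<forall>W X Y. open_in A W \<and> vector_field A W X \<and> vector_field A W Y \<longrightarrow>
        (\<forall>p\<in>W. (\<lambda>f. D X Y p f - D Y X p f) = lie_bracket A X Y p)) \<and>
     (\<forall>W X Y Z. open_in A W \<and> vector_field A W X \<and> vector_field A W Y \<and> vector_field A W Z \<longrightarrow>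
        (\<forall>p\<in>W. X p (\<lambda>q. g q (Y q) (Z q)) = g p (D X Y p) (Z p) + g p (Y p) (D X Z p)))"

text \<open>
  By the fundamental theorem of pseudo-Riemannian geometry such a \<open>D\<close> exists, and its values at the
  points of \<open>W\<close> on vector fields smooth on \<open>W\<close> are unique.
\<close>
definition levi_civita ::
    "('p::{t2_space,second_countable_topology}, 'a::euclidean_space) atlas \<Rightarrow> 'p metric \<Rightarrow>
       'p vfield \<Rightarrow> 'p vfield \<Rightarrow> 'p vfield" where
  "levi_civita A g = (SOME D. is_levi_civita A g D)"


section \<open>Gradient, Hessian, Laplacian and Ricci tensor\<close>

definition gradient ::
    "('p::{t2_space,second_countable_topology}, 'a::euclidean_space) atlas \<Rightarrow> 'p metric \<Rightarrow>
       ('p \<Rightarrow> real) \<Rightarrow> 'p vfield" where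
  "gradient A g v p =
     (THE x. x \<in> tangent_space A p \<and> (\<forall>y\<in>tangent_space A p. g p x y = y v))"

definition hessian ::
    "('p::{t2_space,second_countable_topology}, 'a::euclidean_space) atlas \<Rightarrow> 'p metric \<Rightarrow>
       ('p \<Rightarrow> real) \<Rightarrow> 'p vfield \<Rightarrow> 'p vfield \<Rightarrow> 'p \<Rightarrow> real" where
  "hessian A g v X Y p = X p (\<lambda>q. Y q v) - levi_civita A g X Y p v"

text \<open>
  Smooth vector fields near \<open>p\<close> whose values at \<open>p\<close> form an orthonormal basis of the tangent space.
  The sums below are tensorial in the frame, so they depend only on these values, and they are
  independent of the chosen basis.
\<close>
definition orthonormal_frame ::
    "('p::{t2_space,second_countable_topology}, 'a::euclidean_space) atlas \<Rightarrow> 'p metric \<Rightarrow> 'p \<Rightarrow>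
       (nat \<Rightarrow> 'p vfield) \<Rightarrow> bool" where
  "orthonormal_frame A g p E \<longleftrightarrow>
     (\<exists>W. open_in A W \<and> p \<in> W \<and> (\<forall>i<DIM('a). vector_field A W (E i))) \<and>
     (\<forall>i<DIM('a). \<bar>g p (E i p) (E i p)\<bar> = 1) \<and>
     (\<forall>i<DIM('a). \<forall>j<DIM('a). i \<noteq> j \<longrightarrow> g p (E i p) (E j p) = 0)"

definition laplacian ::
    "('p::{t2_space,second_countable_topology}, 'a::euclidean_space) atlas \<Rightarrow> 'p metric \<Rightarrow>
       ('p \<Rightarrow> real) \<Rightarrow> 'p \<Rightarrow> real" where
  "laplacian A g v p =
     (let E = (SOME E. orthonormal_frame A g p E)
      in \<Sum>i<DIM('a). g p (E i p) (E i p) * hessian A g v (E i) (E i) p)"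

definition curvature ::
    "('p::{t2_space,second_countable_topology}, 'a::euclidean_space) atlas \<Rightarrow> 'p metric \<Rightarrow>
       'p vfield \<Rightarrow> 'p vfield \<Rightarrow> 'p vfield \<Rightarrow> 'p vfield" where
  "curvature A g X Y Z = (let D = levi_civita A g in
     (\<lambda>p f. D X (D Y Z) p f - D Y (D X Z) p f - D (lie_bracket A X Y) Z p f))"

definition ricci ::
    "('p::{t2_space,second_countable_topology}, 'a::euclidean_space) atlas \<Rightarrow> 'p metric \<Rightarrow>
       'p vfield \<Rightarrow> 'p vfield \<Rightarrow> 'p \<Rightarrow> real" where
  "ricci A g X Y p =
     (let E = (SOME E. orthonormal_frame A g p E)
      in \<Sum>i<DIM('a). g p (E i p) (E i p) * g p (curvature A g (E i) Y X p) (E i p))"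

end

theory Submission
  imports Defs
begin

text \<open>
  In a chart with metric coefficients \<open>G\<close> the Levi-Civita connection is \<open>dY(X) + \<Gamma>(X, Y)\<close>, where
  \<open>\<Gamma>\<close>, the Christoffel symbols, is the only symmetric family compatible with \<open>G\<close>. The curvature is
  the tensor \<open>R(x, y)u = d\<Gamma>(x)(y, u) - d\<Gamma>(y)(x, u) + \<Gamma>(x, \<Gamma>(y, u)) - \<Gamma>(y, \<Gamma>(x, u))\<close>, and expanding
  the standard basis in an orthonormal one turns \<open>Ric(X, Y)\<close> into the coordinate trace of
  \<open>e \<mapsto> R(e, Y)X\<close>, so that no adapted frame is needed on the product. In a product chart the
  Christoffel symbols of the warped metric are those of the factors plus a tensor built from
  \<open>dc/c\<close>, \<open>dw/w\<close> and the gradients of \<open>c\<close> and \<open>w\<close>; by uniqueness, only compatibility has to be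
  checked. The trace over \<open>e\<close> splits into a base and a fiber part, and each of the three formulas
  becomes a direct computation.
\<close>

section \<open>Smooth functions on open subsets of Euclidean spaces\<close>

text \<open>The connection, the frame and the gradient are picked by choice or description
  operators, so nothing is known about them until existence is proved, together with uniqueness as
  far as the results depend on the choice. For the connection this means the whole fundamental
  theorem: a connection is glued from the charts, and pointwise uniqueness makes the result
  independent of the chart picked at each point. Metrics may be indefinite, which rules out
  estimates by Cauchy-Schwarz and plain Gram-Schmidt: smooth dependence of gradients and Christoffel
  symbols on the point comes from a locally uniform nondegeneracy estimate, and orthonormal bases
  are built by stepping around null vectors. Tensors are families that are linear in their vector
  arguments and smooth in the point for fixed vectors; expansion over \<open>Basis\<close> reduces
  statements about moving arguments to finite sums. Geometrically, the metric is a warped product of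
  the conformal metric \<open>c^2 gB\<close> with the fiber, which explains the shape of the
  curvature terms.\<close>

abbreviation fderiv ::
    "('a::real_normed_vector \<Rightarrow> 'b::real_normed_vector) \<Rightarrow> 'a \<Rightarrow> 'a \<Rightarrow> 'b" where
  "fderiv f x \<equiv> frechet_derivative f (at x)"

text \<open>\<open>frechet_derivative\<close> is a choice among the derivatives at the point.
  Functions that agree near the point have the same derivatives there, so the choices coincide even
  where no derivative exists.\<close>

lemma frechet_derivative_cong_open:
  assumes "open S" "x \<in> S" "\<And>y. y \<in> S \<Longrightarrow> f y = g y"
  shows "f differentiable (at x) \<longleftrightarrow> g differentiable (at x)"
    and "fderiv f x = fderiv g x"
proof -
  have *: "(f has_derivative f') (at x) \<longleftrightarrow> (g has_derivative f') (at x)" for f'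
    using has_derivative_transform_within_open[of f f' x UNIV S g]
      has_derivative_transform_within_open[of g f' x UNIV S f] assms by auto
  show "f differentiable (at x) \<longleftrightarrow> g differentiable (at x)"
    by (simp add: differentiable_def *)
  show "fderiv f x = fderiv g x"
    by (simp add: frechet_derivative_def *)
qed

lemma Ck_on_cong:
  assumes "open S" "\<And>x. x \<in> S \<Longrightarrow> f x = g x"
  shows "Ck_on n S f \<longleftrightarrow> Ck_on n S g"
  using assms(2)
proof (induction n arbitrary: f g)
  case 0
  then show ?case by (simp cong: continuous_on_cong)
next
  case (Suc n)
  have "Ck_on n S (\<lambda>x. fderiv f x v) = Ck_on n S (\<lambda>x. fderiv g x v)" for v
    by (rule Suc.IH) (metis assms(1) Suc.prems frechet_derivative_cong_open(2))
  moreover have "(\<forall>x\<in>S. f differentiable (at x)) \<longleftrightarrow> (\<forall>x\<in>S. g differentiable (at x))"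
    by (metis assms(1) Suc.prems frechet_derivative_cong_open(1))
  ultimately show ?case by simp
qed

lemma Ck_on_subset: "Ck_on n S f \<Longrightarrow> T \<subseteq> S \<Longrightarrow> Ck_on n T f"
  by (induction n arbitrary: f) (auto intro: continuous_on_subset)

lemma Ck_on_local:
  assumes "\<And>x. x \<in> S \<Longrightarrow> \<exists>T. open T \<and> x \<in> T \<and> Ck_on n T f"
  shows "Ck_on n S f"
  using assms
proof (induction n arbitrary: f)
  case 0
  then show ?case
    by (auto intro!: continuous_at_imp_continuous_on) (metis continuous_on_eq_continuous_at)
next
  case (Suc n)
  show ?case
    unfolding Ck_on.simps
  proof (intro conjI ballI allI)
    fix x assume "x \<in> S"
    with Suc.prems show "f differentiable (at x)" by (metis Ck_on.simps(2))
  next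
    fix v
    show "Ck_on n S (\<lambda>x. fderiv f x v)"
    proof (rule Suc.IH)
      fix x assume "x \<in> S"
      with Suc.prems obtain T where "open T" "x \<in> T" "Ck_on (Suc n) T f" by blast
      then show "\<exists>T. open T \<and> x \<in> T \<and> Ck_on n T (\<lambda>x. fderiv f x v)" by auto
    qed
  qed
qed

lemma Ck_on_continuous: "Ck_on n S f \<Longrightarrow> continuous_on S f"
proof (cases n)
  case (Suc m)
  moreover assume "Ck_on n S f"
  ultimately have "\<forall>x\<in>S. isCont f x" by (simp add: differentiable_imp_continuous_within)
  then show ?thesis by (rule continuous_at_imp_continuous_on)
qed simp

lemma Ck_on_SucD: "Ck_on (Suc n) S f \<Longrightarrow> Ck_on n S f"
proof (induction n arbitrary: f)
  case 0
  show ?case using Ck_on_continuous[OF 0] by simp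
next
  case (Suc n)
  then show ?case by (metis Ck_on.simps(2))
qed

lemma Ck_on_const: "Ck_on n S (\<lambda>x. c)"
  by (induction n arbitrary: c) auto

lemma frechet_derivative_bounded_linear:
  assumes "bounded_linear f"
  shows "fderiv f x = f"
  using frechet_derivative_at[OF bounded_linear_imp_has_derivative[OF assms]] by simp

lemma Ck_on_bounded_linear:
  assumes "bounded_linear f"
  shows "Ck_on n S f"
proof (cases n)
  case 0
  then show ?thesis using assms by (simp add: linear_continuous_on)
next
  case (Suc m)
  then show ?thesis
    using assms by (auto simp: frechet_derivative_bounded_linear Ck_on_const
        bounded_linear_imp_differentiable)
qed

text \<open>Lets the derivative be supplied in any closed form instead of as the chosen
  \<open>frechet_derivative\<close>; the inductive closure properties below pass through this
  rule.\<close>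

lemma Ck_on_SucI:
  assumes "open S" and d: "\<And>x. x \<in> S \<Longrightarrow> (f has_derivative f' x) (at x)"
    and "\<And>v. Ck_on n S (\<lambda>x. f' x v)"
  shows "Ck_on (Suc n) S f"
proof -
  have "Ck_on n S (\<lambda>x. fderiv f x v)" for v
    by (rule Ck_on_cong[THEN iffD1, OF assms(1) _ assms(3)])
        (simp add: frechet_derivative_at[OF d, symmetric])
  then show ?thesis using d by (auto simp: differentiable_def)
qed

lemma Ck_on_Suc_has_derivative:
  "Ck_on (Suc n) S f \<Longrightarrow> x \<in> S \<Longrightarrow> (f has_derivative fderiv f x) (at x)"
  by (simp add: frechet_derivative_works[symmetric])

lemma Ck_on_Suc_derivative: "Ck_on (Suc n) S f \<Longrightarrow> Ck_on n S (\<lambda>x. fderiv f x v)"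
  by simp

lemma Ck_on_bounded_linear_compose:
  assumes L: "bounded_linear L" and S: "open S" and "Ck_on n S f"
  shows "Ck_on n S (\<lambda>x. L (f x))"
  using assms(3)
proof (induction n arbitrary: f)
  case 0
  then show ?case using L by (auto intro: bounded_linear.continuous_on)
next
  case (Suc n)
  show ?case
    by (rule Ck_on_SucI[OF S bounded_linear.has_derivative[OF L Ck_on_Suc_has_derivative[OF Suc.prems]]])
       (assumption | rule Suc.IH[OF Ck_on_Suc_derivative[OF Suc.prems]])+
qed

lemma Ck_on_add:
  assumes S: "open S" and "Ck_on n S f" "Ck_on n S g"
  shows "Ck_on n S (\<lambda>x. f x + g x)"
  using assms(2,3)
proof (induction n arbitrary: f g)
  case 0
  then show ?case by (auto intro: continuous_intros)
next
  case (Suc n)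
  show ?case
    by (rule Ck_on_SucI[OF S has_derivative_add[OF Suc.prems[THEN Ck_on_Suc_has_derivative]]])
       (simp_all only: Suc.IH Suc.prems[THEN Ck_on_Suc_derivative])
qed

lemma Ck_on_bilinear:
  assumes P: "bounded_bilinear P" and S: "open S" and "Ck_on n S f" "Ck_on n S g"
  shows "Ck_on n S (\<lambda>x. P (f x) (g x))"
  using assms(3,4)
proof (induction n arbitrary: f g)
  case 0
  then show ?case using P by (auto intro: bounded_bilinear.continuous_on)
next
  case (Suc n)
  show ?case
    by (rule Ck_on_SucI[OF S bounded_bilinear.FDERIV[OF P Suc.prems[THEN Ck_on_Suc_has_derivative]]])
       (simp_all only: Ck_on_add[OF S] Suc.IH Suc.prems[THEN Ck_on_Suc_derivative]
           Suc.prems[THEN Ck_on_SucD])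
qed

lemma Ck_on_sum:
  assumes "open S" "\<And>i. i \<in> I \<Longrightarrow> Ck_on n S (f i)"
  shows "Ck_on n S (\<lambda>x. \<Sum>i\<in>I. f i x)"
  using assms(2) by (induction I rule: infinite_finite_induct) (auto intro: Ck_on_const Ck_on_add
      assms(1))

lemma linear_eq_sum_Basis:
  fixes f :: "'a::euclidean_space \<Rightarrow> 'b::real_vector"
  assumes "linear f"
  shows "f x = (\<Sum>b\<in>Basis. (x \<bullet> b) *\<^sub>R f b)"
proof -
  have "f x = f (\<Sum>b\<in>Basis. (x \<bullet> b) *\<^sub>R b)" by (simp add: euclidean_representation)
  also have "\<dots> = (\<Sum>b\<in>Basis. (x \<bullet> b) *\<^sub>R f b)" using assms by (simp add: linear_sum linear_scale)
  finally show ?thesis .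
qed

lemma Ck_on_compose:
  fixes f :: "'b::euclidean_space \<Rightarrow> 'c::real_normed_vector" and g :: "'a::euclidean_space \<Rightarrow> 'b"
  assumes S: "open S" and T: "open T" and gT: "g ` S \<subseteq> T" and f: "Ck_on n T f" and g: "Ck_on n S g"
  shows "Ck_on n S (\<lambda>x. f (g x))"
  using f g
proof (induction n arbitrary: f)
  case 0
  then show ?case using gT by (auto intro: continuous_on_compose2)
next
  case (Suc n)
  have fT: "(f has_derivative fderiv f (g x)) (at (g x))" if "x \<in> S" for x
    using gT that by (intro Ck_on_Suc_has_derivative[OF Suc.prems(1)]) auto
  show ?case
  proof (rule Ck_on_SucI[OF S has_derivative_compose[OF Ck_on_Suc_has_derivative[OF Suc.prems(2)] fT]])
    fix v
    \<comment> \<open>The induction hypothesis covers \<open>fderiv f (g x) b\<close> only for a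
      fixed direction \<open>b\<close>, whereas the chain rule has a direction that varies with
      \<open>x\<close>; expanding that direction over \<open>Basis\<close> separates the
      two.\<close>
    have "Ck_on n S (\<lambda>x. \<Sum>b\<in>Basis. (fderiv g x v \<bullet> b) *\<^sub>R fderiv f (g x) b)"
      by (intro Ck_on_sum[OF S] Ck_on_bilinear[OF bounded_bilinear_scaleR S]
          Ck_on_bounded_linear_compose[OF bounded_linear_inner_left S] Suc.IH
          Suc.prems[THEN Ck_on_Suc_derivative] Ck_on_SucD[OF Suc.prems(2)])
    then show "Ck_on n S (\<lambda>x. fderiv f (g x) (fderiv g x v))"
      by (rule Ck_on_cong[THEN iffD1, OF S, rotated])
         (rule linear_eq_sum_Basis[OF has_derivative_linear[OF fT], symmetric])
  qed
qed

section \<open>Closure properties of smooth functions\<close>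

lemma smooth_on_cong:
  "open S \<Longrightarrow> (\<And>x. x \<in> S \<Longrightarrow> f x = g x) \<Longrightarrow> smooth_on S f \<longleftrightarrow> smooth_on S g"
  unfolding smooth_on_def using Ck_on_cong by blast

lemma smooth_on_subset: "smooth_on S f \<Longrightarrow> T \<subseteq> S \<Longrightarrow> smooth_on T f"
  unfolding smooth_on_def using Ck_on_subset by blast

lemma smooth_on_local:
  "(\<And>x. x \<in> S \<Longrightarrow> \<exists>T. open T \<and> x \<in> T \<and> smooth_on T f) \<Longrightarrow> smooth_on S f"
  unfolding smooth_on_def by (meson Ck_on_local)

lemma smooth_on_continuous: "smooth_on S f \<Longrightarrow> continuous_on S f"
  unfolding smooth_on_def using Ck_on_continuous by blast

lemma smooth_on_differentiable: "smooth_on S f \<Longrightarrow> x \<in> S \<Longrightarrow> f differentiable (at x)"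
  unfolding smooth_on_def using Ck_on.simps(2) by blast

lemma smooth_on_has_derivative:
  "smooth_on S f \<Longrightarrow> x \<in> S \<Longrightarrow> (f has_derivative fderiv f x) (at x)"
  using smooth_on_differentiable frechet_derivative_works by blast

lemma smooth_on_frechet_derivative:
  "smooth_on S f \<Longrightarrow> smooth_on S (\<lambda>x. fderiv f x v)"
  unfolding smooth_on_def by (metis Ck_on.simps(2))

lemma smooth_on_const: "smooth_on S (\<lambda>x. c)"
  by (simp add: smooth_on_def Ck_on_const)

lemma smooth_on_bounded_linear: "bounded_linear f \<Longrightarrow> smooth_on S f"
  by (simp add: smooth_on_def Ck_on_bounded_linear)

lemma smooth_on_bounded_linear_compose:
  "bounded_linear L \<Longrightarrow> open S \<Longrightarrow> smooth_on S f \<Longrightarrow> smooth_on S (\<lambda>x. L (f x))"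
  by (simp add: smooth_on_def Ck_on_bounded_linear_compose)

lemma smooth_on_add:
  "open S \<Longrightarrow> smooth_on S f \<Longrightarrow> smooth_on S g \<Longrightarrow> smooth_on S (\<lambda>x. f x + g x)"
  by (simp add: smooth_on_def Ck_on_add)

lemma smooth_on_minus:
  "open S \<Longrightarrow> smooth_on S f \<Longrightarrow> smooth_on S (\<lambda>x. - f x)"
  by (rule smooth_on_bounded_linear_compose[OF bounded_linear_minus[OF bounded_linear_ident]])

lemma smooth_on_diff:
  "open S \<Longrightarrow> smooth_on S f \<Longrightarrow> smooth_on S g \<Longrightarrow> smooth_on S (\<lambda>x. f x - g x)"
  using smooth_on_add[of S f "\<lambda>x. - g x"] smooth_on_minus[of S g] by simp

lemma smooth_on_scaleR:
  "open S \<Longrightarrow> smooth_on S f \<Longrightarrow> smooth_on S g \<Longrightarrow> smooth_on S (\<lambda>x. f x *\<^sub>R g x)"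
  by (simp add: smooth_on_def Ck_on_bilinear[OF bounded_bilinear_scaleR])

lemma smooth_on_mult:
  fixes f g :: "'a::euclidean_space \<Rightarrow> real"
  shows "open S \<Longrightarrow> smooth_on S f \<Longrightarrow> smooth_on S g \<Longrightarrow> smooth_on S (\<lambda>x. f x * g x)"
  by (simp add: smooth_on_def Ck_on_bilinear[OF bounded_bilinear_mult])

lemma smooth_on_inner_left:
  "open S \<Longrightarrow> smooth_on S f \<Longrightarrow> smooth_on S (\<lambda>x. f x \<bullet> b)"
  by (rule smooth_on_bounded_linear_compose[OF bounded_linear_inner_left])

lemma smooth_on_sum:
  "open S \<Longrightarrow> (\<And>i. i \<in> I \<Longrightarrow> smooth_on S (f i)) \<Longrightarrow> smooth_on S (\<lambda>x. \<Sum>i\<in>I. f i x)"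
  by (simp add: smooth_on_def Ck_on_sum)

lemma smooth_on_compose:
  "open S \<Longrightarrow> open T \<Longrightarrow> g ` S \<subseteq> T \<Longrightarrow> smooth_on T f \<Longrightarrow> smooth_on S g \<Longrightarrow> smooth_on S (\<lambda>x. f (g x))"
  by (simp add: smooth_on_def Ck_on_compose)

lemma smooth_on_componentwise:
  assumes "open S" "\<And>b. b \<in> Basis \<Longrightarrow> smooth_on S (\<lambda>x. f x \<bullet> b)"
  shows "smooth_on S f"
proof -
  have "smooth_on S (\<lambda>x. \<Sum>b\<in>Basis. (f x \<bullet> b) *\<^sub>R b)"
    by (intro smooth_on_sum smooth_on_scaleR smooth_on_const assms)
  then show ?thesis by (simp add: euclidean_representation)
qed

text \<open>Regularity for each fixed argument suffices, since linearity over a finite-dimensional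
  space turns the moving argument into finitely many coefficients. Tensor fields in charts are
  handled in this way throughout.\<close>

lemma Ck_on_linear_family:
  fixes X :: "'c::euclidean_space \<Rightarrow> 'a::euclidean_space"
  assumes "open S" "\<And>z. z \<in> S \<Longrightarrow> linear (f z)" "\<And>v. Ck_on n S (\<lambda>z. f z v)" "Ck_on n S X"
  shows "Ck_on n S (\<lambda>z. f z (X z))"
proof -
  have "Ck_on n S (\<lambda>z. \<Sum>b\<in>Basis. (X z \<bullet> b) *\<^sub>R f z b)"
    by (intro Ck_on_sum Ck_on_bilinear[OF bounded_bilinear_scaleR]
        Ck_on_bounded_linear_compose[OF bounded_linear_inner_left] assms)
  then show ?thesis
    by (rule Ck_on_cong[THEN iffD1, OF \<open>open S\<close>, rotated])
       (rule linear_eq_sum_Basis[OF assms(2), symmetric])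
qed

lemma smooth_on_linear_family:
  fixes X :: "'c::euclidean_space \<Rightarrow> 'a::euclidean_space"
  assumes "open S" "\<And>z. z \<in> S \<Longrightarrow> linear (f z)" "\<And>v. smooth_on S (\<lambda>z. f z v)" "smooth_on S X"
  shows "smooth_on S (\<lambda>z. f z (X z))"
  unfolding smooth_on_def
proof
  show "Ck_on n S (\<lambda>z. f z (X z))" for n
    by (rule Ck_on_linear_family[OF assms(1,2)]) (use assms(3,4) in \<open>auto simp: smooth_on_def\<close>)
qed

text \<open>Differentiate \<open>f z (u + v) = f z u + f z v\<close> and
  \<open>f z (r *\<^sub>R v) = r *\<^sub>R f z v\<close> in \<open>z\<close> and compare, using that
  derivatives are unique.\<close>

lemma linear_derivative_linear_family:
  assumes S: "open S" "z \<in> S" and lin: "\<And>z. z \<in> S \<Longrightarrow> linear (f z)"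
    and f: "\<And>v. ((\<lambda>z. f z v) has_derivative (\<lambda>h. f' h v)) (at z)"
  shows "linear (f' h)"
proof (rule linearI)
  fix u v
  have "((\<lambda>z. f z (u + v)) has_derivative (\<lambda>h. f' h u + f' h v)) (at z)"
    by (rule has_derivative_transform_within_open[OF has_derivative_add[OF f f] S])
        (simp add: lin linear_add)
  from has_derivative_unique[OF f this] show "f' h (u + v) = f' h u + f' h v" by metis
next
  fix r v
  have "((\<lambda>z. f z (r *\<^sub>R v)) has_derivative (\<lambda>h. r *\<^sub>R f' h v)) (at z)"
    by (rule has_derivative_transform_within_open[OF has_derivative_scaleR_right[OF f] S])
        (simp add: lin linear_scale)
  from has_derivative_unique[OF f this] show "f' h (r *\<^sub>R v) = r *\<^sub>R f' h v" by metis
qed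

text \<open>The product rule for evaluating \<open>f z\<close> at \<open>X z\<close>. No operator
  norm is involved: after expansion over \<open>Basis\<close> only scalar coefficients of
  \<open>X\<close> and values of \<open>f\<close> on fixed vectors are differentiated.\<close>

lemma has_derivative_linear_family:
  fixes X :: "'c::real_normed_vector \<Rightarrow> 'a::euclidean_space"
    and f :: "'c \<Rightarrow> 'a \<Rightarrow> 'b::real_normed_vector"
  assumes S: "open S" "z \<in> S" and lin: "\<And>z. z \<in> S \<Longrightarrow> linear (f z)"
    and f: "\<And>v. ((\<lambda>z. f z v) has_derivative (\<lambda>h. f' h v)) (at z)"
    and X: "(X has_derivative X') (at z)"
  shows "((\<lambda>z. f z (X z)) has_derivative (\<lambda>h. f' h (X z) + f z (X' h))) (at z)"
proof -
  have lin': "linear (f' h)" for h by (rule linear_derivative_linear_family[OF S lin f])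
  have Xb: "((\<lambda>z. X z \<bullet> b) has_derivative (\<lambda>h. X' h \<bullet> b)) (at z)" for b
    by (rule has_derivative_inner_left[OF X])
  have "((\<lambda>z. \<Sum>b\<in>Basis. (X z \<bullet> b) *\<^sub>R f z b) has_derivative
      (\<lambda>h. \<Sum>b\<in>Basis. (X z \<bullet> b) *\<^sub>R f' h b + (X' h \<bullet> b) *\<^sub>R f z b)) (at z)"
    by (intro has_derivative_sum has_derivative_scaleR f Xb)
  also have "(\<lambda>h. \<Sum>b\<in>Basis. (X z \<bullet> b) *\<^sub>R f' h b + (X' h \<bullet> b) *\<^sub>R f z b) = (\<lambda>h. f' h (X z) + f z (X' h))"
    by (rule ext, subst (2) linear_eq_sum_Basis[OF lin'], subst (2) linear_eq_sum_Basis[OF lin[OF S(2)]])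
       (simp add: sum.distrib)
  finally show ?thesis
    by (rule has_derivative_transform_within_open[OF _ S]) (rule linear_eq_sum_Basis[OF lin, symmetric])
qed

lemma smooth_on_frechet_derivative_along:
  assumes "open S" "smooth_on S f" "smooth_on S X"
  shows "smooth_on S (\<lambda>z. fderiv f z (X z))"
proof (rule smooth_on_linear_family[OF \<open>open S\<close> _ _ \<open>smooth_on S X\<close>])
  show "linear (fderiv f z)" if "z \<in> S" for z
    by (rule linear_frechet_derivative[OF smooth_on_differentiable[OF assms(2) that]])
  show "smooth_on S (\<lambda>z. fderiv f z v)" for v
    by (rule smooth_on_frechet_derivative[OF assms(2)])
qed

section \<open>Symmetry of second derivatives\<close>

text \<open>The mean value theorem is applied twice: to the increment in direction \<open>v\<close>,
  viewed as a function along \<open>u\<close>, and then to the derivative in direction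
  \<open>u\<close>, viewed as a function along \<open>v\<close>.\<close>

lemma second_difference_mvt:
  fixes g :: "'a::real_normed_vector \<Rightarrow> real"
  assumes t: "0 < t"
    and g1: "\<And>a b. 0 \<le> a \<Longrightarrow> a \<le> t \<Longrightarrow> 0 \<le> b \<Longrightarrow> b \<le> t \<Longrightarrow>
      (g has_derivative g' (z + a *\<^sub>R u + b *\<^sub>R v)) (at (z + a *\<^sub>R u + b *\<^sub>R v))"
    and g2: "\<And>a b. 0 \<le> a \<Longrightarrow> a \<le> t \<Longrightarrow> 0 \<le> b \<Longrightarrow> b \<le> t \<Longrightarrow>
      ((\<lambda>y. g' y u) has_derivative g'' (z + a *\<^sub>R u + b *\<^sub>R v)) (at (z + a *\<^sub>R u + b *\<^sub>R v))"
  shows "\<exists>a b. 0 < a \<and> a < t \<and> 0 < b \<and> b < t \<and>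
    g (z + t *\<^sub>R u + t *\<^sub>R v) - g (z + t *\<^sub>R u) - g (z + t *\<^sub>R v) + g z = t * t * g'' (z + a *\<^sub>R u
        + b *\<^sub>R v) v"
proof -
  define F where "F s = g (z + s *\<^sub>R u + t *\<^sub>R v) - g (z + s *\<^sub>R u)" for s
  have line: "((\<lambda>s. g (z + s *\<^sub>R u + b *\<^sub>R v)) has_derivative (\<lambda>h. g' (z + a *\<^sub>R u + b *\<^sub>R v)
      (h *\<^sub>R u))) (at a)"
    if "0 \<le> a" "a \<le> t" "0 \<le> b" "b \<le> t" for a b
    by (rule has_derivative_compose[where g = g and f = "\<lambda>s. z + s *\<^sub>R u + b *\<^sub>R v", OF _ g1[OF that]])
       (auto intro!: derivative_eq_intros)
  have F': "(F has_derivative (\<lambda>h. g' (z + a *\<^sub>R u + t *\<^sub>R v) (h *\<^sub>R u) - g' (z + a *\<^sub>R u)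
      (h *\<^sub>R u))) (at a)"
    if "0 \<le> a" "a \<le> t" for a
    unfolding F_def using has_derivative_diff[OF line[of a t] line[of a 0]] that t by simp
  have "\<exists>a\<in>{0<..<t}. F t - F 0 = (g' (z + a *\<^sub>R u + t *\<^sub>R v) ((t - 0) *\<^sub>R u) - g' (z + a *\<^sub>R u)
      ((t - 0) *\<^sub>R u))"
    by (rule mvt_simple[where f = F
          and f' = "\<lambda>a h. g' (z + a *\<^sub>R u + t *\<^sub>R v) (h *\<^sub>R u) - g' (z + a *\<^sub>R u) (h *\<^sub>R u)", OF t])
       (rule has_derivative_at_withinI[OF F'])
  then obtain a where a: "0 < a" "a < t"
    and Fa: "F t - F 0 = g' (z + a *\<^sub>R u + t *\<^sub>R v) (t *\<^sub>R u) - g' (z + a *\<^sub>R u) (t *\<^sub>R u)"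
    by auto
  have lin: "linear (g' (z + a *\<^sub>R u + b *\<^sub>R v))" if "0 \<le> b" "b \<le> t" for b
    using has_derivative_linear[OF g1[of a b]] a that by auto
  have "F t - F 0 = t * (g' (z + a *\<^sub>R u + t *\<^sub>R v) u - g' (z + a *\<^sub>R u) u)"
    using Fa lin[of t] lin[of 0] t by (simp add: linear_scale right_diff_distrib)
  moreover
  have line2: "((\<lambda>s. g' (z + a *\<^sub>R u + s *\<^sub>R v) u) has_derivative (\<lambda>h. g'' (z + a *\<^sub>R u + b *\<^sub>R v)
      (h *\<^sub>R v))) (at b)"
    if "0 \<le> b" "b \<le> t" for b
    by (rule has_derivative_compose[where g = "\<lambda>y. g' y u" and f = "\<lambda>s. z + a *\<^sub>R u + s *\<^sub>R v", OF _ g2])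
       (use a that in \<open>auto intro!: derivative_eq_intros\<close>)
  have "\<exists>b\<in>{0<..<t}. g' (z + a *\<^sub>R u + t *\<^sub>R v) u - g' (z + a *\<^sub>R u + 0 *\<^sub>R v) u
      = g'' (z + a *\<^sub>R u + b *\<^sub>R v) ((t - 0) *\<^sub>R v)"
    by (rule mvt_simple[where f = "\<lambda>s. g' (z + a *\<^sub>R u + s *\<^sub>R v) u"
          and f' = "\<lambda>b h. g'' (z + a *\<^sub>R u + b *\<^sub>R v) (h *\<^sub>R v)", OF t])
       (rule has_derivative_at_withinI[OF line2])
  then obtain b where b: "0 < b" "b < t"
    and Gb: "g' (z + a *\<^sub>R u + t *\<^sub>R v) u - g' (z + a *\<^sub>R u) u = g'' (z + a *\<^sub>R u + b *\<^sub>R v) (t *\<^sub>R v)"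
    by auto
  have "g'' (z + a *\<^sub>R u + b *\<^sub>R v) (t *\<^sub>R v) = t * g'' (z + a *\<^sub>R u + b *\<^sub>R v) v"
    using has_derivative_linear[OF g2[of a b]] a b by (simp add: linear_scale)
  ultimately have "F t - F 0 = t * (t * g'' (z + a *\<^sub>R u + b *\<^sub>R v) v)" using Gb by simp
  then show ?thesis using a b unfolding F_def by (intro exI[of _ a] exI[of _ b])
      (auto simp: algebra_simps)
qed

text \<open>The second difference over the parallelogram spanned by multiples \<open>t\<close> of
  \<open>u\<close> and \<open>v\<close> is symmetric in \<open>u\<close> and \<open>v\<close>, yet
  equals \<open>t * t\<close> times either mixed derivative at some point of the parallelogram. For
  small \<open>t\<close> both are within \<open>e\<close> of their values at \<open>z\<close>, so
  these values cannot be \<open>2 * e\<close> apart.\<close>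

lemma second_derivative_symmetric_real:
  fixes g :: "'a::euclidean_space \<Rightarrow> real"
  assumes S: "open S" "z \<in> S" and g: "smooth_on S g"
  shows "fderiv (\<lambda>y. fderiv g y u) z v
    = fderiv (\<lambda>y. fderiv g y v) z u"
proof (rule ccontr)
  define Q where "Q u v y = fderiv (\<lambda>y. fderiv g y u) y v" for u v y
  assume "\<not> ?thesis"
  then have ne: "Q u v z \<noteq> Q v u z" by (simp add: Q_def)
  define e where "e = \<bar>Q u v z - Q v u z\<bar> / 2"
  have e: "e > 0" using ne by (simp add: e_def)
  have sQ: "smooth_on S (Q u v)" for u v
    unfolding Q_def by (intro smooth_on_frechet_derivative g)
  have cQ: "isCont (Q u v) z" for u v
    using smooth_on_continuous[OF sQ] S continuous_on_eq_continuous_at by blast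
  obtain d1 where d1: "d1 > 0" "\<And>y. dist y z < d1 \<Longrightarrow> dist (Q u v y) (Q u v z) < e"
    using cQ[of u v] e unfolding continuous_at_eps_delta by blast
  obtain d2 where d2: "d2 > 0" "\<And>y. dist y z < d2 \<Longrightarrow> dist (Q v u y) (Q v u z) < e"
    using cQ[of v u] e unfolding continuous_at_eps_delta by blast
  obtain d3 where d3: "d3 > 0" "\<And>y. dist y z < d3 \<Longrightarrow> y \<in> S"
    using S open_dist by blast
  define d where "d = min d1 (min d2 d3)"
  \<comment> \<open>Small enough to keep the whole parallelogram within distance \<open>d\<close> of
    \<open>z\<close>; the summand 1 keeps the denominator positive when \<open>u\<close> and
    \<open>v\<close> vanish.\<close>
  define t where "t = d / (2 * (norm u + norm v + 1))"
  have d: "d > 0" using d1 d2 d3 by (simp add: d_def)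
  have t: "t > 0" using d by (simp add: t_def add_nonneg_pos)
  \<comment> \<open>Stated for any \<open>p\<close>, \<open>q\<close> with the same total norm, so
    that it serves \<open>u\<close>, \<open>v\<close> in both orders.\<close>
  have near: "dist (z + a *\<^sub>R p + b *\<^sub>R q) z < d"
    if "0 \<le> a" "a \<le> t" "0 \<le> b" "b \<le> t" "norm p + norm q = norm u + norm v" for a b p q
  proof -
    have "norm (a *\<^sub>R p + b *\<^sub>R q) \<le> a * norm p + b * norm q"
      using norm_triangle_ineq[of "a *\<^sub>R p" "b *\<^sub>R q"] that by simp
    also have "\<dots> \<le> t * norm p + t * norm q"
      using that by (intro add_mono mult_right_mono) auto
    also have "\<dots> = t * (norm u + norm v)" using that by (simp add: distrib_left[symmetric])
    also have "\<dots> < t * (2 * (norm u + norm v + 1))" using t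
      by (intro mult_strict_left_mono) (auto simp: add_nonneg_pos)
    also have "\<dots> = d" unfolding t_def
      by (smt (verit, best) nonzero_divide_eq_eq norm_ge_zero)
    finally show ?thesis by (simp add: dist_norm add.assoc)
  qed
  have ex: "\<exists>a b. 0 < a \<and> a < t \<and> 0 < b \<and> b < t \<and>
    g (z + t *\<^sub>R p + t *\<^sub>R q) - g (z + t *\<^sub>R p) - g (z + t *\<^sub>R q) + g z = t * t * Q p q (z + a *\<^sub>R p
        + b *\<^sub>R q)"
    if pq: "norm p + norm q = norm u + norm v" for p q
    unfolding Q_def
  proof (rule second_difference_mvt[OF t])
    fix a b assume ab: "0 \<le> a" "a \<le> t" "0 \<le> b" "b \<le> t"
    then have "z + a *\<^sub>R p + b *\<^sub>R q \<in> S" using near[OF ab pq] d3 by (simp add: d_def)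
    then show "(g has_derivative fderiv g (z + a *\<^sub>R p + b *\<^sub>R q)) (at (z + a *\<^sub>R p + b *\<^sub>R q))"
      "((\<lambda>y. fderiv g y p) has_derivative
        fderiv (\<lambda>y. fderiv g y p) (z + a *\<^sub>R p + b *\<^sub>R q)) (at (z + a *\<^sub>R p + b *\<^sub>R q))"
      by (auto intro: smooth_on_has_derivative g smooth_on_frechet_derivative)
  qed
  obtain a b where ab: "0 < a" "a < t" "0 < b" "b < t"
    "g (z + t *\<^sub>R u + t *\<^sub>R v) - g (z + t *\<^sub>R u) - g (z + t *\<^sub>R v) + g z
        = t * t * Q u v (z + a *\<^sub>R u + b *\<^sub>R v)"
    using ex[of u v] by auto
  obtain a' b' where ab': "0 < a'" "a' < t" "0 < b'" "b' < t"
    "g (z + t *\<^sub>R v + t *\<^sub>R u) - g (z + t *\<^sub>R v) - g (z + t *\<^sub>R u) + g z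
        = t * t * Q v u (z + a' *\<^sub>R v + b' *\<^sub>R u)"
    using ex[of v u] by auto
  have "t * t * Q u v (z + a *\<^sub>R u + b *\<^sub>R v) = t * t * Q v u (z + a' *\<^sub>R v + b' *\<^sub>R u)"
    using ab(5) ab'(5) by (simp add: algebra_simps)
  then have "Q u v (z + a *\<^sub>R u + b *\<^sub>R v) = Q v u (z + a' *\<^sub>R v + b' *\<^sub>R u)" using t by simp
  moreover have "dist (Q u v (z + a *\<^sub>R u + b *\<^sub>R v)) (Q u v z) < e"
    using near[of a b u v] ab by (intro d1) (auto simp: d_def)
  moreover have "dist (Q v u (z + a' *\<^sub>R v + b' *\<^sub>R u)) (Q v u z) < e"
    using near[of a' b' v u] ab' by (intro d2) (auto simp: d_def)
  ultimately show False unfolding e_def dist_real_def by (simp add: abs_if split: if_splits)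
qed

lemma second_derivative_symmetric:
  fixes g :: "'a::euclidean_space \<Rightarrow> 'b::euclidean_space"
  assumes S: "open S" "z \<in> S" and g: "smooth_on S g"
  shows "fderiv (\<lambda>y. fderiv g y u) z v
    = fderiv (\<lambda>y. fderiv g y v) z u"
proof (rule euclidean_eqI)
  fix b :: 'b assume "b \<in> Basis"
  have sb: "smooth_on S (\<lambda>y. g y \<bullet> b)" by (intro smooth_on_inner_left S g)
  have 1: "fderiv (\<lambda>y. g y \<bullet> b) y w = fderiv g y w \<bullet> b" if "y \<in> S" for y w
    using frechet_derivative_at[OF has_derivative_inner_left[OF smooth_on_has_derivative[OF g
        that]], of b]
    by metis
  have 2: "fderiv (\<lambda>y. fderiv (\<lambda>y. g y \<bullet> b) y w) z w'
      = fderiv (\<lambda>y. fderiv g y w) z w' \<bullet> b" for w w'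
  proof -
    have "fderiv (\<lambda>y. fderiv (\<lambda>y. g y \<bullet> b) y w) z w'
        = fderiv (\<lambda>y. fderiv g y w \<bullet> b) z w'"
      by (rule fun_cong, rule frechet_derivative_cong_open[OF S]) (rule 1)
    also have "\<dots> = fderiv (\<lambda>y. fderiv g y w) z w' \<bullet> b"
      using frechet_derivative_at[OF has_derivative_inner_left[OF smooth_on_has_derivative[OF
          smooth_on_frechet_derivative[OF g] S(2)]], of w b] by metis
    finally show ?thesis .
  qed
  show "fderiv (\<lambda>y. fderiv g y u) z v \<bullet> b
    = fderiv (\<lambda>y. fderiv g y v) z u \<bullet> b"
    using second_derivative_symmetric_real[OF S sb] by (simp add: 2)
qed

section \<open>Smooth families of nondegenerate forms\<close>

definition nondegenerate_form :: "('a::euclidean_space \<Rightarrow> 'a \<Rightarrow> real) \<Rightarrow> bool" where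
  "nondegenerate_form G \<longleftrightarrow>
     bilinear G \<and> (\<forall>x y. G x y = G y x) \<and> (\<forall>x. (\<forall>y. G x y = 0) \<longrightarrow> x = 0)"

text \<open>The musical isomorphism that raises an index: the vector representing the covector
  \<alpha>. The description is proper for linear \<alpha> and nondegenerate
  \<open>G\<close>.\<close>

definition sharp :: "('a::euclidean_space \<Rightarrow> 'a \<Rightarrow> real) \<Rightarrow> ('a \<Rightarrow> real) \<Rightarrow> 'a" where
  "sharp G \<alpha> = (THE x. \<forall>y. G x y = \<alpha> y)"

lemma nondegenerate_form_eqI:
  assumes "nondegenerate_form G" "\<And>y. G x y = G x' y"
  shows "x = x'"
proof -
  have "bilinear G" using assms(1) by (simp add: nondegenerate_form_def)
  then have "\<forall>y. G (x - x') y = 0"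
    using assms(2) by (simp add: bilinear_lsub)
  moreover have "\<forall>x. (\<forall>y. G x y = 0) \<longrightarrow> x = 0" using assms(1) by (simp add: nondegenerate_form_def)
  ultimately have "x - x' = 0" by blast
  then show ?thesis by simp
qed

text \<open>Nondegeneracy says that \<open>x \<mapsto> G x\<close> is injective into the dual space,
  which has the same dimension. \<open>L\<close> realizes this map as an endomorphism by listing
  values on \<open>Basis\<close>, so it is also surjective.\<close>

lemma sharp_ex1:
  fixes G :: "'a::euclidean_space \<Rightarrow> 'a \<Rightarrow> real"
  assumes G: "nondegenerate_form G" and \<alpha>: "linear \<alpha>"
  shows "\<exists>!x. \<forall>y. G x y = \<alpha> y"
proof -
  have bil: "bilinear G" using G by (simp add: nondegenerate_form_def)
  define L where "L x = (\<Sum>b\<in>Basis. G x b *\<^sub>R b)" for x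
  have Lb: "L x \<bullet> b = G x b" if "b \<in> Basis" for x b
    using that by (simp add: L_def inner_sum_left inner_Basis if_distrib cong: if_cong)
  have Gl: "linear (G x)" for x using bil by (simp add: bilinear_def)
  have linL: "linear L"
    unfolding L_def using bil
    by (intro linearI) (auto simp: bilinear_ladd bilinear_lmul scaleR_add_left sum.distrib
        scaleR_sum_right)
  have "inj L"
  proof (rule injI)
    fix x x' assume "L x = L x'"
    then have b: "G x b = G x' b" if "b \<in> Basis" for b using Lb that by metis
    have "G x y = G x' y" for y
      using linear_eq_sum_Basis[OF Gl[of x], of y] linear_eq_sum_Basis[OF Gl[of x'], of y] b by simp
    then show "x = x'" by (rule nondegenerate_form_eqI[OF G])
  qed
  then have "surj L" using linL linear_injective_imp_surjective by blast
  then obtain x where x: "(\<Sum>b\<in>Basis. \<alpha> b *\<^sub>R b) = L x" by (metis surjD)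
  have "G x b = \<alpha> b" if "b \<in> Basis" for b
    using Lb[OF that, of x] that by (simp add: x[symmetric] inner_sum_left inner_Basis if_distrib
        cong: if_cong)
  then have "G x y = \<alpha> y" for y
    using linear_eq_sum_Basis[OF Gl[of x], of y] linear_eq_sum_Basis[OF \<alpha>, of y] by simp
  then show ?thesis using nondegenerate_form_eqI[OF G] by (metis (full_types))
qed

lemma sharp_eq:
  assumes "nondegenerate_form G" "linear \<alpha>"
  shows "G (sharp G \<alpha>) y = \<alpha> y"
  using theI'[OF sharp_ex1[OF assms]] unfolding sharp_def by blast

definition smooth_metric_on :: "'a::euclidean_space set \<Rightarrow> ('a \<Rightarrow> 'a \<Rightarrow> 'a \<Rightarrow> real) \<Rightarrow> bool" where
  "smooth_metric_on S G \<longleftrightarrow> open S \<and> (\<forall>z\<in>S. nondegenerate_form (G z)) \<and> (\<forall>x y. smooth_on S (\<lambda>z. G z x y))"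

text \<open>Nondegeneracy made quantitative and locally uniform, in place of a bound on the inverse
  matrix. At \<open>z0\<close> the sum of the absolute pairings has a positive minimum
  \<open>e\<close> on the unit sphere; near \<open>z0\<close> the coefficients move so little that
  at most half of it is lost, whence the constant \<open>2 / e\<close>.\<close>

lemma nondegenerate_form_bound:
  assumes G: "smooth_metric_on S G" and z0: "z0 \<in> S"
  shows "\<exists>K>0. \<forall>\<^sub>F z in nhds z0. z \<in> S \<and> (\<forall>x. norm x \<le> K * (\<Sum>b\<in>Basis. \<bar>G z x b\<bar>))"
proof -
  have S: "open S" using G by (simp add: smooth_metric_on_def)
  have bil: "bilinear (G z)" if "z \<in> S" for z
    using G that by (simp add: smooth_metric_on_def nondegenerate_form_def)
  have lin1: "linear (\<lambda>x. G z x b)" if "z \<in> S" for z b using bil[OF that] by (simp add: bilinear_def)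
  define N where "N z x = (\<Sum>b\<in>Basis. \<bar>G z x b\<bar>)" for z x
  have "continuous_on (sphere 0 1) (N z0)"
    unfolding N_def using lin1[OF z0] by (intro continuous_intros linear_continuous_on
        linear_conv_bounded_linear[THEN iffD1])
  moreover have "sphere (0::'a) 1 \<noteq> {}" by simp
  ultimately obtain x0 where x0: "norm x0 = 1" and min: "\<And>x. norm x = 1 \<Longrightarrow> N z0 x0 \<le> N z0 x"
    using continuous_attains_inf[of "sphere 0 1" "N z0"] by auto
  define e where "e = N z0 x0"
  have "N z0 x0 \<noteq> 0"
  proof
    assume "N z0 x0 = 0"
    then have "\<forall>b\<in>Basis. G z0 x0 b = 0" unfolding N_def by (subst (asm) sum_nonneg_eq_0_iff) auto
    then have "\<forall>y. G z0 x0 y = 0"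
      using linear_eq_sum_Basis[of "G z0 x0"] bil[OF z0] by (simp add: bilinear_def)
    then have "x0 = 0" using G z0 by (auto simp: smooth_metric_on_def nondegenerate_form_def)
    then show False using x0 by simp
  qed
  then have e: "e > 0" unfolding e_def N_def by (simp add: sum_nonneg less_le)
  have lower: "e * norm x \<le> N z0 x" for x
  proof (cases "x = 0")
    case True
    then show ?thesis by (simp add: N_def sum_nonneg)
  next
    case False
    have "N z0 x = norm x * N z0 (x /\<^sub>R norm x)"
      using False linear_scale[OF lin1[OF z0]] by (simp add: N_def sum_distrib_left abs_mult field_simps)
    moreover have "e \<le> N z0 (x /\<^sub>R norm x)" using min[of "x /\<^sub>R norm x"] False by (simp add: e_def)
    ultimately show ?thesis by (simp add: mult.commute[of e] mult_left_mono)
  qed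
  \<comment> \<open>The total change of the coefficients between \<open>z0\<close> and
    \<open>z\<close>; multiplied by \<open>norm x\<close> it bounds the change of the sum of
    pairings for \<open>x\<close>.\<close>
  define E where "E z = (\<Sum>b\<in>Basis. \<Sum>c\<in>Basis. \<bar>G z c b - G z0 c b\<bar>)" for z
  have cont: "isCont (\<lambda>z. G z c b) z0" for c b
    using G z0 S smooth_on_continuous continuous_on_eq_continuous_at unfolding smooth_metric_on_def
        by blast
  have "((\<lambda>z. \<Sum>b\<in>Basis. \<Sum>c\<in>Basis. \<bar>G z c b - G z0 c b\<bar>) \<longlongrightarrow> (\<Sum>b\<in>Basis. \<Sum>c\<in>Basis. \<bar>G z0 c b
      - G z0 c b\<bar>)) (nhds z0)"
    using cont unfolding continuous_at
    by (intro tendsto_sum tendsto_rabs tendsto_diff tendsto_const tendsto_at_iff_tendsto_nhds[THEN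
        iffD1])
  then have "(E \<longlongrightarrow> 0) (nhds z0)" by (simp add: E_def[abs_def])
  then have "\<forall>\<^sub>F z in nhds z0. \<bar>E z\<bar> < e / 2"
    using e by (auto simp: tendsto_iff dist_real_def dest: spec[of _ "e/2"])
  moreover have "\<forall>\<^sub>F z in nhds z0. z \<in> S" using S z0 by (simp add: eventually_nhds_in_open)
  ultimately have "\<forall>\<^sub>F z in nhds z0. z \<in> S \<and> (\<forall>x. norm x \<le> (2 / e) * N z x)"
  proof eventually_elim
    case (elim z)
    have "norm x \<le> (2 / e) * N z x" for x
    proof -
      have "N z0 x - N z x \<le> (\<Sum>b\<in>Basis. \<bar>G z x b - G z0 x b\<bar>)"
        unfolding N_def sum_subtractf[symmetric] by (intro sum_mono) simp
      also have "\<dots> \<le> (\<Sum>b\<in>Basis. \<Sum>c\<in>Basis. norm x * \<bar>G z c b - G z0 c b\<bar>)"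
      proof (rule sum_mono)
        fix b :: 'a assume "b \<in> Basis"
        have "G z x b - G z0 x b = (\<Sum>c\<in>Basis. (x \<bullet> c) * (G z c b - G z0 c b))"
          using linear_eq_sum_Basis[OF lin1[OF z0], of x b] linear_eq_sum_Basis[OF lin1[of z], of x
              b] elim
          by (simp add: right_diff_distrib sum_subtractf)
        also have "\<bar>\<dots>\<bar> \<le> (\<Sum>c\<in>Basis. \<bar>(x \<bullet> c) * (G z c b - G z0 c b)\<bar>)" by (rule sum_abs)
        also have "\<dots> \<le> (\<Sum>c\<in>Basis. norm x * \<bar>G z c b - G z0 c b\<bar>)"
          by (intro sum_mono) (auto simp: abs_mult Basis_le_norm intro!: mult_right_mono)
        finally show "\<bar>G z x b - G z0 x b\<bar> \<le> (\<Sum>c\<in>Basis. norm x * \<bar>G z c b - G z0 c b\<bar>)" .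
      qed
      also have "\<dots> = norm x * E z" by (simp add: E_def sum_distrib_left)
      also have "\<dots> \<le> norm x * (e / 2)" using elim by (intro mult_left_mono) auto
      finally have "e * norm x - N z x \<le> norm x * (e / 2)" using lower[of x] by linarith
      then have "norm x * e \<le> 2 * N z x" by (simp add: field_simps)
      then show ?thesis using e by (simp add: field_simps)
    qed
    then show ?case using elim by blast
  qed
  then show ?thesis unfolding N_def using e by (intro exI[of _ "2 / e"]) auto
qed

text \<open>Pairing \<open>u z - u z0\<close> with \<open>b\<close> under \<open>G z\<close> gives
  \<open>\<alpha> z b - G z (u z0) b\<close>, in which \<open>u\<close> occurs only at
  \<open>z0\<close>. This is continuous and vanishes at \<open>z0\<close>, and the uniform bound
  carries it over to the norm.\<close>

lemma sharp_continuous_at: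
  assumes G: "smooth_metric_on S G" and z0: "z0 \<in> S"
    and \<alpha>: "\<And>y. isCont (\<lambda>z. \<alpha> z y) z0"
    and u: "\<And>z y. z \<in> S \<Longrightarrow> G z (u z) y = \<alpha> z y"
  shows "isCont u z0"
proof -
  have bil: "bilinear (G z)" if "z \<in> S" for z
    using G that by (simp add: smooth_metric_on_def nondegenerate_form_def)
  obtain K where K: "K > 0" "\<forall>\<^sub>F z in nhds z0. z \<in> S \<and> (\<forall>x. norm x \<le> K * (\<Sum>b\<in>Basis. \<bar>G z x b\<bar>))"
    using nondegenerate_form_bound[OF G z0] by blast
  define r where "r z = K * (\<Sum>b\<in>Basis. \<bar>\<alpha> z b - G z (u z0) b\<bar>)" for z
  have G': "isCont (\<lambda>z. G z x y) z0" for x y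
    using G z0 smooth_on_continuous continuous_on_eq_continuous_at unfolding smooth_metric_on_def
        by blast
  have "isCont r z0" unfolding r_def by (intro continuous_intros \<alpha> G')
  then have "r \<midarrow>z0\<rightarrow> 0" using u[OF z0] by (simp add: continuous_at r_def)
  moreover have "\<forall>\<^sub>F z in at z0. norm (u z - u z0) \<le> r z"
    using K(2)[unfolded eventually_nhds_conv_at, THEN conjunct1]
  proof (rule eventually_mono)
    fix z assume z: "z \<in> S \<and> (\<forall>x. norm x \<le> K * (\<Sum>b\<in>Basis. \<bar>G z x b\<bar>))"
    then have "norm (u z - u z0) \<le> K * (\<Sum>b\<in>Basis. \<bar>G z (u z - u z0) b\<bar>)" by blast
    moreover have "G z (u z - u z0) b = \<alpha> z b - G z (u z0) b" for b
      using z u bil by (simp add: bilinear_lsub)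
    ultimately show "norm (u z - u z0) \<le> r z" by (simp add: r_def)
  qed
  ultimately have "(\<lambda>z. u z - u z0) \<midarrow>z0\<rightarrow> 0" by (rule Lim_null_comparison[rotated])
  then show ?thesis by (simp add: continuous_at LIM_zero_iff)
qed

text \<open>The condition on \<open>u'\<close> is the defining equation differentiated formally at
  \<open>z0\<close>. It makes the pairing of the remainder \<open>u z - u z0 - u' (z - z0)\<close>
  with any \<open>y\<close> a function of zero derivative at \<open>z0\<close>; the uniform bound
  turns this into an estimate for the remainder itself.\<close>

lemma sharp_has_derivative:
  assumes G: "smooth_metric_on S G" and z0: "z0 \<in> S"
    and \<alpha>: "\<And>y. ((\<lambda>z. \<alpha> z y) has_derivative (\<lambda>h. \<alpha>' h y)) (at z0)"
    and u: "\<And>z y. z \<in> S \<Longrightarrow> G z (u z) y = \<alpha> z y"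
    and u': "linear u'"
      "\<And>h y. G z0 (u' h) y = \<alpha>' h y - fderiv (\<lambda>z. G z (u z0) y) z0 h"
  shows "(u has_derivative u') (at z0)"
proof -
  have S: "open S" using G by (simp add: smooth_metric_on_def)
  have bil: "bilinear (G z)" if "z \<in> S" for z
    using G that by (simp add: smooth_metric_on_def nondegenerate_form_def)
  have sG: "smooth_on S (\<lambda>z. G z x y)" for x y using G by (simp add: smooth_metric_on_def)
  obtain K where K: "K > 0" "\<forall>\<^sub>F z in nhds z0. z \<in> S \<and> (\<forall>x. norm x \<le> K * (\<Sum>b\<in>Basis. \<bar>G z x b\<bar>))"
    using nondegenerate_form_bound[OF G z0] by blast
  define \<gamma> where "\<gamma> y z = \<alpha> z y - G z (u z0) y - G z (u' (z - z0)) y" for y z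
  have "bounded_linear u'" using u'(1) by (simp add: linear_conv_bounded_linear)
  then have d1: "((\<lambda>z. u' (z - z0)) has_derivative u') (at z0)"
    by (auto intro!: derivative_eq_intros bounded_linear.has_derivative[where f = u'])
  have d\<gamma>: "(\<gamma> y has_derivative (\<lambda>h. 0)) (at z0)" for y
  proof -
    have "((\<lambda>z. G z (u' (z - z0)) y) has_derivative
        (\<lambda>h. fderiv (\<lambda>z. G z (u' (z0 - z0)) y) z0 h + G z0 (u' h) y)) (at z0)"
      by (rule has_derivative_linear_family[where f = "\<lambda>z v. G z v y" and f'
          = "\<lambda>h v. fderiv (\<lambda>z. G z v y) z0 h", OF S z0])
         (use bil in \<open>auto simp: bilinear_def intro!: smooth_on_has_derivative[OF sG z0] d1\<close>)
    moreover have "fderiv (\<lambda>z. G z (u' (z0 - z0)) y) z0 h = 0" for h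
    proof -
      have "fderiv (\<lambda>z. G z (u' (z0 - z0)) y) z0 = fderiv (\<lambda>z. 0) z0"
        using u'(1) bil by (intro frechet_derivative_cong_open[OF S z0])
            (simp add: linear_0 bilinear_lzero)
      then show ?thesis by simp
    qed
    ultimately have "((\<lambda>z. G z (u' (z - z0)) y) has_derivative (\<lambda>h. G z0 (u' h) y)) (at z0)" by simp
    then have "(\<gamma> y has_derivative (\<lambda>h. \<alpha>' h y - fderiv (\<lambda>z. G z (u z0) y) z0 h - G z0 (u' h) y))
        (at z0)"
      unfolding \<gamma>_def by (intro has_derivative_diff \<alpha> smooth_on_has_derivative[OF sG z0])
    then show ?thesis by (simp add: u'(2))
  qed
  have "(\<lambda>z. norm (\<gamma> y z - \<gamma> y z0 - 0) / norm (z - z0)) \<midarrow>z0\<rightarrow> 0" for y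
    using d\<gamma>[of y] unfolding has_derivative_iff_norm by blast
  moreover have "\<gamma> y z0 = 0" for y
    using u[OF z0] u'(1) bil[OF z0] by (simp add: \<gamma>_def linear_0 bilinear_lzero)
  ultimately have "(\<lambda>z. K * (\<Sum>b\<in>Basis. \<bar>\<gamma> b z\<bar> / norm (z - z0))) \<midarrow>z0\<rightarrow> K * (\<Sum>b\<in>(Basis :: 'a set). 0)"
    by (intro tendsto_mult tendsto_sum tendsto_const) simp
  then have "(\<lambda>z. K * (\<Sum>b\<in>Basis. \<bar>\<gamma> b z\<bar> / norm (z - z0))) \<midarrow>z0\<rightarrow> 0" by simp
  moreover have "\<forall>\<^sub>F z in at z0. norm (norm ((u z - u z0) - u' (z - z0)) / norm (z - z0))
      \<le> K * (\<Sum>b\<in>Basis. \<bar>\<gamma> b z\<bar> / norm (z - z0))"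
    using K(2)[unfolded eventually_nhds_conv_at, THEN conjunct1]
  proof (rule eventually_mono)
    fix z assume z: "z \<in> S \<and> (\<forall>x. norm x \<le> K * (\<Sum>b\<in>Basis. \<bar>G z x b\<bar>))"
    then have "norm (u z - u z0 - u' (z - z0)) \<le> K * (\<Sum>b\<in>Basis. \<bar>G z (u z - u z0 - u' (z - z0)) b\<bar>)"
        by blast
    moreover have "G z (u z - u z0 - u' (z - z0)) b = \<gamma> b z" for b
      using z u bil by (simp add: \<gamma>_def bilinear_lsub)
    ultimately have "norm (u z - u z0 - u' (z - z0)) \<le> K * (\<Sum>b\<in>Basis. \<bar>\<gamma> b z\<bar>)" by simp
    then have "norm (u z - u z0 - u' (z - z0)) / norm (z - z0) \<le> K * (\<Sum>b\<in>Basis. \<bar>\<gamma> b z\<bar>) / norm (z - z0)"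
      by (rule divide_right_mono) simp
    then show "norm (norm ((u z - u z0) - u' (z - z0)) / norm (z - z0))
      \<le> K * (\<Sum>b\<in>Basis. \<bar>\<gamma> b z\<bar> / norm (z - z0))"
      by (simp add: sum_divide_distrib sum_distrib_left)
  qed
  ultimately have "(\<lambda>z. norm ((u z - u z0) - u' (z - z0)) / norm (z - z0)) \<midarrow>z0\<rightarrow> 0"
    by (rule Lim_null_comparison[rotated])
  then show ?thesis using \<open>bounded_linear u'\<close> by (simp add: has_derivative_iff_norm)
qed

text \<open>Differentiating \<open>G z (u z) y = \<alpha> z y\<close> shows that the derivative of \<open>u\<close> solves an equation of the
  same form.\<close>
lemma Ck_on_sharp:
  fixes G :: "'a::euclidean_space \<Rightarrow> 'a \<Rightarrow> 'a \<Rightarrow> real"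
  assumes G: "smooth_metric_on S G"
    and \<alpha>: "\<And>y. Ck_on n S (\<lambda>z. \<alpha> z y)"
    and u: "\<And>z y. z \<in> S \<Longrightarrow> G z (u z) y = \<alpha> z y"
  shows "Ck_on n S u"
  using \<alpha> u
proof (induction n arbitrary: \<alpha> u)
  case 0
  have S: "open S" using G by (simp add: smooth_metric_on_def)
  show ?case
    unfolding Ck_on.simps
  proof (intro continuous_at_imp_continuous_on ballI)
    fix z assume z: "z \<in> S"
    have "isCont (\<lambda>z. \<alpha> z y) z" for y
      using 0(1)[of y] S z by (simp add: continuous_on_eq_continuous_at)
    then show "isCont u z" using sharp_continuous_at[OF G z _ 0(2)] by blast
  qed
next
  case (Suc n)
  have S: "open S" using G by (simp add: smooth_metric_on_def)
  have nd: "nondegenerate_form (G z)" if "z \<in> S" for z using G that by (simp add: smooth_metric_on_def)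
  have bil: "bilinear (G z)" if "z \<in> S" for z using nd[OF that] by (simp add: nondegenerate_form_def)
  have sG: "smooth_on S (\<lambda>z. G z x y)" for x y using G by (simp add: smooth_metric_on_def)
  have \<alpha>d: "((\<lambda>z. \<alpha> z y) has_derivative fderiv (\<lambda>z. \<alpha> z y) z) (at z)" if "z \<in> S" for y z
    using Suc.prems(1)[of y] that by (simp add: frechet_derivative_works[symmetric])
  define \<alpha>' where "\<alpha>' h z y = fderiv (\<lambda>z. \<alpha> z y) z h - fderiv (\<lambda>z'. G z' (u z) y) z h" for h z y
  define u' where "u' z h = sharp (G z) (\<alpha>' h z)" for z h
  have dG_lin1: "linear (\<lambda>x. fderiv (\<lambda>z. G z x y) z h)" if z: "z \<in> S" for y z h
    by (rule linear_derivative_linear_family[where f = "\<lambda>z x. G z x y",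
        OF S z _ smooth_on_has_derivative[OF sG z]])
       (use bil in \<open>simp add: bilinear_def\<close>)
  have \<alpha>'h: "linear (\<lambda>h. \<alpha>' h z y)" if "z \<in> S" for z y
    unfolding \<alpha>'_def
    by (intro linear_compose_sub has_derivative_linear[OF \<alpha>d[OF that]]
        has_derivative_linear[OF smooth_on_has_derivative[OF sG that]])
  have \<alpha>'_lin: "linear (\<alpha>' h z)" if z: "z \<in> S" for z h
  proof (rule linear_derivative_linear_family[where f = "\<lambda>z' y. \<alpha> z' y - G z' (u z) y"
        and f' = "\<lambda>h. \<alpha>' h z", OF S z])
    show "linear (\<lambda>y. \<alpha> z' y - G z' (u z) y)" if "z' \<in> S" for z'
      using bil[OF that] Suc.prems(2)[OF that, symmetric] by (simp add: bilinear_def linear_compose_sub)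
    show "((\<lambda>z'. \<alpha> z' y - G z' (u z) y) has_derivative (\<lambda>h. \<alpha>' h z y)) (at z)" for y
      unfolding \<alpha>'_def by (intro has_derivative_diff \<alpha>d[OF z] smooth_on_has_derivative[OF sG z])
  qed
  have u'_eq: "G z (u' z h) y = \<alpha>' h z y" if "z \<in> S" for z h y
    unfolding u'_def by (rule sharp_eq[OF nd[OF that] \<alpha>'_lin[OF that]])
  have lin_u': "linear (u' z)" if z: "z \<in> S" for z
  proof (rule linearI)
    fix h h'
    show "u' z (h + h') = u' z h + u' z h'"
      using z by (intro nondegenerate_form_eqI[OF nd[OF z]])
        (simp add: u'_eq bil bilinear_ladd linear_add[OF \<alpha>'h])
  next
    fix r h
    show "u' z (r *\<^sub>R h) = r *\<^sub>R u' z h"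
      using z by (intro nondegenerate_form_eqI[OF nd[OF z]])
        (simp add: u'_eq bil bilinear_lmul linear_scale[OF \<alpha>'h])
  qed
  have du: "(u has_derivative u' z) (at z)" if z: "z \<in> S" for z
  proof (rule sharp_has_derivative[OF G z _ Suc.prems(2) lin_u'[OF z]])
    show "((\<lambda>z. \<alpha> z y) has_derivative (\<lambda>h. fderiv (\<lambda>z. \<alpha> z y) z h)) (at z)" for y
      by (rule \<alpha>d[OF z])
    show "G z (u' z h) y = fderiv (\<lambda>z. \<alpha> z y) z h - fderiv (\<lambda>z'. G z' (u z) y) z h" for h y
      using u'_eq[OF z] by (simp add: \<alpha>'_def)
  qed
  \<comment> \<open>\<open>u\<close> enters the right-hand side \<open>\<alpha>'\<close> of the
    equation for its derivative, so regularity of order \<open>n\<close> of \<open>u\<close> itself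
    has to be known before the induction hypothesis can be applied to that derivative.\<close>
  have Cu: "Ck_on n S u"
    using Suc.prems(1) by (intro Suc.IH[OF _ Suc.prems(2)]) (blast dest: Ck_on_SucD)
  have Cu': "Ck_on n S (\<lambda>z. u' z h)" for h
  proof (rule Suc.IH[OF _ u'_eq])
    fix y
    have "Ck_on n S (\<lambda>z. fderiv (\<lambda>z'. G z' (u z) y) z h)"
      using smooth_on_frechet_derivative[OF sG]
      by (intro Ck_on_linear_family[where f = "\<lambda>z x. fderiv (\<lambda>z'. G z' x y) z h", OF S dG_lin1 _ Cu])
         (auto simp: smooth_on_def)
    then have "Ck_on n S (\<lambda>z. fderiv (\<lambda>z. \<alpha> z y) z h + - fderiv (\<lambda>z'. G z' (u z) y) z h)"
      using Suc.prems(1)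
      by (intro Ck_on_add[OF S] Ck_on_bounded_linear_compose[OF bounded_linear_minus[OF
          bounded_linear_ident] S]) auto
    then show "Ck_on n S (\<lambda>z. \<alpha>' h z y)" by (simp add: \<alpha>'_def)
  qed
  show ?case by (rule Ck_on_SucI[OF S du Cu'])
qed

lemma smooth_on_sharp:
  assumes "smooth_metric_on S G" "\<And>y. smooth_on S (\<lambda>z. \<alpha> z y)" "\<And>z y. z \<in> S \<Longrightarrow> G z (u z) y = \<alpha> z y"
  shows "smooth_on S u"
  using assms Ck_on_sharp unfolding smooth_on_def by blast

section \<open>Orthonormal families and connection coefficients\<close>

text \<open>The absolute value admits any signature, and the separate length \<open>n\<close> allows
  a family to be extended one vector at a time.\<close>

definition orthonormal_family :: "('a \<Rightarrow> 'a \<Rightarrow> real) \<Rightarrow> nat \<Rightarrow> (nat \<Rightarrow> 'a) \<Rightarrow> bool" where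
  "orthonormal_family G n e \<longleftrightarrow>
     (\<forall>i<n. \<bar>G (e i) (e i)\<bar> = 1) \<and> (\<forall>i<n. \<forall>j<n. i \<noteq> j \<longrightarrow> G (e i) (e j) = 0)"

lemma abs_eq_1_square: "\<bar>x :: real\<bar> = 1 \<Longrightarrow> x * x = 1"
  by (metis abs_mult_self_eq mult_1)

lemma bilinear_sum_left: "bilinear G \<Longrightarrow> G (\<Sum>i\<in>I. f i) y = (\<Sum>i\<in>I. G (f i) y)"
  using linear_sum[of "\<lambda>x. G x y" f I] by (simp add: bilinear_def)

lemma bilinear_sum_right: "bilinear G \<Longrightarrow> G x (\<Sum>i\<in>I. f i) = (\<Sum>i\<in>I. G x (f i))"
  using linear_sum[of "G x" f I] by (simp add: bilinear_def)

lemma orthonormal_family_sum: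
  assumes G: "bilinear G" and e: "orthonormal_family G n e" and j: "j < n"
  shows "G (\<Sum>i<n. c i *\<^sub>R e i) (e j) = c j * G (e j) (e j)"
proof -
  have "G (\<Sum>i<n. c i *\<^sub>R e i) (e j) = (\<Sum>i<n. c i * G (e i) (e j))"
    by (simp add: bilinear_sum_left[OF G] bilinear_lmul[OF G])
  also have "\<dots> = (\<Sum>i<n. if i = j then c j * G (e j) (e j) else 0)"
    using e j by (intro sum.cong) (auto simp: orthonormal_family_def)
  finally show ?thesis using j by simp
qed

text \<open>In indefinite signature the projection coefficients carry the sign
  \<open>G (e i) (e i)\<close>, whose square is 1.\<close>

lemma orthonormal_family_residual:
  assumes G: "bilinear G" and e: "orthonormal_family G n e" and j: "j < n"
  shows "G (x - (\<Sum>i<n. (G (e i) (e i) * G x (e i)) *\<^sub>R e i)) (e j) = 0"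
proof -
  have "G (e j) (e j) * G (e j) (e j) = 1"
    using e j by (intro abs_eq_1_square) (simp add: orthonormal_family_def)
  then show ?thesis
    using orthonormal_family_sum[OF G e j] by (simp add: bilinear_lsub[OF G] algebra_simps)
qed

lemma bij_betw_nat_Basis: "\<exists>b. bij_betw b {..<DIM('a)} (Basis :: 'a::euclidean_space set)"
  using ex_bij_betw_nat_finite[of "Basis :: 'a set"] by (simp add: lessThan_atLeast0)

lemma inner_bij_Basis:
  assumes "bij_betw b {..<DIM('a)} (Basis :: 'a::euclidean_space set)" "i < DIM('a)" "j < DIM('a)"
  shows "b i \<bullet> b j = (if i = j then 1 else 0)"
proof -
  have "b i \<in> Basis" "b j \<in> Basis" using assms by (auto simp: bij_betw_def)
  moreover have "b i = b j \<longleftrightarrow> i = j" using assms by (auto simp: bij_betw_def inj_on_def)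
  ultimately show ?thesis by (simp add: inner_Basis)
qed

lemma linear_coordinates_of_forms:
  fixes f :: "nat \<Rightarrow> 'a::euclidean_space \<Rightarrow> real"
  assumes b: "bij_betw b {..<DIM('a)} (Basis :: 'a set)" and n: "n \<le> DIM('a)"
    and f: "\<And>i. i < n \<Longrightarrow> linear (f i)"
  shows "linear (\<lambda>x. \<Sum>i<n. f i x *\<^sub>R b i)"
    and "j < n \<Longrightarrow> (\<Sum>i<n. f i x *\<^sub>R b i) \<bullet> b j = f j x"
proof -
  show "linear (\<lambda>x. \<Sum>i<n. f i x *\<^sub>R b i)"
    using f by (intro linear_compose_sum) (auto simp: linear_iff scaleR_add_left)
  assume j: "j < n"
  have "(\<Sum>i<n. f i x *\<^sub>R b i) \<bullet> b j = (\<Sum>i<n. if i = j then f j x else 0)"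
    unfolding inner_sum_left using inner_bij_Basis[OF b] n j by (intro sum.cong) auto
  then show "(\<Sum>i<n. f i x *\<^sub>R b i) \<bullet> b j = f j x" using j by simp
qed

text \<open>Collecting the \<open>n\<close> forms into one endomorphism \<open>T\<close> leaves the
  direction \<open>b n\<close> out of its range, so \<open>T\<close> is not onto and hence not
  injective.\<close>

lemma ex_nonzero_common_kernel:
  fixes f :: "nat \<Rightarrow> 'a::euclidean_space \<Rightarrow> real"
  assumes n: "n < DIM('a)" and f: "\<And>i. i < n \<Longrightarrow> linear (f i)"
  shows "\<exists>x. x \<noteq> 0 \<and> (\<forall>i<n. f i x = 0)"
proof -
  obtain b where b: "bij_betw b {..<DIM('a)} (Basis :: 'a set)" using bij_betw_nat_Basis by blast
  define T where "T x = (\<Sum>i<n. f i x *\<^sub>R b i)" for x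
  have lin: "linear T" unfolding T_def by (rule linear_coordinates_of_forms(1)[OF b _ f]) (use n in auto)
  have "T x \<bullet> b n = 0" for x
    unfolding T_def inner_sum_left using inner_bij_Basis[OF b] n by (intro sum.neutral) auto
  moreover have "b n \<bullet> b n = 1" using inner_bij_Basis[OF b] n by simp
  ultimately have "\<not> surj T" by (metis surjD zero_neq_one)
  then have "\<not> inj T" using linear_injective_imp_surjective[OF lin] by blast
  then obtain x where x: "x \<noteq> 0" "T x = 0" using lin by (auto simp: linear_injective_0)
  have "f i x = 0" if "i < n" for i
    using linear_coordinates_of_forms(2)[where f = f and n = n and x = x, OF b _ f that] n x(2)
    by (simp add: T_def)
  then show ?thesis using x by blast
qed

text \<open>Gram-Schmidt with a detour, because a vector orthogonal to those found so far may be
  null. A nonzero such \<open>x\<close> has a partner \<open>y'\<close>, also orthogonal to them,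
  with nonzero pairing, and one of \<open>x\<close>, \<open>y'\<close>, \<open>x + y'\<close> is not
  null.\<close>

lemma orthonormal_family_exists:
  fixes G :: "'a::euclidean_space \<Rightarrow> 'a \<Rightarrow> real"
  assumes G: "nondegenerate_form G"
  shows "n \<le> DIM('a) \<Longrightarrow> \<exists>e. orthonormal_family G n e"
proof (induction n)
  case 0
  then show ?case by (simp add: orthonormal_family_def)
next
  case (Suc n)
  then obtain e where e: "orthonormal_family G n e" by auto
  have bil: "bilinear G" and sym: "\<And>x y. G x y = G y x" using G by (auto simp: nondegenerate_form_def)
  have "\<exists>x. x \<noteq> 0 \<and> (\<forall>i<n. G (e i) x = 0)"
    using bil Suc.prems by (intro ex_nonzero_common_kernel) (auto simp: bilinear_def)
  then obtain x where x: "x \<noteq> 0" "\<And>i. i < n \<Longrightarrow> G x (e i) = 0" using sym by metis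
  obtain y where y: "G x y \<noteq> 0" using G x(1) unfolding nondegenerate_form_def by blast
  define y' where "y' = y - (\<Sum>i<n. (G (e i) (e i) * G y (e i)) *\<^sub>R e i)"
  have y': "G y' (e i) = 0" if "i < n" for i
    unfolding y'_def by (rule orthonormal_family_residual[OF bil e that])
  \<comment> \<open>Projecting \<open>y\<close> keeps its pairing with \<open>x\<close>, because
    \<open>x\<close> is orthogonal to every \<open>e i\<close>.\<close>
  have xy': "G x y' \<noteq> 0"
    using y x(2) by (simp add: y'_def bilinear_rsub[OF bil] bilinear_sum_right[OF bil]
        bilinear_rmul[OF bil])
  have "\<exists>v. G v v \<noteq> 0 \<and> (\<forall>i<n. G v (e i) = 0)"
  proof (cases "G x x = 0 \<and> G y' y' = 0")
    case True
    \<comment> \<open>When both vectors are null, only the cross terms survive.\<close>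
    then have "G (x + y') (x + y') = 2 * G x y'"
      using sym[of y' x] by (simp add: bilinear_ladd[OF bil] bilinear_radd[OF bil])
    moreover have "G (x + y') (e i) = 0" if "i < n" for i
      using x(2) y' that by (simp add: bilinear_ladd[OF bil])
    ultimately show ?thesis using xy' by (intro exI[of _ "x + y'"]) auto
  next
    case False
    then show ?thesis using x(2) y' by blast
  qed
  then obtain v where v: "G v v \<noteq> 0" "\<And>i. i < n \<Longrightarrow> G v (e i) = 0" by blast
  define u where "u = v /\<^sub>R sqrt \<bar>G v v\<bar>"
  have "G u u = G v v / \<bar>G v v\<bar>"
    by (simp add: u_def bilinear_lmul[OF bil] bilinear_rmul[OF bil] divide_inverse
        mult.assoc[symmetric] real_sqrt_mult_self inverse_mult_distrib[symmetric])
  then have "\<bar>G u u\<bar> = 1" using v by simp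
  moreover have "G u (e i) = 0" "G (e i) u = 0" if "i < n" for i
    using v that sym[of "e i" u] by (simp_all add: u_def bilinear_lmul[OF bil])
  ultimately have "orthonormal_family G (Suc n) (e(n := u))"
    using e by (auto simp: orthonormal_family_def less_Suc_eq)
  then show ?case by blast
qed

text \<open>The map to the coordinates \<open>G x (e i)\<close> is onto, with preimages combined
  from the \<open>e i\<close>, hence injective by dimension; the difference of the two sides has all
  coordinates zero.\<close>

lemma orthonormal_family_expansion:
  fixes G :: "'a::euclidean_space \<Rightarrow> 'a \<Rightarrow> real"
  assumes G: "bilinear G" and e: "orthonormal_family G DIM('a) e"
  shows "x = (\<Sum>i<DIM('a). (G (e i) (e i) * G x (e i)) *\<^sub>R e i)"
proof -
  obtain b where b: "bij_betw b {..<DIM('a)} (Basis :: 'a set)" using bij_betw_nat_Basis by blast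
  define T where "T x = (\<Sum>i<DIM('a). G x (e i) *\<^sub>R b i)" for x
  have lin: "linear T"
    unfolding T_def using G by (intro linear_coordinates_of_forms(1)[OF b]) (auto simp: bilinear_def)
  have Tb: "T x \<bullet> b j = G x (e j)" if "j < DIM('a)" for x j
    unfolding T_def using G that by (intro linear_coordinates_of_forms(2)[OF b])
        (auto simp: bilinear_def)
  have "surj T"
  proof (rule surjI)
    fix y :: 'a
    define x where "x = (\<Sum>i<DIM('a). (G (e i) (e i) * (y \<bullet> b i)) *\<^sub>R e i)"
    have "T x \<bullet> b j = y \<bullet> b j" if "j < DIM('a)" for j
    proof -
      have "G (e j) (e j) * G (e j) (e j) = 1"
        using e that by (intro abs_eq_1_square) (simp add: orthonormal_family_def)
      then show ?thesis
        using Tb[OF that, of x] orthonormal_family_sum[OF G e that] by (simp add: x_def algebra_simps)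
    qed
    then have "T x \<bullet> c = y \<bullet> c" if "c \<in> b ` {..<DIM('a)}" for c
      using that by auto
    then have "T x \<bullet> c = y \<bullet> c" if "c \<in> Basis" for c
      using that by (simp only: bij_betw_imp_surj_on[OF b])
    then show "T (\<Sum>i<DIM('a). (G (e i) (e i) * (y \<bullet> b i)) *\<^sub>R e i) = y"
      unfolding x_def[symmetric] by (rule euclidean_eqI)
  qed
  then have "inj T" using linear_surjective_imp_injective[OF lin] by blast
  define r where "r = x - (\<Sum>i<DIM('a). (G (e i) (e i) * G x (e i)) *\<^sub>R e i)"
  have "T r = 0"
    unfolding T_def r_def using orthonormal_family_residual[OF G e] by simp
  then have "r = 0" using \<open>inj T\<close> lin by (auto simp: linear_injective_0)
  then show ?thesis by (simp add: r_def)
qed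

text \<open>Basis independence of the trace, the dual basis of \<open>e\<close> with respect to
  \<open>G\<close> being \<open>G (e i) (e i) *\<^sub>R e i\<close>. Any orthonormal frame picked by
  \<open>SOME\<close> therefore gives the same sum.\<close>

lemma orthonormal_trace:
  fixes G :: "'a::euclidean_space \<Rightarrow> 'a \<Rightarrow> real"
  assumes G: "bilinear G" and e: "orthonormal_family G DIM('a) e" and L: "linear L"
  shows "(\<Sum>i<DIM('a). G (e i) (e i) * G (L (e i)) (e i)) = (\<Sum>b\<in>Basis. L b \<bullet> b)"
proof -
  have "(\<Sum>b\<in>Basis. L b \<bullet> b) = (\<Sum>b\<in>Basis. \<Sum>i<DIM('a). G (e i) (e i) * G b (e i) * (L (e i) \<bullet> b))"
  proof (rule sum.cong)
    fix b :: 'a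
    have "L b = (\<Sum>i<DIM('a). (G (e i) (e i) * G b (e i)) *\<^sub>R L (e i))"
      by (subst orthonormal_family_expansion[OF G e, of b]) (simp add: linear_sum[OF L]
          linear_scale[OF L])
    then show "L b \<bullet> b = (\<Sum>i<DIM('a). G (e i) (e i) * G b (e i) * (L (e i) \<bullet> b))"
      by (simp add: inner_sum_left)
  qed simp
  also have "\<dots> = (\<Sum>i<DIM('a). G (e i) (e i) * (\<Sum>b\<in>Basis. (L (e i) \<bullet> b) * G b (e i)))"
    by (subst sum.swap) (simp add: sum_distrib_left mult_ac)
  also have "\<dots> = (\<Sum>i<DIM('a). G (e i) (e i) * G (L (e i)) (e i))"
  proof (rule sum.cong)
    fix i
    have "linear (\<lambda>x. G x (e i))" using G by (simp add: bilinear_def)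
    from linear_eq_sum_Basis[OF this, of "L (e i)"]
    show "G (e i) (e i) * (\<Sum>b\<in>Basis. (L (e i) \<bullet> b) * G b (e i)) = G (e i) (e i) * G (L (e i)) (e i)"
      by simp
  qed simp
  finally show ?thesis by simp
qed

section \<open>Smooth families of bilinear maps, for metrics and Christoffel symbols alike\<close>

definition smooth_bilinear_on ::
    "'c::euclidean_space set \<Rightarrow> ('c \<Rightarrow> 'a::euclidean_space \<Rightarrow> 'b::euclidean_space \<Rightarrow>
        'd::euclidean_space) \<Rightarrow> bool" where
  "smooth_bilinear_on S T \<longleftrightarrow> open S \<and> (\<forall>z\<in>S. bilinear (T z)) \<and> (\<forall>x y. smooth_on S (\<lambda>z. T z x y))"

lemma smooth_bilinear_onD: "smooth_bilinear_on S T \<Longrightarrow> z \<in> S \<Longrightarrow> bilinear (T z)"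
  by (simp add: smooth_bilinear_on_def)

definition bilinear_derivative ::
    "('c::euclidean_space \<Rightarrow> 'a \<Rightarrow> 'b \<Rightarrow> 'd::euclidean_space) \<Rightarrow> 'c \<Rightarrow> 'c \<Rightarrow> 'a \<Rightarrow> 'b \<Rightarrow> 'd" where
  "bilinear_derivative T z h x y = fderiv (\<lambda>z. T z x y) z h"

lemma has_derivative_bilinear_derivative:
  assumes "smooth_bilinear_on S T" "z \<in> S"
  shows "((\<lambda>z. T z x y) has_derivative (\<lambda>h. bilinear_derivative T z h x y)) (at z)"
  unfolding bilinear_derivative_def
  using assms by (auto intro: smooth_on_has_derivative simp: smooth_bilinear_on_def)

lemma smooth_bilinear_derivative:
  "smooth_bilinear_on S T \<Longrightarrow> smooth_on S (\<lambda>z. bilinear_derivative T z h x y)"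
  unfolding bilinear_derivative_def smooth_bilinear_on_def by (blast intro: smooth_on_frechet_derivative)

lemma linear_bilinear_derivative:
  assumes T: "smooth_bilinear_on S T" "z \<in> S"
  shows "linear (\<lambda>h. bilinear_derivative T z h x y)"
    and "linear (\<lambda>x. bilinear_derivative T z h x y)"
    and "linear (\<lambda>y. bilinear_derivative T z h x y)"
proof -
  have S: "open S" and bil: "\<And>z. z \<in> S \<Longrightarrow> bilinear (T z)" using T by (auto simp: smooth_bilinear_on_def)
  note d = has_derivative_bilinear_derivative[OF T]
  show "linear (\<lambda>h. bilinear_derivative T z h x y)" by (rule has_derivative_linear[OF d])
  show "linear (\<lambda>x. bilinear_derivative T z h x y)"
    by (rule linear_derivative_linear_family[where f = "\<lambda>z x. T z x y", OF S T(2) _ d])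
       (use bil in \<open>simp add: bilinear_def\<close>)
  show "linear (\<lambda>y. bilinear_derivative T z h x y)"
    by (rule linear_derivative_linear_family[where f = "\<lambda>z. T z x", OF S T(2) _ d])
       (use bil in \<open>simp add: bilinear_def\<close>)
qed

lemma has_derivative_bilinear_family:
  assumes T: "smooth_bilinear_on S T" "z \<in> S"
    and X: "(X has_derivative X') (at z)" and Y: "(Y has_derivative Y') (at z)"
  shows "((\<lambda>z. T z (X z) (Y z)) has_derivative
    (\<lambda>h. bilinear_derivative T z h (X z) (Y z) + T z (X' h) (Y z) + T z (X z) (Y' h))) (at z)"
proof -
  have S: "open S" and bil: "\<And>z. z \<in> S \<Longrightarrow> bilinear (T z)" using T by (auto simp: smooth_bilinear_on_def)
  have "((\<lambda>z. T z (X z) y) has_derivative (\<lambda>h. bilinear_derivative T z h (X z) y + T z (X' h) y))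
      (at z)" for y
    using bil by (intro has_derivative_linear_family[OF S T(2) _ _ X, where f = "\<lambda>z x. T z x y"]
        has_derivative_bilinear_derivative[OF T]) (simp add: bilinear_def)
  moreover have "linear (T z (X z))" if "z \<in> S" for z using bil[OF that] by (simp add: bilinear_def)
  ultimately show ?thesis
    using has_derivative_linear_family[OF S T(2) _ _ Y, where f = "\<lambda>z. T z (X z)"
        and f' = "\<lambda>h y. bilinear_derivative T z h (X z) y + T z (X' h) y"] by simp
qed

lemma smooth_on_bilinear_family:
  assumes "smooth_bilinear_on S T" "smooth_on S X" "smooth_on S Y"
  shows "smooth_on S (\<lambda>z. T z (X z) (Y z))"
proof -
  have S: "open S" and bil: "\<And>z. z \<in> S \<Longrightarrow> bilinear (T z)"
    and sm: "\<And>x y. smooth_on S (\<lambda>z. T z x y)"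
    using assms(1) by (auto simp: smooth_bilinear_on_def)
  have "smooth_on S (\<lambda>z. T z (X z) y)" for y
    using bil by (intro smooth_on_linear_family[where f = "\<lambda>z x. T z x y", OF S _ sm assms(2)])
        (simp add: bilinear_def)
  then show ?thesis
    using bil by (intro smooth_on_linear_family[OF S _ _ assms(3), where f = "\<lambda>z. T z (X z)"])
        (simp_all add: bilinear_def)
qed

section \<open>Covariant derivative and curvature in coordinates\<close>

definition covariant_derivative ::
    "('a::euclidean_space \<Rightarrow> 'a \<Rightarrow> 'a \<Rightarrow> 'a) \<Rightarrow> ('a \<Rightarrow> 'a) \<Rightarrow> ('a \<Rightarrow> 'a) \<Rightarrow> 'a \<Rightarrow> 'a" where
  "covariant_derivative \<Gamma> X Y z = fderiv Y z (X z) + \<Gamma> z (X z) (Y z)"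

definition riemann :: "('a::euclidean_space \<Rightarrow> 'a \<Rightarrow> 'a \<Rightarrow> 'a) \<Rightarrow> 'a \<Rightarrow> 'a \<Rightarrow> 'a \<Rightarrow> 'a \<Rightarrow> 'a" where
  "riemann \<Gamma> z x y u = bilinear_derivative \<Gamma> z x y u - bilinear_derivative \<Gamma> z y x u
     + \<Gamma> z x (\<Gamma> z y u) - \<Gamma> z y (\<Gamma> z x u)"

lemma smooth_covariant_derivative:
  assumes "smooth_bilinear_on S \<Gamma>" "smooth_on S X" "smooth_on S Y"
  shows "smooth_on S (covariant_derivative \<Gamma> X Y)"
proof -
  have "open S" using assms(1) by (simp add: smooth_bilinear_on_def)
  then show ?thesis
    unfolding covariant_derivative_def[abs_def]
    by (intro smooth_on_add smooth_on_frechet_derivative_along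
        smooth_on_bilinear_family[where T = \<Gamma> and X = X and Y = Y] assms)
qed

lemma has_derivative_covariant_derivative:
  assumes \<Gamma>: "smooth_bilinear_on S \<Gamma>" and z: "z \<in> S" and X: "smooth_on S X" and Y: "smooth_on S Y"
  shows "(covariant_derivative \<Gamma> X Y has_derivative
    (\<lambda>h. fderiv (\<lambda>y. fderiv Y y (X z)) z h
       + fderiv Y z (fderiv X z h)
       + (bilinear_derivative \<Gamma> z h (X z) (Y z) + \<Gamma> z (fderiv X z h) (Y z)
         + \<Gamma> z (X z) (fderiv Y z h)))) (at z)"
proof -
  have S: "open S" using \<Gamma> by (simp add: smooth_bilinear_on_def)
  show ?thesis
    unfolding covariant_derivative_def[abs_def]
  proof (intro has_derivative_add has_derivative_bilinear_family[OF \<Gamma> z] smooth_on_has_derivative[OF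
      _ z] X Y)
    show "((\<lambda>z. fderiv Y z (X z)) has_derivative
        (\<lambda>h. fderiv (\<lambda>y. fderiv Y y (X z)) z h
          + fderiv Y z (fderiv X z h))) (at z)"
    proof (rule has_derivative_linear_family[OF S z, where f = "\<lambda>z. fderiv Y z"
          and f' = "\<lambda>h v. fderiv (\<lambda>y. fderiv Y y v) z h"])
      show "linear (fderiv Y z)" if "z \<in> S" for z
        by (rule has_derivative_linear[OF smooth_on_has_derivative[OF Y that]])
    qed (intro smooth_on_has_derivative[OF _ z] smooth_on_frechet_derivative X Y)+
  qed
qed

text \<open>Second derivatives of \<open>Z\<close> cancel by symmetry, its first derivatives inside
  \<Gamma> cancel between the two iterated derivatives, and all terms with derivatives of
  \<open>X\<close> or \<open>Y\<close> are absorbed by the bracket term. What survives involves only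
  the values of the fields at \<open>z\<close>: curvature is a tensor.\<close>

lemma riemann_eq:
  assumes \<Gamma>: "smooth_bilinear_on S \<Gamma>" and z: "z \<in> S"
    and X: "smooth_on S X" and Y: "smooth_on S Y" and Z: "smooth_on S Z"
  shows "covariant_derivative \<Gamma> X (covariant_derivative \<Gamma> Y Z) z
      - covariant_derivative \<Gamma> Y (covariant_derivative \<Gamma> X Z) z
      - covariant_derivative \<Gamma> (\<lambda>z. fderiv Y z (X z) - fderiv X z (Y z)) Z z
    = riemann \<Gamma> z (X z) (Y z) (Z z)"
proof -
  have S: "open S" and bil: "bilinear (\<Gamma> z)" using \<Gamma> z by (auto simp: smooth_bilinear_on_def)
  have lZ: "linear (fderiv Z z)"
    by (rule has_derivative_linear[OF smooth_on_has_derivative[OF Z z]])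
  note d = frechet_derivative_at[OF has_derivative_covariant_derivative[OF \<Gamma> z], symmetric]
  have dYZ: "fderiv (covariant_derivative \<Gamma> Y Z) z h =
      fderiv (\<lambda>y. fderiv Z y (Y z)) z h
       + fderiv Z z (fderiv Y z h)
       + (bilinear_derivative \<Gamma> z h (Y z) (Z z) + \<Gamma> z (fderiv Y z h) (Z z)
         + \<Gamma> z (Y z) (fderiv Z z h))" for h
    by (simp add: d[OF Y Z])
  have dXZ: "fderiv (covariant_derivative \<Gamma> X Z) z h =
      fderiv (\<lambda>y. fderiv Z y (X z)) z h
       + fderiv Z z (fderiv X z h)
       + (bilinear_derivative \<Gamma> z h (X z) (Z z) + \<Gamma> z (fderiv X z h) (Z z)
         + \<Gamma> z (X z) (fderiv Z z h))" for h
    by (simp add: d[OF X Z])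
  have sym: "fderiv (\<lambda>y. fderiv Z y (Y z)) z (X z)
      = fderiv (\<lambda>y. fderiv Z y (X z)) z (Y z)"
    by (rule second_derivative_symmetric[OF S z Z])
  show ?thesis
    unfolding riemann_def covariant_derivative_def[of \<Gamma> X "covariant_derivative \<Gamma> Y Z"]
      covariant_derivative_def[of \<Gamma> Y "covariant_derivative \<Gamma> X Z"] dYZ dXZ sym
    by (simp add: covariant_derivative_def bilinear_radd[OF bil] bilinear_lsub[OF bil]
        linear_diff[OF lZ])
qed

section \<open>Christoffel symbols, Hessian and gradient in coordinates\<close>

text \<open>The Koszul formula for constant fields, whose Lie brackets vanish, with the free index
  raised by \<open>sharp\<close>.\<close>

definition christoffel :: "('a::euclidean_space \<Rightarrow> 'a \<Rightarrow> 'a \<Rightarrow> real) \<Rightarrow> 'a \<Rightarrow> 'a \<Rightarrow> 'a \<Rightarrow> 'a" where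
  "christoffel G z x y = sharp (G z) (\<lambda>v. (bilinear_derivative G z x y v
     + bilinear_derivative G z y x v - bilinear_derivative G z v x y) / 2)"

lemma smooth_metric_on_imp_bilinear: "smooth_metric_on S G \<Longrightarrow> smooth_bilinear_on S G"
  by (simp add: smooth_metric_on_def smooth_bilinear_on_def nondegenerate_form_def)

lemma bilinear_derivative_metric_symmetric:
  assumes G: "smooth_metric_on S G" "z \<in> S"
  shows "bilinear_derivative G z h x y = bilinear_derivative G z h y x"
  unfolding bilinear_derivative_def
proof (rule fun_cong, rule frechet_derivative_cong_open[OF _ G(2)])
  show "open S" "\<And>z. z \<in> S \<Longrightarrow> G z x y = G z y x"
    using G by (auto simp: smooth_metric_on_def nondegenerate_form_def)
qed

lemma christoffel_eq:
  assumes G: "smooth_metric_on S G" "z \<in> S"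
  shows "2 * G z (christoffel G z x y) v =
    bilinear_derivative G z x y v + bilinear_derivative G z y x v - bilinear_derivative G z v x y"
proof -
  note l = linear_bilinear_derivative[OF smooth_metric_on_imp_bilinear[OF G(1)] G(2)]
  have "linear (\<lambda>v. (bilinear_derivative G z x y v + bilinear_derivative G z y x v
      - bilinear_derivative G z v x y) / 2)"
    by (intro linearI) (simp_all add: l[THEN linear_add] l[THEN linear_scale] field_simps)
  then have "G z (christoffel G z x y) v =
      (bilinear_derivative G z x y v + bilinear_derivative G z y x v - bilinear_derivative G z v x
          y) / 2"
    unfolding christoffel_def using G by (intro sharp_eq) (auto simp: smooth_metric_on_def)
  then show ?thesis by simp
qed

lemma christoffel_symmetric:
  assumes G: "smooth_metric_on S G" "z \<in> S"
  shows "christoffel G z x y = christoffel G z y x"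
  unfolding christoffel_def using bilinear_derivative_metric_symmetric[OF G] by (simp add: add.commute)

text \<open>In the sum of the Koszul formulas for the pairs \<open>h\<close>, \<open>x\<close> and
  \<open>h\<close>, \<open>y\<close>, all terms cancel by symmetry of \<open>G\<close> except those
  differentiated along \<open>h\<close>.\<close>

lemma christoffel_compatible:
  assumes G: "smooth_metric_on S G" "z \<in> S"
  shows "bilinear_derivative G z h x y = G z (christoffel G z h x) y + G z x (christoffel G z h y)"
proof -
  have "G z x (christoffel G z h y) = G z (christoffel G z h y) x"
    using G by (simp add: smooth_metric_on_def nondegenerate_form_def)
  then show ?thesis
    using christoffel_eq[OF G, of h x y] christoffel_eq[OF G, of h y x]
      bilinear_derivative_metric_symmetric[OF G, of h x y]
      bilinear_derivative_metric_symmetric[OF G, of x h y]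
      bilinear_derivative_metric_symmetric[OF G, of y h x]
    by linarith
qed

text \<open>Inserting the compatibility of \<open>T\<close> into the Koszul formula leaves
  \<open>2 * G z (T x y) v\<close>. The hypotheses on \<open>T\<close> concern the single point
  \<open>z\<close>, so a guessed formula can be confirmed without differentiating it.\<close>

lemma christoffel_unique:
  assumes G: "smooth_metric_on S G" "z \<in> S"
    and sym: "\<And>x y. T x y = T y x"
    and comp: "\<And>h x y. bilinear_derivative G z h x y = G z (T h x) y + G z x (T h y)"
  shows "christoffel G z x y = T x y"
proof (rule nondegenerate_form_eqI)
  show nd: "nondegenerate_form (G z)" using G by (simp add: smooth_metric_on_def)
  have s: "G z x y = G z y x" for x y using nd by (simp add: nondegenerate_form_def)
  fix v
  have "2 * G z (christoffel G z x y) v = 2 * G z (T x y) v"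
    unfolding christoffel_eq[OF G] comp
    using sym[of y x] sym[of v x] sym[of v y] s[of y "T x v"] s[of x "T y v"] by simp
  then show "G z (christoffel G z x y) v = G z (T x y) v" by simp
qed

text \<open>Bilinearity passes from the Koszul expression to the represented vector by testing
  against all \<open>v\<close>; smoothness is that of solutions of a smooth family of nondegenerate
  linear equations.\<close>

lemma smooth_bilinear_christoffel:
  assumes G: "smooth_metric_on S G"
  shows "smooth_bilinear_on S (christoffel G)"
  unfolding smooth_bilinear_on_def
proof (intro conjI ballI allI)
  show S: "open S" using G by (simp add: smooth_metric_on_def)
  note sb = smooth_metric_on_imp_bilinear[OF G]
  {
    fix z assume z: "z \<in> S"
    have nd: "nondegenerate_form (G z)" using G z by (simp add: smooth_metric_on_def)
    have bil: "bilinear (G z)" using nd by (simp add: nondegenerate_form_def)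
    note l = linear_bilinear_derivative[OF sb z]
    have add: "christoffel G z (x + x') y = christoffel G z x y + christoffel G z x' y" for x x' y
    proof (rule nondegenerate_form_eqI[OF nd])
      fix v
      have "2 * G z (christoffel G z (x + x') y) v = 2 * G z (christoffel G z x y) v
          + 2 * G z (christoffel G z x' y) v"
        unfolding christoffel_eq[OF G z] by (simp add: l[THEN linear_add])
      then show "G z (christoffel G z (x + x') y) v = G z (christoffel G z x y + christoffel G z x' y) v"
        by (simp add: bilinear_ladd[OF bil])
    qed
    have scale: "christoffel G z (r *\<^sub>R x) y = r *\<^sub>R christoffel G z x y" for x y r
    proof (rule nondegenerate_form_eqI[OF nd])
      fix v
      have "2 * G z (christoffel G z (r *\<^sub>R x) y) v = r * (2 * G z (christoffel G z x y) v)"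
        unfolding christoffel_eq[OF G z] by (simp add: l[THEN linear_scale] algebra_simps)
      then show "G z (christoffel G z (r *\<^sub>R x) y) v = G z (r *\<^sub>R christoffel G z x y) v"
        by (simp add: bilinear_lmul[OF bil])
    qed
    show "bilinear (christoffel G z)"
      unfolding bilinear_def
    proof (intro conjI allI linearI)
      show "christoffel G z x (y + y') = christoffel G z x y + christoffel G z x y'" for x y y'
        using add christoffel_symmetric[OF G z] by metis
      show "christoffel G z x (r *\<^sub>R y) = r *\<^sub>R christoffel G z x y" for x y r
        using scale christoffel_symmetric[OF G z] by metis
    qed (rule add scale)+
  }
  fix x y
  have "smooth_on S (\<lambda>z. (1/2) *\<^sub>R (bilinear_derivative G z x y v + bilinear_derivative G z y x v
      - bilinear_derivative G z v x y))" for v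
    by (intro smooth_on_scaleR smooth_on_add smooth_on_diff smooth_bilinear_derivative[OF sb] S
        smooth_on_const)
  then show "smooth_on S (\<lambda>z. christoffel G z x y)"
    by (rule smooth_on_sharp[OF G]) (simp add: christoffel_eq[OF G, symmetric])
qed

section \<open>Hessian and gradient in coordinates\<close>

definition coordinate_hessian ::
    "('a::euclidean_space \<Rightarrow> 'a \<Rightarrow> 'a \<Rightarrow> real) \<Rightarrow> ('a \<Rightarrow> real) \<Rightarrow> 'a \<Rightarrow> 'a \<Rightarrow> 'a \<Rightarrow> real" where
  "coordinate_hessian G f z x y = fderiv (\<lambda>z. fderiv f z y) z x
     - fderiv f z (christoffel G z x y)"

definition coordinate_gradient ::
    "('a::euclidean_space \<Rightarrow> 'a \<Rightarrow> 'a \<Rightarrow> real) \<Rightarrow> ('a \<Rightarrow> real) \<Rightarrow> 'a \<Rightarrow> 'a" where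
  "coordinate_gradient G f z = sharp (G z) (fderiv f z)"

text \<open>The Hessian operator: the covariant derivative of the gradient along \<open>x\<close>,
  that is, the Hessian with one index raised. Its coordinate trace is the Laplacian.\<close>

definition gradient_derivative ::
    "('a::euclidean_space \<Rightarrow> 'a \<Rightarrow> 'a \<Rightarrow> real) \<Rightarrow> ('a \<Rightarrow> real) \<Rightarrow> 'a \<Rightarrow> 'a \<Rightarrow> 'a" where
  "gradient_derivative G f z x = fderiv (coordinate_gradient G f) z x
     + christoffel G z x (coordinate_gradient G f z)"

lemma coordinate_gradient_eq:
  assumes "smooth_metric_on S G" "z \<in> S" "smooth_on S f"
  shows "G z (coordinate_gradient G f z) y = fderiv f z y"
  unfolding coordinate_gradient_def
  using assms by (intro sharp_eq linear_frechet_derivative smooth_on_differentiable)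
      (auto simp: smooth_metric_on_def)

lemma smooth_coordinate_gradient:
  assumes "smooth_metric_on S G" "smooth_on S f"
  shows "smooth_on S (coordinate_gradient G f)"
  by (rule smooth_on_sharp[OF assms(1) smooth_on_frechet_derivative[OF assms(2)]])
     (rule coordinate_gradient_eq[OF assms(1) _ assms(2)])

lemma linear_gradient_derivative:
  assumes G: "smooth_metric_on S G" "z \<in> S" and f: "smooth_on S f"
  shows "linear (gradient_derivative G f z)"
proof -
  have "linear (\<lambda>x. christoffel G z x (coordinate_gradient G f z))"
    using smooth_bilinear_christoffel[OF G(1)] G(2) by (simp add: smooth_bilinear_on_def bilinear_def)
  then show ?thesis
    unfolding gradient_derivative_def[abs_def]
    by (intro linear_compose_add has_derivative_linear[OF smooth_on_has_derivative[OF
        smooth_coordinate_gradient[OF G(1) f] G(2)]])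
qed

text \<open>Differentiate the equation that defines the gradient, paired with a constant
  \<open>y\<close>. Metric compatibility splits the derivative of \<open>G\<close>, and the part
  with \<open>christoffel G z x y\<close> is the correction term of the Hessian.\<close>

lemma gradient_derivative_eq:
  assumes G: "smooth_metric_on S G" "z \<in> S" and f: "smooth_on S f"
  shows "G z (gradient_derivative G f z x) y = coordinate_hessian G f z x y"
proof -
  have S: "open S" and bil: "bilinear (G z)"
    using G by (auto simp: smooth_metric_on_def nondegenerate_form_def)
  note sb = smooth_metric_on_imp_bilinear[OF G(1)]
  let ?N = "coordinate_gradient G f"
  have N: "(?N has_derivative frechet_derivative ?N (at z)) (at z)"
    by (rule smooth_on_has_derivative[OF smooth_coordinate_gradient[OF G(1) f] G(2)])
  have "((\<lambda>z. G z (?N z) y) has_derivative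
      (\<lambda>h. bilinear_derivative G z h (?N z) y + G z (frechet_derivative ?N (at z) h) y
          + G z (?N z) 0)) (at z)"
    by (rule has_derivative_bilinear_family[OF sb G(2) N has_derivative_const])
  then have "((\<lambda>z. fderiv f z y) has_derivative
      (\<lambda>h. bilinear_derivative G z h (?N z) y + G z (frechet_derivative ?N (at z) h) y
          + G z (?N z) 0)) (at z)"
    by (rule has_derivative_transform_within_open[OF _ S G(2)])
        (rule coordinate_gradient_eq[OF G(1) _ f])
  from frechet_derivative_at[OF this, THEN fun_cong, of x]
  have "fderiv (\<lambda>z. fderiv f z y) z x =
      G z (christoffel G z x (?N z)) y + G z (?N z) (christoffel G z x y)
          + G z (frechet_derivative ?N (at z) x) y"
    using christoffel_compatible[OF G, of x "?N z" y] by (simp add: bilinear_rzero[OF bil])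
  then show ?thesis
    using coordinate_gradient_eq[OF G f]
    by (simp add: coordinate_hessian_def gradient_derivative_def bilinear_ladd[OF bil])
qed

section \<open>Charts and vector fields\<close>

locale chart =
  fixes A :: "('p::{t2_space,second_countable_topology}, 'a::euclidean_space) atlas"
    and U :: "'p set" and \<phi> :: "'p \<Rightarrow> 'a"
  assumes atlas: "smooth_atlas A" and in_atlas: "(U, \<phi>) \<in> A"
begin

abbreviation param :: "'a \<Rightarrow> 'p" where "param \<equiv> inv_into U \<phi>"
abbreviation cd :: "'p \<Rightarrow> 'a \<Rightarrow> 'p tangent" where "cd \<equiv> chart_derivative A U \<phi>"

text \<open>A tangent vector is only a functional, so its components are recovered by evaluating it
  on the coordinate functions. The formula is linear on arbitrary functionals, which allows it to be
  applied to a difference without knowing that the difference is tangent.\<close>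

definition coord_vector :: "'p tangent \<Rightarrow> 'a" where
  "coord_vector x = (\<Sum>b\<in>Basis. x (\<lambda>q. \<phi> q \<bullet> b) *\<^sub>R b)"

definition rep :: "'p vfield \<Rightarrow> 'a \<Rightarrow> 'a" where
  "rep X z = coord_vector (X (param z))"

lemma domain: "open U" "open (\<phi> ` U)" "homeomorphism U (\<phi> ` U) \<phi> param" "U \<subseteq> points A"
  using atlas in_atlas by (auto simp: smooth_atlas_def points_def)

lemma param_chart [simp]: "p \<in> U \<Longrightarrow> param (\<phi> p) = p"
  using domain(3) by (simp add: homeomorphism_def)

lemma open_chart_image:
  assumes "open W"
  shows "open (\<phi> ` (U \<inter> W))"
proof -
  have "continuous_on (\<phi> ` U) param" using domain(3) by (simp add: homeomorphism_def)
  then have "open (\<phi> ` U \<inter> param -` W)"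
    using domain(2) assms by (rule continuous_open_preimage)
  moreover have "\<phi> ` U \<inter> param -` W = \<phi> ` (U \<inter> W)"
    by force
  ultimately show ?thesis by simp
qed

lemma open_chart_image_subset: "open W \<Longrightarrow> W \<subseteq> U \<Longrightarrow> open (\<phi> ` W)"
  using open_chart_image[of W] by (simp add: Int_absorb1)

lemma open_in_subset: "open W \<Longrightarrow> W \<subseteq> U \<Longrightarrow> open_in A W"
  using domain(4) by (auto simp: open_in_def)

lemma smooth_transition:
  assumes "(V, \<psi>) \<in> A"
  shows "smooth_on (\<psi> ` (V \<inter> U)) (\<lambda>z. \<phi> (inv_into V \<psi> z))"
  using atlas in_atlas assms by (fastforce simp: smooth_atlas_def comp_def)

lemma smooth_funD:
  "smooth_fun A W f \<Longrightarrow> W \<subseteq> U \<Longrightarrow> smooth_on (\<phi> ` W) (f \<circ> param)"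
  using in_atlas by (auto simp: smooth_fun_def Int_absorb1)

text \<open>One chart is enough: in any other chart the function is its representation here composed
  with a smooth transition map.\<close>

lemma smooth_funI:
  assumes W: "open W" "W \<subseteq> U" and f: "smooth_on (\<phi> ` W) (f \<circ> param)"
  shows "smooth_fun A W f"
  unfolding smooth_fun_def
proof clarify
  fix V \<psi> assume V: "(V, \<psi>) \<in> A"
  interpret V: chart A V \<psi> using atlas V by unfold_locales
  have o: "open (\<psi> ` (V \<inter> W))" by (rule V.open_chart_image[OF W(1)])
  have "smooth_on (\<psi> ` (V \<inter> W)) (\<lambda>z. (f \<circ> param) (\<phi> (V.param z)))"
    using W by (intro smooth_on_compose[OF o open_chart_image_subset[OF W] _ f]
        smooth_on_subset[OF smooth_transition[OF V]]) auto
  then show "smooth_on (\<psi> ` (V \<inter> W)) (f \<circ> V.param)"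
    by (rule smooth_on_cong[THEN iffD1, OF o, rotated]) (use W in auto)
qed

end

lemma smooth_fun_subset: "smooth_fun A W f \<Longrightarrow> W' \<subseteq> W \<Longrightarrow> smooth_fun A W' f"
  unfolding smooth_fun_def by (auto intro: smooth_on_subset)

lemma smooth_fun_local:
  assumes A: "smooth_atlas A"
    and loc: "\<And>p. p \<in> W \<Longrightarrow> \<exists>W'. open W' \<and> p \<in> W' \<and> smooth_fun A W' f"
  shows "smooth_fun A W f"
  unfolding smooth_fun_def
proof clarify
  fix U \<phi> assume U: "(U, \<phi>) \<in> A"
  interpret chart A U \<phi> using A U by unfold_locales
  show "smooth_on (\<phi> ` (U \<inter> W)) (f \<circ> param)"
  proof (rule smooth_on_local)
    fix z assume "z \<in> \<phi> ` (U \<inter> W)"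
    then obtain p where p: "p \<in> U" "p \<in> W" "z = \<phi> p" by auto
    obtain W' where W': "open W'" "p \<in> W'" "smooth_fun A W' f" using loc[OF p(2)] by auto
    have "smooth_on (\<phi> ` (U \<inter> W')) (f \<circ> param)" using W'(3) U by (auto simp: smooth_fun_def)
    then show "\<exists>T. open T \<and> z \<in> T \<and> smooth_on T (f \<circ> param)"
      using open_chart_image[OF W'(1)] p W'(2) by blast
  qed
qed

lemma points_chart:
  assumes "p \<in> points A" obtains U \<phi> where "(U, \<phi>) \<in> A" "p \<in> U"
  using assms by (auto simp: points_def)

lemma vector_field_subset: "vector_field A W X \<Longrightarrow> W' \<subseteq> W \<Longrightarrow> vector_field A W' X"
  unfolding vector_field_def by blast

lemma vector_field_local:
  assumes A: "smooth_atlas A"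
    and loc: "\<And>p. p \<in> W \<Longrightarrow> \<exists>W'. open W' \<and> p \<in> W' \<and> vector_field A W' X"
  shows "vector_field A W X"
  unfolding vector_field_def
proof (intro conjI ballI allI impI; (elim conjE)?)
  fix p assume "p \<in> W"
  then show "X p \<in> tangent_space A p" using loc unfolding vector_field_def by blast
next
  fix V f assume V: "open_in A V" "V \<subseteq> W" "smooth_fun A V f"
  show "smooth_fun A V (\<lambda>p. X p f)"
  proof (rule smooth_fun_local[OF A])
    fix p assume p: "p \<in> V"
    then obtain W' where W': "open W'" "p \<in> W'" "vector_field A W' X" using loc V by blast
    have "open_in A (V \<inter> W')" using V W' by (auto simp: open_in_def)
    moreover have "smooth_fun A (V \<inter> W') f" using V(3) by (rule smooth_fun_subset) simp
    ultimately have "smooth_fun A (V \<inter> W') (\<lambda>p. X p f)" using W'(3) by (auto simp: vector_field_def)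
    then show "\<exists>W'. open W' \<and> p \<in> W' \<and> smooth_fun A W' (\<lambda>p. X p f)"
      using V W' p by (intro exI[of _ "V \<inter> W'"]) (auto simp: open_in_def)
  qed
qed

section \<open>Tangent vectors and vector fields in coordinates\<close>

context chart
begin

lemma smooth_nearE:
  assumes "smooth_near A p f" "p \<in> W" "open W"
  obtains W' where "open W'" "p \<in> W'" "W' \<subseteq> W" "smooth_fun A W' f"
proof -
  obtain W1 where "open_in A W1" "p \<in> W1" "smooth_fun A W1 f"
    using assms(1) by (auto simp: smooth_near_def)
  then show ?thesis
    using assms that[of "W \<inter> W1"] by (auto simp: open_in_def intro: smooth_fun_subset)
qed

lemma smooth_nearI: "open W \<Longrightarrow> W \<subseteq> U \<Longrightarrow> p \<in> W \<Longrightarrow> smooth_fun A W f \<Longrightarrow> smooth_near A p f"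
  unfolding smooth_near_def using open_in_subset by blast

lemma smooth_near_has_derivative:
  assumes "smooth_near A p f" "p \<in> U"
  shows "((f \<circ> param) has_derivative fderiv (f \<circ> param) (\<phi> p)) (at (\<phi> p))"
proof -
  obtain W where W: "open W" "p \<in> W" "W \<subseteq> U" "smooth_fun A W f"
    using smooth_nearE[OF assms domain(1)] by blast
  show ?thesis
    by (rule smooth_on_has_derivative[OF smooth_funD[OF W(4,3)]]) (use W in auto)
qed

lemma smooth_near_coordinate:
  assumes "p \<in> U"
  shows "smooth_near A p (\<lambda>q. \<phi> q \<bullet> b)"
proof (rule smooth_nearI[OF domain(1) subset_refl assms], rule smooth_funI[OF domain(1) subset_refl])
  have "smooth_on (\<phi> ` U) (\<lambda>z. z \<bullet> b)" by (rule smooth_on_bounded_linear[OF bounded_linear_inner_left])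
  then show "smooth_on (\<phi> ` U) ((\<lambda>q. \<phi> q \<bullet> b) \<circ> param)"
    by (rule smooth_on_cong[THEN iffD1, OF domain(2), rotated]) auto
qed

lemma coord_vector_cd [simp]:
  assumes p: "p \<in> U"
  shows "coord_vector (cd p v) = v"
proof -
  have "cd p v (\<lambda>q. \<phi> q \<bullet> b) = v \<bullet> b" for b
  proof -
    have "fderiv ((\<lambda>q. \<phi> q \<bullet> b) \<circ> param) (\<phi> p) v = fderiv (\<lambda>z. z \<bullet> b) (\<phi> p) v"
      by (rule fun_cong, rule frechet_derivative_cong_open[OF domain(2)]) (use p in auto)
    also have "\<dots> = v \<bullet> b"
      by (simp add: frechet_derivative_bounded_linear bounded_linear_inner_left)
    finally show ?thesis using smooth_near_coordinate[OF p] by (simp add: chart_derivative_def)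
  qed
  then show ?thesis by (simp add: coord_vector_def euclidean_representation)
qed

lemma cd_linear:
  assumes p: "p \<in> U"
  shows "cd p (a *\<^sub>R v + b *\<^sub>R w) = (\<lambda>f. a * cd p v f + b * cd p w f)"
proof
  fix f
  show "cd p (a *\<^sub>R v + b *\<^sub>R w) f = a * cd p v f + b * cd p w f"
  proof (cases "smooth_near A p f")
    case True
    then have "linear (fderiv (f \<circ> param) (\<phi> p))"
      using smooth_near_has_derivative[OF _ p] has_derivative_linear by blast
    then show ?thesis using True by (simp add: chart_derivative_def linear_add linear_scale)
  qed (simp add: chart_derivative_def)
qed

lemma coord_vector_linear:
  "coord_vector (\<lambda>f. a * x f + b * y f) = a *\<^sub>R coord_vector x + b *\<^sub>R coord_vector y"
  by (simp add: coord_vector_def scaleR_add_left sum.distrib scaleR_sum_right)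

text \<open>The chain rule for the transition map. On functions that are not smooth near
  \<open>p\<close> both sides take the default value 0, so the functionals agree everywhere.\<close>

lemma cd_transition:
  assumes V: "(V, \<psi>) \<in> A" and p: "p \<in> U" "p \<in> V"
  shows "chart_derivative A V \<psi> p v
    = cd p (fderiv (\<lambda>z. \<phi> (inv_into V \<psi> z)) (\<psi> p) v)"
proof
  fix f
  interpret V: chart A V \<psi> using atlas V by unfold_locales
  let ?t = "\<lambda>z. \<phi> (V.param z)"
  show "V.cd p v f = cd p (frechet_derivative ?t (at (\<psi> p)) v) f"
  proof (cases "smooth_near A p f")
    case True
    have o: "open (\<psi> ` (V \<inter> U))" by (rule V.open_chart_image[OF domain(1)])
    have z: "\<psi> p \<in> \<psi> ` (V \<inter> U)" using p by auto
    have "(?t has_derivative frechet_derivative ?t (at (\<psi> p))) (at (\<psi> p))"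
      by (rule smooth_on_has_derivative[OF smooth_transition[OF V] z])
    moreover have "((f \<circ> param) has_derivative fderiv (f \<circ> param) (\<phi> p)) (at (?t (\<psi> p)))"
      using smooth_near_has_derivative[OF True p(1)] p by simp
    ultimately have "((\<lambda>z. (f \<circ> param) (?t z)) has_derivative
        (\<lambda>h. fderiv (f \<circ> param) (\<phi> p) (frechet_derivative ?t (at (\<psi> p)) h))) (at (\<psi> p))"
      by (rule has_derivative_compose)
    then have "((f \<circ> V.param) has_derivative
        (\<lambda>h. fderiv (f \<circ> param) (\<phi> p) (frechet_derivative ?t (at (\<psi> p)) h))) (at (\<psi> p))"
      by (rule has_derivative_transform_within_open[OF _ o z]) auto
    from frechet_derivative_at[OF this] show ?thesis
      using True by (simp add: chart_derivative_def) metis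
  qed (simp add: chart_derivative_def)
qed

lemma tangent_space_eq:
  assumes p: "p \<in> U"
  shows "tangent_space A p = range (cd p)"
proof
  show "tangent_space A p \<subseteq> range (cd p)"
    unfolding tangent_space_def using cd_transition[OF _ p] by auto
  show "range (cd p) \<subseteq> tangent_space A p"
    unfolding tangent_space_def using in_atlas p by auto
qed

lemma cd_in_tangent_space [simp]: "p \<in> U \<Longrightarrow> cd p v \<in> tangent_space A p"
  by (simp add: tangent_space_eq)

lemma cd_coord_vector:
  "p \<in> U \<Longrightarrow> x \<in> tangent_space A p \<Longrightarrow> cd p (coord_vector x) = x"
  by (auto simp: tangent_space_eq)

lemma tangent_apply:
  assumes "p \<in> U" "x \<in> tangent_space A p" "smooth_near A p f"
  shows "x f = fderiv (f \<circ> param) (\<phi> p) (coord_vector x)"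
proof -
  have "x f = cd p (coord_vector x) f" using cd_coord_vector[OF assms(1,2)] by simp
  then show ?thesis using assms(3) by (simp add: chart_derivative_def)
qed

lemma vector_field_cd:
  assumes "vector_field A W X" "p \<in> W" "p \<in> U"
  shows "X p = cd p (rep X (\<phi> p))"
  using assms cd_coord_vector by (simp add: rep_def vector_field_def)

lemma vector_field_apply:
  assumes X: "vector_field A W X" "p \<in> W" "p \<in> U" and f: "smooth_near A p f"
  shows "X p f = fderiv (f \<circ> param) (\<phi> p) (rep X (\<phi> p))"
  using f vector_field_cd[OF X] by (simp add: chart_derivative_def)

text \<open>The components are the values of the field on the coordinate functions, and these are
  smooth on \<open>U\<close>.\<close>

lemma smooth_rep:
  assumes W: "open W" "W \<subseteq> U" and X: "vector_field A W X"
  shows "smooth_on (\<phi> ` W) (rep X)"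
proof (rule smooth_on_componentwise[OF open_chart_image_subset[OF W]])
  fix b :: 'a assume b: "b \<in> Basis"
  have "smooth_on (\<phi> ` W) (\<lambda>z. z \<bullet> b)" by (rule smooth_on_bounded_linear[OF bounded_linear_inner_left])
  then have "smooth_on (\<phi> ` W) ((\<lambda>q. \<phi> q \<bullet> b) \<circ> param)"
    by (rule smooth_on_cong[THEN iffD1, OF open_chart_image_subset[OF W], rotated]) (use W in auto)
  then have "smooth_fun A W (\<lambda>q. \<phi> q \<bullet> b)" by (rule smooth_funI[OF W])
  then have "smooth_fun A W (\<lambda>p. X p (\<lambda>q. \<phi> q \<bullet> b))"
    using X open_in_subset[OF W] by (auto simp: vector_field_def)
  from smooth_funD[OF this W(2)] show "smooth_on (\<phi> ` W) (\<lambda>z. rep X z \<bullet> b)"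
    using b by (simp add: rep_def coord_vector_def comp_def inner_sum_left inner_Basis if_distrib
        cong: if_cong)
qed

lemma vector_fieldI:
  assumes W: "open W" "W \<subseteq> U" and X: "\<And>p. p \<in> W \<Longrightarrow> X p \<in> tangent_space A p"
    and s: "smooth_on (\<phi> ` W) (rep X)"
  shows "vector_field A W X"
  unfolding vector_field_def
proof (intro conjI ballI allI impI X; (elim conjE)?)
  fix V f assume V: "open_in A V" "V \<subseteq> W" "smooth_fun A V f"
  have oV: "open V" and VU: "V \<subseteq> U" using V W by (auto simp: open_in_def)
  note o = open_chart_image_subset[OF oV VU]
  show "smooth_fun A V (\<lambda>p. X p f)"
  proof (rule smooth_funI[OF oV VU])
    have "smooth_on (\<phi> ` V) (\<lambda>z. fderiv (f \<circ> param) z (rep X z))"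
      by (intro smooth_on_frechet_derivative_along[OF o smooth_funD[OF V(3) VU]] smooth_on_subset[OF s])
         (use V in auto)
    then show "smooth_on (\<phi> ` V) ((\<lambda>p. X p f) \<circ> param)"
    proof (rule smooth_on_cong[THEN iffD1, OF o, rotated])
      fix z assume "z \<in> \<phi> ` V"
      then obtain p where p: "p \<in> V" "z = \<phi> p" by auto
      have "smooth_near A p f" by (rule smooth_nearI[OF oV VU p(1) V(3)])
      moreover have "p \<in> U" "X p \<in> tangent_space A p" using p V VU X by auto
      ultimately show "fderiv (f \<circ> param) z (rep X z) = ((\<lambda>p. X p f) \<circ> param) z"
        using tangent_apply[of p "X p" f] p by (simp add: rep_def)
    qed
  qed
qed

lemma rep_eqI:
  assumes "p \<in> U" "X p = cd p v" shows "rep X (\<phi> p) = v"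
  using assms by (simp add: rep_def)

lemma vector_field_const: "vector_field A U (\<lambda>p. cd p v)"
proof (rule vector_fieldI[OF domain(1) subset_refl])
  show "smooth_on (\<phi> ` U) (rep (\<lambda>p. cd p v))"
    by (rule smooth_on_cong[THEN iffD1, OF domain(2) _ smooth_on_const[of _ v]]) (auto simp: rep_def)
qed simp

lemma vector_field_apply_smooth:
  assumes W: "open W" "W \<subseteq> U" and Y: "vector_field A W Y" and f: "smooth_fun A W f" and z: "z \<in> \<phi> ` W"
  shows "((\<lambda>q. Y q f) \<circ> param) z = fderiv (f \<circ> param) z (rep Y z)"
proof -
  obtain p where p: "p \<in> W" "z = \<phi> p" using z by auto
  then show ?thesis using vector_field_apply[OF Y] smooth_nearI[OF W _ f] W by auto
qed

text \<open>Separates the part with the second derivative of \<open>f\<close>, where the fields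
  occur only through their values at \<open>p\<close>, from the part with the derivative of
  \<open>rep Y\<close>. The former cancels in a Lie bracket and is the leading term of the
  Hessian.\<close>

lemma vector_field_apply_apply:
  assumes W: "open W" "W \<subseteq> U" and X: "vector_field A W X" and Y: "vector_field A W Y"
    and f: "smooth_fun A W f" and p: "p \<in> W"
  shows "X p (\<lambda>q. Y q f) =
      fderiv (\<lambda>z. fderiv (f \<circ> param) z (rep Y (\<phi> p))) (\<phi> p) (rep X (\<phi> p))
    + fderiv (f \<circ> param) (\<phi> p) (fderiv (rep Y) (\<phi> p) (rep X (\<phi> p)))"
proof -
  note o = open_chart_image_subset[OF W]
  have z: "\<phi> p \<in> \<phi> ` W" using p by auto
  note F = smooth_funD[OF f W(2)]
  have "smooth_fun A W (\<lambda>q. Y q f)" using Y f open_in_subset[OF W] by (auto simp: vector_field_def)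
  then have "X p (\<lambda>q. Y q f) = fderiv ((\<lambda>q. Y q f) \<circ> param) (\<phi> p) (rep X (\<phi> p))"
    using p W by (intro vector_field_apply[OF X] smooth_nearI[OF W]) auto
  also have "fderiv ((\<lambda>q. Y q f) \<circ> param) (\<phi> p) =
      fderiv (\<lambda>z. fderiv (f \<circ> param) z (rep Y z)) (\<phi> p)"
    by (rule frechet_derivative_cong_open[OF o z]) (rule vector_field_apply_smooth[OF W Y f])
  also have "\<dots> = (\<lambda>h. fderiv (\<lambda>z. fderiv (f \<circ> param) z (rep Y (\<phi> p))) (\<phi> p) h
      + fderiv (f \<circ> param) (\<phi> p) (fderiv (rep Y) (\<phi> p) h))"
  proof (rule frechet_derivative_at[symmetric], rule has_derivative_linear_family[where f
      = "\<lambda>z. fderiv (f \<circ> param) z", OF o z])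
    show "linear (fderiv (f \<circ> param) z)" if "z \<in> \<phi> ` W" for z
      by (rule has_derivative_linear[OF smooth_on_has_derivative[OF F that]])
  qed (intro smooth_on_has_derivative[OF _ z] smooth_on_frechet_derivative F smooth_rep[OF W Y])+
  finally show ?thesis .
qed

text \<open>The second-derivative terms cancel by symmetry; for \<open>f\<close> not smooth near
  \<open>p\<close> both sides are 0 by convention.\<close>

lemma lie_bracket_eq:
  assumes W: "open W" "W \<subseteq> U" and X: "vector_field A W X" and Y: "vector_field A W Y" and p: "p \<in> W"
  shows "lie_bracket A X Y p =
    cd p (fderiv (rep Y) (\<phi> p) (rep X (\<phi> p)) - fderiv (rep X) (\<phi> p) (rep Y (\<phi> p)))"
proof
  fix f
  show "lie_bracket A X Y p f =
    cd p (fderiv (rep Y) (\<phi> p) (rep X (\<phi> p)) - fderiv (rep X) (\<phi> p) (rep Y (\<phi> p))) f"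
  proof (cases "smooth_near A p f")
    case True
    obtain W' where W': "open W'" "p \<in> W'" "W' \<subseteq> W" "smooth_fun A W' f"
      using smooth_nearE[OF True p W(1)] by blast
    have W'U: "W' \<subseteq> U" using W' W by auto
    note v = vector_field_subset[OF X W'(3)] vector_field_subset[OF Y W'(3)]
    note F = smooth_funD[OF W'(4) W'U]
    have z: "\<phi> p \<in> \<phi> ` W'" using W' by auto
    have "linear (fderiv (f \<circ> param) (\<phi> p))"
      by (rule has_derivative_linear[OF smooth_on_has_derivative[OF F z]])
    moreover note second_derivative_symmetric[OF open_chart_image_subset[OF W'(1) W'U] z F, of "rep
        Y (\<phi> p)" "rep X (\<phi> p)"]
    ultimately show ?thesis
      using True vector_field_apply_apply[OF W'(1) W'U v(1,2) W'(4,2)]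
        vector_field_apply_apply[OF W'(1) W'U v(2,1) W'(4,2)]
      by (simp add: lie_bracket_def chart_derivative_def linear_diff)
  qed (simp add: lie_bracket_def chart_derivative_def)
qed

lemma vector_field_lie_bracket:
  assumes W: "open W" "W \<subseteq> U" and X: "vector_field A W X" and Y: "vector_field A W Y"
  shows "vector_field A W (lie_bracket A X Y)"
    and "z \<in> \<phi> ` W \<Longrightarrow> rep (lie_bracket A X Y) z =
      fderiv (rep Y) z (rep X z) - fderiv (rep X) z (rep Y z)"
proof -
  show *: "rep (lie_bracket A X Y) z =
      fderiv (rep Y) z (rep X z) - fderiv (rep X) z (rep Y z)"
    if "z \<in> \<phi> ` W" for z
    using that W lie_bracket_eq[OF W X Y] by (auto simp: rep_def[of "lie_bracket A X Y"] subset_iff)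
  show "vector_field A W (lie_bracket A X Y)"
  proof (rule vector_fieldI[OF W])
    show "lie_bracket A X Y p \<in> tangent_space A p" if "p \<in> W" for p
      using lie_bracket_eq[OF W X Y that] that W by auto
    note o = open_chart_image_subset[OF W]
    have "smooth_on (\<phi> ` W) (\<lambda>z. fderiv (rep Y) z (rep X z) - fderiv (rep X) z (rep Y z))"
      by (intro smooth_on_diff o smooth_on_frechet_derivative_along smooth_rep[OF W] X Y)
    then show "smooth_on (\<phi> ` W) (rep (lie_bracket A X Y))"
      by (rule smooth_on_cong[THEN iffD1, OF o, rotated]) (rule *[symmetric])
  qed
qed

end

section \<open>The Levi-Civita connection\<close>

lemma smooth_metric_on_subset:
  "smooth_metric_on S G \<Longrightarrow> open T \<Longrightarrow> T \<subseteq> S \<Longrightarrow> smooth_metric_on T G"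
  unfolding smooth_metric_on_def by (blast intro: smooth_on_subset)

lemma smooth_bilinear_on_subset:
  "smooth_bilinear_on S T \<Longrightarrow> open S' \<Longrightarrow> S' \<subseteq> S \<Longrightarrow> smooth_bilinear_on S' T"
  unfolding smooth_bilinear_on_def by (blast intro: smooth_on_subset)

text \<open>The operator is tensorial in \<open>X\<close> but depends on \<open>Y\<close> in a
  neighborhood, hence the different assumptions on the two fields.\<close>

lemma covariant_derivative_cong:
  assumes "open S" "z \<in> S" "X z = X' z" "\<And>z. z \<in> S \<Longrightarrow> Y z = Y' z"
  shows "covariant_derivative \<Gamma> X Y z = covariant_derivative \<Gamma> X' Y' z"
  unfolding covariant_derivative_def using assms frechet_derivative_cong_open(2)[of S z Y Y'] by simp

lemma pseudo_riemannian_atlas: "pseudo_riemannian A g \<Longrightarrow> smooth_atlas A"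
  by (simp add: pseudo_riemannian_def)

context chart
begin

definition local_metric :: "'p metric \<Rightarrow> 'a \<Rightarrow> 'a \<Rightarrow> 'a \<Rightarrow> real" where
  "local_metric g z x y = g (param z) (cd (param z) x) (cd (param z) y)"

lemma cd_zero: "p \<in> U \<Longrightarrow> cd p 0 = (\<lambda>_. 0)"
  using cd_linear[of p 0 0 0 0] by simp

lemma metric_eq:
  "p \<in> U \<Longrightarrow> x \<in> tangent_space A p \<Longrightarrow> y \<in> tangent_space A p \<Longrightarrow>
    g p x y = local_metric g (\<phi> p) (coord_vector x) (coord_vector y)"
  by (simp add: local_metric_def cd_coord_vector)

lemma smooth_local_metric:
  assumes g: "pseudo_riemannian A g"
  shows "smooth_metric_on (\<phi> ` U) (local_metric g)"
  unfolding smooth_metric_on_def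
proof (intro conjI ballI allI domain(2))
  fix z assume "z \<in> \<phi> ` U"
  then obtain p where p: "p \<in> U" "z = \<phi> p" by auto
  then have pA: "p \<in> points A" using domain(4) by auto
  have lin: "g p (cd p (a *\<^sub>R x + b *\<^sub>R y)) (cd p u) = a * g p (cd p x) (cd p u) + b * g p (cd p y)
      (cd p u)" for a b x y u
    using g pA p unfolding pseudo_riemannian_def by (simp add: cd_linear)
  have sym: "g p (cd p x) (cd p y) = g p (cd p y) (cd p x)" for x y
    using g pA p unfolding pseudo_riemannian_def by simp
  show "nondegenerate_form (local_metric g z)"
    unfolding nondegenerate_form_def
  proof (intro conjI allI impI)
    have add: "local_metric g z (x + y) u = local_metric g z x u + local_metric g z y u" for x y u
      using lin[of 1 x 1 y u] p by (simp add: local_metric_def)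
    have scale: "local_metric g z (r *\<^sub>R x) u = r *\<^sub>R local_metric g z x u" for x r u
      using lin[of r x 0 x u] p by (simp add: local_metric_def)
    show s: "local_metric g z x y = local_metric g z y x" for x y
      using sym p by (simp add: local_metric_def)
    show "bilinear (local_metric g z)"
      unfolding bilinear_def
    proof (intro conjI allI linearI)
      show "local_metric g z u (x + y) = local_metric g z u x + local_metric g z u y" for x y u
        using add s by metis
      show "local_metric g z u (r *\<^sub>R x) = r *\<^sub>R local_metric g z u x" for x r u
        using scale s by metis
    qed (rule add scale)+
    fix x assume "\<forall>y. local_metric g z x y = 0"
    then have "\<forall>y\<in>tangent_space A p. g p (cd p x) y = 0"
      using p by (auto simp: local_metric_def tangent_space_eq)
    then have "cd p x = (\<lambda>_. 0)"
      using g pA p unfolding pseudo_riemannian_def by (metis cd_in_tangent_space)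
    then have "cd p x = cd p 0" using cd_zero[OF p(1)] by simp
    then show "x = 0" using p(1) coord_vector_cd by metis
  qed
next
  fix x y
  have "smooth_fun A U (\<lambda>p. g p (cd p x) (cd p y))"
    using g open_in_subset[OF domain(1)] vector_field_const unfolding pseudo_riemannian_def by blast
  from smooth_funD[OF this subset_refl] show "smooth_on (\<phi> ` U) (\<lambda>z. local_metric g z x y)"
    by (simp add: comp_def local_metric_def)
qed

end

text \<open>Turns the axioms into conditions on the coefficients in the charts of the given atlas,
  so that the warped metric has to be examined in product charts only.\<close>

lemma pseudo_riemannianI:
  assumes A: "smooth_atlas A"
    and G: "\<And>U \<phi>. (U, \<phi>) \<in> A \<Longrightarrow> smooth_metric_on (\<phi> ` U) (chart.local_metric A U \<phi> g)"
  shows "pseudo_riemannian A g"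
  unfolding pseudo_riemannian_def
proof (intro conjI ballI allI impI A)
  fix p assume pA: "p \<in> points A"
  then obtain U \<phi> where U: "(U, \<phi>) \<in> A" and p: "p \<in> U" by (rule points_chart)
  interpret chart A U \<phi> using A U by unfold_locales
  have "nondegenerate_form (local_metric g (\<phi> p))" using G[OF U] p by (simp add: smooth_metric_on_def)
  then have bil: "bilinear (local_metric g (\<phi> p))"
    and sym: "\<And>x y. local_metric g (\<phi> p) x y = local_metric g (\<phi> p) y x"
    and nd: "\<And>x. (\<forall>y. local_metric g (\<phi> p) x y = 0) \<Longrightarrow> x = 0"
    unfolding nondegenerate_form_def by blast+
  {
    fix x y assume x: "x \<in> tangent_space A p" and y: "y \<in> tangent_space A p"
    show "g p x y = g p y x" 
      using metric_eq[OF p x y, of g] metric_eq[OF p y x, of g] sym[of "coord_vector x"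
          "coord_vector y"] by simp
    fix z a b assume z: "z \<in> tangent_space A p"
    have "(\<lambda>f. a * x f + b * y f) = cd p (a *\<^sub>R coord_vector x + b *\<^sub>R coord_vector y)"
      by (simp add: cd_linear[OF p] cd_coord_vector[OF p] x y)
    then have "(\<lambda>f. a * x f + b * y f) \<in> tangent_space A p" using p by simp
    then show "g p (\<lambda>f. a * x f + b * y f) z = a * g p x z + b * g p y z"
      by (simp add: metric_eq[OF p] coord_vector_linear x y z bilinear_ladd[OF bil]
          bilinear_lmul[OF bil])
  }
  fix x assume x: "x \<in> tangent_space A p" and 0: "\<forall>y\<in>tangent_space A p. g p x y = 0"
  have "local_metric g (\<phi> p) (coord_vector x) y = 0" for y
    using 0 metric_eq[OF p x, of "cd p y" g] p by simp
  then have "coord_vector x = 0" using nd by blast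
  then show "x = (\<lambda>_. 0)" using cd_coord_vector[OF p x] cd_zero[OF p] by simp
next
  fix W X Y assume "open_in A W \<and> vector_field A W X \<and> vector_field A W Y"
  then have W: "open W" "W \<subseteq> points A" and X: "vector_field A W X" and Y: "vector_field A W Y"
    by (auto simp: open_in_def)
  show "smooth_fun A W (\<lambda>p. g p (X p) (Y p))"
  proof (rule smooth_fun_local[OF A])
    fix p assume p: "p \<in> W"
    then have "p \<in> points A" using W by auto
    then obtain U \<phi> where U: "(U, \<phi>) \<in> A" and pU: "p \<in> U" by (rule points_chart)
    interpret chart A U \<phi> using A U by unfold_locales
    have W': "open (W \<inter> U)" "W \<inter> U \<subseteq> U" using W domain by auto
    have XY: "vector_field A (W \<inter> U) X" "vector_field A (W \<inter> U) Y"
      using X Y by (auto intro: vector_field_subset)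
    have "smooth_metric_on (\<phi> ` (W \<inter> U)) (local_metric g)"
      by (rule smooth_metric_on_subset[OF G[OF U] open_chart_image_subset[OF W']]) auto
    then have "smooth_on (\<phi> ` (W \<inter> U)) (\<lambda>z. local_metric g z (rep X z) (rep Y z))"
      using smooth_on_bilinear_family[OF smooth_metric_on_imp_bilinear smooth_rep[OF W' XY(1)]
          smooth_rep[OF W' XY(2)]] by blast
    then have "smooth_on (\<phi> ` (W \<inter> U)) ((\<lambda>p. g p (X p) (Y p)) \<circ> param)"
    proof (rule smooth_on_cong[THEN iffD1, OF open_chart_image_subset[OF W'], rotated])
      fix z assume "z \<in> \<phi> ` (W \<inter> U)"
      then show "local_metric g z (rep X z) (rep Y z) = ((\<lambda>p. g p (X p) (Y p)) \<circ> param) z"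
        using X Y by (auto simp: local_metric_def rep_def cd_coord_vector vector_field_def)
    qed
    then have "smooth_fun A (W \<inter> U) (\<lambda>p. g p (X p) (Y p))" by (rule smooth_funI[OF W'])
    then show "\<exists>W'. open W' \<and> p \<in> W' \<and> smooth_fun A W' (\<lambda>p. g p (X p) (Y p))"
      using W' p pU by blast
  qed
qed

text \<open>The pointwise part of the definition of a Levi-Civita connection, which already determines
  the connection.\<close>
definition levi_civita_at ::
    "('p::{t2_space,second_countable_topology}, 'a::euclidean_space) atlas \<Rightarrow> 'p metric \<Rightarrow>
       ('p vfield \<Rightarrow> 'p vfield \<Rightarrow> 'p vfield) \<Rightarrow> 'p \<Rightarrow> bool" where
  "levi_civita_at A g D p \<longleftrightarrow>
     (\<forall>W X Y. open_in A W \<and> p \<in> W \<and> vector_field A W X \<and> vector_field A W Y \<longrightarrow>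
        D X Y p \<in> tangent_space A p \<and>
        (\<lambda>f. D X Y p f - D Y X p f) = lie_bracket A X Y p \<and>
        (\<forall>Z. vector_field A W Z \<longrightarrow>
          X p (\<lambda>q. g q (Y q) (Z q)) = g p (D X Y p) (Z p) + g p (Y p) (D X Z p)))"

lemma is_levi_civita_imp_at:
  assumes "is_levi_civita A g D"
  shows "levi_civita_at A g D p"
  unfolding levi_civita_at_def
proof (intro allI impI conjI; elim conjE)
  fix W X Y assume W: "open_in A W" "p \<in> W" and XY: "vector_field A W X" "vector_field A W Y"
  have "vector_field A W (D X Y)"
    using assms W XY by (simp add: is_levi_civita_def affine_connection_def)
  then show "D X Y p \<in> tangent_space A p" using W by (auto simp: vector_field_def)
  show "(\<lambda>f. D X Y p f - D Y X p f) = lie_bracket A X Y p"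
    using assms W XY unfolding is_levi_civita_def by blast
  show "X p (\<lambda>q. g q (Y q) (Z q)) = g p (D X Y p) (Z p) + g p (Y p) (D X Z p)"
    if "vector_field A W Z" for Z
    using assms W XY that unfolding is_levi_civita_def by blast
qed

text \<open>The difference \<open>t X Y\<close> of two such connections is symmetric in \<open>X\<close>, \<open>Y\<close>, while
  \<open>g (t X Y) Z\<close> is antisymmetric in \<open>Y\<close>, \<open>Z\<close>; hence it vanishes.\<close>
lemma levi_civita_at_unique:
  assumes g: "pseudo_riemannian A g" and D: "levi_civita_at A g D p" and D': "levi_civita_at A g D' p"
    and W: "open_in A W" "p \<in> W" and X: "vector_field A W X" and Y: "vector_field A W Y"
  shows "D X Y p = D' X Y p"
proof -
  have "p \<in> points A" using W by (auto simp: open_in_def)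
  then obtain U \<phi> where U: "(U, \<phi>) \<in> A" and p: "p \<in> U" by (rule points_chart)
  interpret chart A U \<phi> using pseudo_riemannian_atlas[OF g] U by unfold_locales
  \<comment> \<open>The argument needs a test field with a prescribed value at \<open>p\<close>.
    Fields with constant coefficients live on a chart domain, so everything is restricted to
    one.\<close>
  let ?W = "W \<inter> U"
  have W': "open_in A ?W" "p \<in> ?W" using W p domain by (auto simp: open_in_def)
  have XY: "vector_field A ?W X" "vector_field A ?W Y" using X Y by (auto intro: vector_field_subset)
  let ?G = "local_metric g (\<phi> p)"
  have nd: "nondegenerate_form ?G" using smooth_local_metric[OF g] p by (simp add: smooth_metric_on_def)
  then have bil: "bilinear ?G" and sym: "\<And>x y. ?G x y = ?G y x" by (auto simp: nondegenerate_form_def)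
  define t where "t X Y = coord_vector (D X Y p) - coord_vector (D' X Y p)" for X Y
  have T: "D X Y p \<in> tangent_space A p" "D' X Y p \<in> tangent_space A p"
    if "vector_field A ?W X" "vector_field A ?W Y" for X Y
    using D D' W' that unfolding levi_civita_at_def by blast+
  have t_sym: "t X Y = t Y X" if "vector_field A ?W X" "vector_field A ?W Y" for X Y
  proof -
    have "(\<lambda>f. D X Y p f - D Y X p f) = lie_bracket A X Y p"
      using D W' that unfolding levi_civita_at_def by blast
    moreover have "(\<lambda>f. D' X Y p f - D' Y X p f) = lie_bracket A X Y p"
      using D' W' that unfolding levi_civita_at_def by blast
    ultimately have "coord_vector (\<lambda>f. 1 * D X Y p f + (-1) * D Y X p f)
        = coord_vector (\<lambda>f. 1 * D' X Y p f + (-1) * D' Y X p f)"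
      by simp
    then show ?thesis unfolding coord_vector_linear t_def by (simp add: algebra_simps)
  qed
  have t_anti: "?G (t X Y) (coord_vector (Z p)) + ?G (coord_vector (Y p)) (t X Z) = 0"
    if v: "vector_field A ?W X" "vector_field A ?W Y" "vector_field A ?W Z" for X Y Z
  proof -
    have "X p (\<lambda>q. g q (Y q) (Z q)) = g p (D X Y p) (Z p) + g p (Y p) (D X Z p)"
      using D W' v unfolding levi_civita_at_def by blast
    moreover have "X p (\<lambda>q. g q (Y q) (Z q)) = g p (D' X Y p) (Z p) + g p (Y p) (D' X Z p)"
      using D' W' v unfolding levi_civita_at_def by blast
    moreover have "Y p \<in> tangent_space A p" "Z p \<in> tangent_space A p"
      using v W' by (auto simp: vector_field_def)
    ultimately show ?thesis
      using T[OF v(1,2)] T[OF v(1,3)]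
      by (simp add: metric_eq[OF p] t_def bilinear_lsub[OF bil] bilinear_rsub[OF bil])
  qed
  have "t X Y = 0"
  proof (rule nondegenerate_form_eqI[OF nd])
    fix v
    define Z where "Z = (\<lambda>q. cd q v)"
    have Z: "vector_field A ?W Z" using vector_field_const
        by (auto simp: Z_def intro: vector_field_subset)
    have Zp: "coord_vector (Z p) = v" using p by (simp add: Z_def)
    \<comment> \<open>Three cyclic instances of the antisymmetry, combined with the symmetry of
      \<open>t\<close>, say that \<open>a + b\<close>, \<open>b + c\<close> and \<open>c + a\<close>
      vanish; hence \<open>a = 0\<close>.\<close>
    have "?G (t X Y) v = 0"
      using t_anti[OF XY Z] t_anti[OF XY(2) Z XY(1)] t_anti[OF Z XY]
      unfolding t_sym[OF XY(2) XY(1)] t_sym[OF Z XY(1)] t_sym[OF Z XY(2)] Zp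
        sym[of v "t X Y"] sym[of "coord_vector (Y p)"] sym[of "coord_vector (X p)"]
      by linarith
    then show "?G (t X Y) v = ?G 0 v" by (simp add: bilinear_lzero[OF bil])
  qed
  then have "cd p (coord_vector (D X Y p)) = cd p (coord_vector (D' X Y p))" by (simp add: t_def)
  then show ?thesis using T[OF XY] cd_coord_vector[OF p] by simp
qed

section \<open>The connection of a single chart\<close>

context chart
begin

definition lc :: "'p metric \<Rightarrow> 'p vfield \<Rightarrow> 'p vfield \<Rightarrow> 'p vfield" where
  "lc g X Y p = cd p (covariant_derivative (christoffel (local_metric g)) (rep X) (rep Y) (\<phi> p))"

lemma rep_lc: "z \<in> \<phi> ` U \<Longrightarrow> rep (lc g X Y) z = covariant_derivative (christoffel (local_metric g))
    (rep X) (rep Y) z"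
  by (auto simp: rep_def lc_def)

lemma smooth_christoffel_local:
  assumes "pseudo_riemannian A g" "open W" "W \<subseteq> U"
  shows "smooth_bilinear_on (\<phi> ` W) (christoffel (local_metric g))"
  by (rule smooth_bilinear_on_subset[OF smooth_bilinear_christoffel[OF smooth_local_metric[OF assms(1)]]
        open_chart_image_subset[OF assms(2,3)]]) (use assms(3) in auto)

text \<open>Vanishing torsion is the symmetry of the Christoffel symbols, the remaining terms
  forming the coordinate bracket. Metric compatibility is the product rule combined with the
  compatibility of the Christoffel symbols.\<close>

lemma lc_levi_civita_at:
  assumes g: "pseudo_riemannian A g" and p: "p \<in> U"
  shows "levi_civita_at A g (lc g) p"
  unfolding levi_civita_at_def
proof (intro allI impI conjI; elim conjE)
  fix W X Y assume W: "open_in A W" "p \<in> W" and "vector_field A W X" "vector_field A W Y"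
  let ?W = "W \<inter> U"
  have W': "open ?W" "?W \<subseteq> U" "p \<in> ?W" using W p domain by (auto simp: open_in_def)
  have XY: "vector_field A ?W X" "vector_field A ?W Y"
    using \<open>vector_field A W X\<close> \<open>vector_field A W Y\<close> by (auto intro: vector_field_subset)
  let ?G = "local_metric g" and ?\<Gamma> = "christoffel (local_metric g)"
  note G = smooth_local_metric[OF g]
  have z: "\<phi> p \<in> \<phi> ` U" "\<phi> p \<in> \<phi> ` ?W" using p W' by auto
  show "lc g X Y p \<in> tangent_space A p" using p by (simp add: lc_def)
  have minus: "cd p (v - w) = (\<lambda>f. cd p v f - cd p w f)" for v w
    using cd_linear[OF p, of 1 v "-1" w] by simp
  show "(\<lambda>f. lc g X Y p f - lc g Y X p f) = lie_bracket A X Y p"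
    unfolding lie_bracket_eq[OF W'(1,2) XY W'(3)] lc_def minus[symmetric] covariant_derivative_def
    using christoffel_symmetric[OF G z(1)] by simp
  fix Z assume "vector_field A W Z"
  then have Z: "vector_field A ?W Z" by (auto intro: vector_field_subset)
  have "smooth_fun A ?W (\<lambda>q. g q (Y q) (Z q))"
    using g open_in_subset[OF W'(1,2)] XY(2) Z unfolding pseudo_riemannian_def by blast
  then have sn: "smooth_near A p (\<lambda>q. g q (Y q) (Z q))" by (rule smooth_nearI[OF W'])
  note o = open_chart_image_subset[OF W'(1,2)]
  have "fderiv ((\<lambda>q. g q (Y q) (Z q)) \<circ> param) (\<phi> p)
      = fderiv (\<lambda>z. ?G z (rep Y z) (rep Z z)) (\<phi> p)"
  proof (rule frechet_derivative_cong_open[OF o z(2)])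
    fix z assume "z \<in> \<phi> ` ?W"
    then obtain q where q: "q \<in> ?W" "z = \<phi> q" by auto
    then have "Y q \<in> tangent_space A q" "Z q \<in> tangent_space A q"
      using XY Z by (auto simp: vector_field_def)
    then show "((\<lambda>q. g q (Y q) (Z q)) \<circ> param) z = ?G z (rep Y z) (rep Z z)"
      using q by (simp add: rep_def metric_eq)
  qed
  also have "\<dots> = (\<lambda>h. bilinear_derivative ?G (\<phi> p) h (rep Y (\<phi> p)) (rep Z (\<phi> p))
      + ?G (\<phi> p) (fderiv (rep Y) (\<phi> p) h) (rep Z (\<phi> p))
      + ?G (\<phi> p) (rep Y (\<phi> p)) (fderiv (rep Z) (\<phi> p) h))"
    by (rule frechet_derivative_at[symmetric],
        rule has_derivative_bilinear_family[OF smooth_metric_on_imp_bilinear[OF G] z(1)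
          smooth_on_has_derivative[OF smooth_rep[OF W'(1,2) XY(2)] z(2)]
          smooth_on_has_derivative[OF smooth_rep[OF W'(1,2) Z] z(2)]])
  finally have d: "X p (\<lambda>q. g q (Y q) (Z q)) =
      bilinear_derivative ?G (\<phi> p) (rep X (\<phi> p)) (rep Y (\<phi> p)) (rep Z (\<phi> p))
      + ?G (\<phi> p) (fderiv (rep Y) (\<phi> p) (rep X (\<phi> p))) (rep Z (\<phi> p))
      + ?G (\<phi> p) (rep Y (\<phi> p)) (fderiv (rep Z) (\<phi> p) (rep X (\<phi> p)))"
    using vector_field_apply[OF XY(1) W'(3) p sn] by simp
  have bil: "bilinear (?G (\<phi> p))"
      by (rule smooth_bilinear_onD[OF smooth_metric_on_imp_bilinear[OF G] z(1)])
  have YZp: "Y p = cd p (rep Y (\<phi> p))" "Z p = cd p (rep Z (\<phi> p))"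
    using vector_field_cd[OF XY(2) W'(3) p] vector_field_cd[OF Z W'(3) p] .
  have gp: "g p (cd p v) (cd p w) = ?G (\<phi> p) v w" for v w using p by (simp add: local_metric_def)
  show "X p (\<lambda>q. g q (Y q) (Z q)) = g p (lc g X Y p) (Z p) + g p (Y p) (lc g X Z p)"
    unfolding d YZp lc_def gp covariant_derivative_def christoffel_compatible[OF G z(1)]
    by (simp add: bilinear_ladd[OF bil] bilinear_radd[OF bil])
qed

lemma vector_field_lc:
  assumes g: "pseudo_riemannian A g" and W: "open W" "W \<subseteq> U"
    and X: "vector_field A W X" and Y: "vector_field A W Y"
  shows "vector_field A W (lc g X Y)"
proof (rule vector_fieldI[OF W])
  show "lc g X Y p \<in> tangent_space A p" if "p \<in> W" for p
    using that W by (auto simp: lc_def)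
  have "smooth_on (\<phi> ` W) (covariant_derivative (christoffel (local_metric g)) (rep X) (rep Y))"
    by (rule smooth_covariant_derivative[OF smooth_christoffel_local[OF g W] smooth_rep[OF W X]
        smooth_rep[OF W Y]])
  then show "smooth_on (\<phi> ` W) (rep (lc g X Y))"
    by (rule smooth_on_cong[THEN iffD1, OF open_chart_image_subset[OF W], rotated])
       (rule rep_lc[symmetric], use W in auto)
qed

lemma vector_field_cong:
  assumes "open W" "W \<subseteq> U" "\<And>p. p \<in> W \<Longrightarrow> X p = Y p" "vector_field A W X"
  shows "vector_field A W Y"
proof (rule vector_fieldI[OF assms(1,2)])
  show "Y p \<in> tangent_space A p" if "p \<in> W" for p
    using assms(3,4) that by (metis vector_field_def)
  show "smooth_on (\<phi> ` W) (rep Y)"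
    by (rule smooth_on_cong[THEN iffD1, OF open_chart_image_subset[OF assms(1,2)] _
        smooth_rep[OF assms(1,2,4)]])
       (use assms(2,3) in \<open>auto simp: rep_def subset_iff\<close>)
qed


context
  fixes g W p
  assumes g: "pseudo_riemannian A g" and W: "open W" "W \<subseteq> U" and p: "p \<in> W"
begin

lemma bilinear_christoffel_local: "bilinear (christoffel (local_metric g) (\<phi> p))"
  by (rule smooth_bilinear_onD[OF smooth_christoffel_local[OF g W]]) (use p in auto)

lemma has_derivative_rep:
  "vector_field A W Y \<Longrightarrow> (rep Y has_derivative fderiv (rep Y) (\<phi> p)) (at (\<phi> p))"
  by (rule smooth_on_has_derivative[OF smooth_rep[OF W]]) (use p in auto)

lemma lc_linear_left:
  assumes Y: "vector_field A W Y"
  shows "lc g (\<lambda>q f. h q * X q f + h' q * X' q f) Y p = (\<lambda>f. h p * lc g X Y p f + h' p * lc g X' Y p f)"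
proof -
  have pU: "p \<in> U" using p W by auto
  note bil = bilinear_christoffel_local and l = has_derivative_linear[OF has_derivative_rep[OF Y]]
  have "rep (\<lambda>q f. h q * X q f + h' q * X' q f) (\<phi> p) = h p *\<^sub>R rep X (\<phi> p) + h' p *\<^sub>R rep X' (\<phi> p)"
    using pU by (simp add: rep_def coord_vector_linear)
  then show ?thesis
    unfolding lc_def cd_linear[OF pU, symmetric] covariant_derivative_def
    by (simp only: linear_add[OF l] linear_scale[OF l] bilinear_ladd[OF bil] bilinear_lmul[OF bil])
       (simp add: algebra_simps)
qed

lemma lc_add_right:
  assumes Y: "vector_field A W Y" and Y': "vector_field A W Y'"
  shows "lc g X (\<lambda>q f. Y q f + Y' q f) p = (\<lambda>f. lc g X Y p f + lc g X Y' p f)"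
proof -
  have pU: "p \<in> U" using p W by auto
  have "rep (\<lambda>q f. Y q f + Y' q f) = (\<lambda>z. rep Y z + rep Y' z)"
    using coord_vector_linear[of 1 _ 1] by (simp add: rep_def fun_eq_iff)
  then show ?thesis
    using cd_linear[OF pU, of 1 _ 1, simplified, symmetric]
      frechet_derivative_at[OF has_derivative_add[OF has_derivative_rep[OF Y] has_derivative_rep[OF
          Y']], symmetric]
    by (simp add: lc_def covariant_derivative_def bilinear_radd[OF bilinear_christoffel_local] add_ac)
qed

lemma lc_leibniz:
  assumes X: "vector_field A W X" and Y: "vector_field A W Y" and h: "smooth_fun A W h"
  shows "lc g X (\<lambda>q f. h q * Y q f) p = (\<lambda>f. X p h * Y p f + h p * lc g X Y p f)"
proof -
  have pU: "p \<in> U" using p W by auto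
  have n: "smooth_near A p h" by (rule smooth_nearI[OF W p h])
  have Xh: "X p h = fderiv (h \<circ> param) (\<phi> p) (rep X (\<phi> p))"
    by (rule vector_field_apply[OF X p pU n])
  have Yp: "Y p = cd p (rep Y (\<phi> p))" by (rule vector_field_cd[OF Y p pU])
  note dY = has_derivative_scaleR[OF smooth_near_has_derivative[OF n pU] has_derivative_rep[OF Y]]
  have r: "rep (\<lambda>q f. h q * Y q f) = (\<lambda>z. (h \<circ> param) z *\<^sub>R rep Y z)"
    using coord_vector_linear[of _ _ 0] by (simp add: rep_def fun_eq_iff)
  have "covariant_derivative (christoffel (local_metric g)) (rep X) (\<lambda>z. (h \<circ> param) z *\<^sub>R rep Y z) (\<phi> p)
    = X p h *\<^sub>R rep Y (\<phi> p) + h p *\<^sub>R covariant_derivative (christoffel (local_metric g)) (rep X)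
        (rep Y) (\<phi> p)"
    unfolding covariant_derivative_def Xh frechet_derivative_at[OF dY, symmetric]
    using pU by (simp add: bilinear_rmul[OF bilinear_christoffel_local] algebra_simps)
  then show ?thesis
    unfolding lc_def r by (simp only: cd_linear[OF pU] Yp[symmetric])
qed

end

end

text \<open>At each point the connection of a chosen chart around that point is used. The axioms
  that concern a single point can be read off in its chart; smoothness of the derived field cannot,
  as the chosen chart may jump from point to point.\<close>

lemma levi_civita_exists:
  assumes g: "pseudo_riemannian A g"
  shows "\<exists>D. is_levi_civita A g D"
proof -
  note A = pseudo_riemannian_atlas[OF g]
  define ch where "ch p = (SOME c. c \<in> A \<and> p \<in> fst c)" for p
  have ch: "ch p \<in> A \<and> p \<in> fst (ch p)" if "p \<in> points A" for p
    unfolding ch_def by (rule someI_ex) (use that in \<open>force simp: points_def\<close>)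
  define D where "D X Y p = chart.lc A (fst (ch p)) (snd (ch p)) g X Y p" for X Y p
  have D_chart: "\<exists>U \<phi>. (U, \<phi>) \<in> A \<and> p \<in> W \<inter> U \<and> (\<forall>X Y. D X Y p = chart.lc A U \<phi> g X Y p)"
    if "open_in A W" "p \<in> W" for W p
    using ch[of p] that
    by (intro exI[of _ "fst (ch p)"] exI[of _ "snd (ch p)"]) (auto simp: D_def open_in_def)
  have opn: "open (W \<inter> U)" "W \<inter> U \<subseteq> U" if "open_in A W" "(U, \<phi>) \<in> A" for W U \<phi>
    using that A by (auto simp: open_in_def smooth_atlas_def)
  have chart: "chart A U \<phi>" if "(U, \<phi>) \<in> A" for U \<phi>
    using A that by unfold_locales
  have at: "levi_civita_at A g D p" if pA: "open_in A W" "p \<in> W" for W p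
  proof -
    obtain U \<phi> where U: "(U, \<phi>) \<in> A" "p \<in> W \<inter> U" "\<And>X Y. D X Y p = chart.lc A U \<phi> g X Y p"
      using D_chart[OF pA] by blast
    then show ?thesis
      using chart.lc_levi_civita_at[OF chart[OF U(1)] g, of p] unfolding levi_civita_at_def U(3) by blast
  qed
  have aff: "affine_connection A D"
    unfolding affine_connection_def
  proof (intro allI impI conjI; (elim conjE)?)
    fix W X Y assume W: "open_in A W" and X: "vector_field A W X" and Y: "vector_field A W Y"
    show "vector_field A W (D X Y)"
    proof (rule vector_field_local[OF A])
      fix p assume p: "p \<in> W"
      then have "p \<in> points A" using W by (auto simp: open_in_def)
      then obtain U \<phi> where U: "(U, \<phi>) \<in> A" "p \<in> U" by (rule points_chart)
      interpret chart A U \<phi> using A U by unfold_locales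
      have W': "open (W \<inter> U)" "W \<inter> U \<subseteq> U" using W domain by (auto simp: open_in_def)
      have XY: "vector_field A (W \<inter> U) X" "vector_field A (W \<inter> U) Y"
        using X Y by (auto intro: vector_field_subset)
      \<comment> \<open>On the domain of one fixed chart the glued connection agrees with the
        connection of that chart by pointwise uniqueness, whichever charts were chosen, and so
        inherits its smoothness.\<close>
      have "vector_field A (W \<inter> U) (D X Y)"
      proof (rule vector_field_cong[OF W' _ vector_field_lc[OF g W' XY]])
        fix q assume q: "q \<in> W \<inter> U"
        then show "lc g X Y q = D X Y q"
          by (intro levi_civita_at_unique[OF g lc_levi_civita_at[OF g] at[OF W]
              open_in_subset[OF W'] _ XY]) auto
      qed
      then show "\<exists>W'. open W' \<and> p \<in> W' \<and> vector_field A W' (D X Y)" using W' p U by blast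
    qed
  next
    fix W X X' Y h h'
    assume W: "open_in A W" and Y: "vector_field A W Y"
    show "\<forall>p\<in>W. D (\<lambda>q f. h q * X q f + h' q * X' q f) Y p = (\<lambda>f. h p * D X Y p f + h' p * D X' Y p f)"
    proof
      fix p assume "p \<in> W"
      then obtain U \<phi> where U: "(U, \<phi>) \<in> A" "p \<in> W \<inter> U" "\<And>X Y. D X Y p = chart.lc A U \<phi> g X Y p"
        using D_chart[OF W] by blast
      show "D (\<lambda>q f. h q * X q f + h' q * X' q f) Y p = (\<lambda>f. h p * D X Y p f + h' p * D X' Y p f)"
        unfolding U(3)
        by (rule chart.lc_linear_left[OF chart[OF U(1)] g opn[OF W U(1)] U(2) vector_field_subset[OF
            Y]]) simp
    qed
  next
    fix W X Y Y'
    assume W: "open_in A W" and Y: "vector_field A W Y" "vector_field A W Y'"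
    show "\<forall>p\<in>W. D X (\<lambda>q f. Y q f + Y' q f) p = (\<lambda>f. D X Y p f + D X Y' p f)"
    proof
      fix p assume "p \<in> W"
      then obtain U \<phi> where U: "(U, \<phi>) \<in> A" "p \<in> W \<inter> U" "\<And>X Y. D X Y p = chart.lc A U \<phi> g X Y p"
        using D_chart[OF W] by blast
      show "D X (\<lambda>q f. Y q f + Y' q f) p = (\<lambda>f. D X Y p f + D X Y' p f)"
        unfolding U(3)
        by (rule chart.lc_add_right[OF chart[OF U(1)] g opn[OF W U(1)] U(2)
            Y[THEN vector_field_subset]]) simp_all
    qed
  next
    fix W X Y h
    assume W: "open_in A W" and v: "vector_field A W X" "vector_field A W Y" and h: "smooth_fun A W h"
    show "\<forall>p\<in>W. D X (\<lambda>q f. h q * Y q f) p = (\<lambda>f. X p h * Y p f + h p * D X Y p f)"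
    proof
      fix p assume "p \<in> W"
      then obtain U \<phi> where U: "(U, \<phi>) \<in> A" "p \<in> W \<inter> U" "\<And>X Y. D X Y p = chart.lc A U \<phi> g X Y p"
        using D_chart[OF W] by blast
      show "D X (\<lambda>q f. h q * Y q f) p = (\<lambda>f. X p h * Y p f + h p * D X Y p f)"
        unfolding U(3)
        by (rule chart.lc_leibniz[OF chart[OF U(1)] g opn[OF W U(1)] U(2)
              v[THEN vector_field_subset] smooth_fun_subset[OF h]]) simp_all
    qed
  qed
  have "is_levi_civita A g D"
    unfolding is_levi_civita_def
  proof (intro conjI aff allI impI ballI; elim conjE)
    fix W X Y p assume W: "open_in A W" and X: "vector_field A W X" and Y: "vector_field A W Y"
        and p: "p \<in> W"
    then show "(\<lambda>f. D X Y p f - D Y X p f) = lie_bracket A X Y p"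
      using at[OF W p] unfolding levi_civita_at_def by blast
  next
    fix W X Y Z p assume W: "open_in A W" and v: "vector_field A W X" "vector_field A W Y"
        "vector_field A W Z" and p: "p \<in> W"
    then show "X p (\<lambda>q. g q (Y q) (Z q)) = g p (D X Y p) (Z p) + g p (Y p) (D X Z p)"
      using at[OF W p] unfolding levi_civita_at_def by blast
  qed
  then show ?thesis by blast
qed

lemma is_levi_civita_levi_civita:
  "pseudo_riemannian A g \<Longrightarrow> is_levi_civita A g (levi_civita A g)"
  unfolding levi_civita_def by (rule someI_ex[OF levi_civita_exists])

section \<open>Ricci tensor, Hessian and Laplacian in a chart\<close>

context chart
begin

text \<open>Existence makes the connection picked by \<open>SOME\<close> satisfy the axioms, and
  uniqueness identifies it with the chart formula.\<close>

lemma levi_civita_eq: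
  assumes g: "pseudo_riemannian A g" and W: "open W" "W \<subseteq> U"
    and X: "vector_field A W X" and Y: "vector_field A W Y" and p: "p \<in> W"
  shows "levi_civita A g X Y p = lc g X Y p"
  using p W
  by (intro levi_civita_at_unique[OF g is_levi_civita_imp_at[OF is_levi_civita_levi_civita[OF g]]
        lc_levi_civita_at[OF g] open_in_subset[OF W] p X Y]) auto

lemma vector_field_levi_civita:
  assumes g: "pseudo_riemannian A g" and W: "open W" "W \<subseteq> U"
    and X: "vector_field A W X" and Y: "vector_field A W Y"
  shows "vector_field A W (levi_civita A g X Y)"
  by (rule vector_field_cong[OF W levi_civita_eq[OF g W X Y, symmetric] vector_field_lc[OF g W X Y]])

lemma rep_levi_civita:
  assumes g: "pseudo_riemannian A g" and W: "open W" "W \<subseteq> U"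
    and X: "vector_field A W X" and Y: "vector_field A W Y" and z: "z \<in> \<phi> ` W"
  shows "rep (levi_civita A g X Y) z = covariant_derivative (christoffel (local_metric g)) (rep X)
      (rep Y) z"
proof -
  obtain p where p: "p \<in> W" "z = \<phi> p" using z by auto
  then have "rep (levi_civita A g X Y) z = rep (lc g X Y) z"
    using levi_civita_eq[OF g W X Y] W by (auto simp: rep_def subset_iff)
  then show ?thesis using rep_lc z W by auto
qed

lemma curvature_eq:
  assumes g: "pseudo_riemannian A g" and W: "open W" "W \<subseteq> U"
    and X: "vector_field A W X" and Y: "vector_field A W Y" and Z: "vector_field A W Z" and p: "p \<in> W"
  shows "curvature A g X Y Z p =
    cd p (riemann (christoffel (local_metric g)) (\<phi> p) (rep X (\<phi> p)) (rep Y (\<phi> p)) (rep Z (\<phi> p)))"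
proof -
  let ?D = "levi_civita A g" and ?cov = "covariant_derivative (christoffel (local_metric g))"
  have pU: "p \<in> U" using p W by auto
  have z: "\<phi> p \<in> \<phi> ` W" using p by auto
  note o = open_chart_image_subset[OF W]
  \<comment> \<open>The outer derivative sees the inner field in a neighborhood, so the coordinate
    formula for the inner field is used on all of \<open>W\<close> and not just at
    \<open>p\<close>.\<close>
  have nested: "?D X (?D Y Z) p = cd p (?cov (rep X) (?cov (rep Y) (rep Z)) (\<phi> p))"
    if X: "vector_field A W X" and Y: "vector_field A W Y" for X Y
    unfolding levi_civita_eq[OF g W X vector_field_levi_civita[OF g W Y Z] p] lc_def
    by (rule arg_cong[where f = "cd p"], rule covariant_derivative_cong[OF o z refl
        rep_levi_civita[OF g W Y Z]])
  have bracket: "?D (lie_bracket A X Y) Z p =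
      cd p (?cov (\<lambda>z. fderiv (rep Y) z (rep X z) - fderiv (rep X) z (rep Y z)) (rep Z) (\<phi> p))"
    unfolding levi_civita_eq[OF g W vector_field_lie_bracket(1)[OF W X Y] Z p] lc_def
    by (simp add: covariant_derivative_def vector_field_lie_bracket(2)[OF W X Y z])
  have minus: "cd p (v - w) = (\<lambda>f. cd p v f - cd p w f)" for v w
    using cd_linear[OF pU, of 1 v "-1" w] by simp
  show ?thesis
    unfolding curvature_def Let_def nested[OF X Y] nested[OF Y X] bracket
      riemann_eq[OF smooth_christoffel_local[OF g W] z smooth_rep[OF W X] smooth_rep[OF W Y]
          smooth_rep[OF W Z], symmetric]
      minus ..
qed

text \<open>Fields with constant coefficients that extend an orthonormal basis at \<open>p\<close>
  form a frame, because orthonormality is demanded at \<open>p\<close> only.\<close>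

lemma orthonormal_frame_SOME:
  assumes g: "pseudo_riemannian A g" and p: "p \<in> U"
  shows "orthonormal_frame A g p (SOME E. orthonormal_frame A g p E)"
proof -
  have "nondegenerate_form (local_metric g (\<phi> p))"
    using smooth_local_metric[OF g] p by (simp add: smooth_metric_on_def)
  then obtain e where e: "orthonormal_family (local_metric g (\<phi> p)) DIM('a) e"
    using orthonormal_family_exists[of "local_metric g (\<phi> p)" "DIM('a)"] by auto
  have "orthonormal_frame A g p (\<lambda>i q. cd q (e i))"
    using e p open_in_subset[OF domain(1)] vector_field_const
    by (auto simp: orthonormal_frame_def orthonormal_family_def local_metric_def)
  then show ?thesis by (rule someI[where P = "orthonormal_frame A g p"])
qed

lemma orthonormal_frame_coordinates:
  assumes E: "orthonormal_frame A g p E" and p: "p \<in> U"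
  obtains W where "open W" "W \<subseteq> U" "p \<in> W" "\<And>i. i < DIM('a) \<Longrightarrow> vector_field A W (E i)"
    "orthonormal_family (local_metric g (\<phi> p)) DIM('a) (\<lambda>i. rep (E i) (\<phi> p))"
proof -
  have "\<exists>W. open_in A W \<and> p \<in> W \<and> (\<forall>i<DIM('a). vector_field A W (E i))"
    using E by (simp add: orthonormal_frame_def)
  then obtain W where "open_in A W \<and> p \<in> W \<and> (\<forall>i<DIM('a). vector_field A W (E i))" ..
  then have W: "open_in A W" "p \<in> W" "\<And>i. i < DIM('a) \<Longrightarrow> vector_field A W (E i)" by simp_all
  have "local_metric g (\<phi> p) (rep (E i) (\<phi> p)) (rep (E j) (\<phi> p)) = g p (E i p) (E j p)"
    if "i < DIM('a)" "j < DIM('a)" for i j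
    using vector_field_cd[OF W(3,2) p] that p by (simp add: local_metric_def)
  then have "orthonormal_family (local_metric g (\<phi> p)) DIM('a) (\<lambda>i. rep (E i) (\<phi> p))"
    using E unfolding orthonormal_frame_def orthonormal_family_def by simp
  then show ?thesis
    using W p domain(1) that[of "W \<inter> U"] by (auto simp: open_in_def intro: vector_field_subset)
qed

text \<open>The chosen frame is known only to be smooth near \<open>p\<close> and orthonormal at
  \<open>p\<close>; tensoriality of the curvature and invariance of the trace remove it. The trace
  runs over the first argument of \<open>R(e, Y)X\<close>, whence \<open>Y\<close> precedes
  \<open>X\<close> on the right.\<close>

lemma ricci_eq:
  assumes g: "pseudo_riemannian A g" and W: "open W" "W \<subseteq> U"
    and X: "vector_field A W X" and Y: "vector_field A W Y" and p: "p \<in> W"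
  shows "ricci A g X Y p =
    (\<Sum>b\<in>Basis. riemann (christoffel (local_metric g)) (\<phi> p) b (rep Y (\<phi> p)) (rep X (\<phi> p)) \<bullet> b)"
proof -
  have pU: "p \<in> U" using p W by auto
  have z: "\<phi> p \<in> \<phi> ` U" using pU by auto
  define E where "E = (SOME E. orthonormal_frame A g p E)"
  have "orthonormal_frame A g p E" unfolding E_def by (rule orthonormal_frame_SOME[OF g pU])
  then obtain W1 where W1: "open W1" "W1 \<subseteq> U" "p \<in> W1" "\<And>i. i < DIM('a) \<Longrightarrow> vector_field A W1 (E i)"
    and on: "orthonormal_family (local_metric g (\<phi> p)) DIM('a) (\<lambda>i. rep (E i) (\<phi> p))"
    using orthonormal_frame_coordinates[OF _ pU] by blast
  have W2: "open (W \<inter> W1)" "W \<inter> W1 \<subseteq> U" "p \<in> W \<inter> W1" using W W1 p by auto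
  have XY: "vector_field A (W \<inter> W1) X" "vector_field A (W \<inter> W1) Y"
    using X Y by (auto intro: vector_field_subset)
  let ?G = "local_metric g (\<phi> p)" and ?\<Gamma> = "christoffel (local_metric g)"
  let ?R = "\<lambda>v. riemann ?\<Gamma> (\<phi> p) v (rep Y (\<phi> p)) (rep X (\<phi> p))"
  note sb = smooth_bilinear_christoffel[OF smooth_local_metric[OF g]]
  have bil: "bilinear (?\<Gamma> (\<phi> p))" by (rule smooth_bilinear_onD[OF sb z])
  note l = linear_bilinear_derivative[OF sb z]
  have "linear ?R"
    unfolding riemann_def using l[THEN linear_add] l[THEN linear_scale]
    by (intro linearI) (simp_all add: bilinear_ladd[OF bil] bilinear_lmul[OF bil] bilinear_radd[OF bil]
        bilinear_rmul[OF bil] algebra_simps)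
  moreover have "bilinear ?G" using smooth_bilinear_onD[OF smooth_metric_on_imp_bilinear[OF
      smooth_local_metric[OF g]] z] .
  ultimately have tr: "(\<Sum>i<DIM('a). ?G (rep (E i) (\<phi> p)) (rep (E i) (\<phi> p)) * ?G
      (?R (rep (E i) (\<phi> p))) (rep (E i) (\<phi> p)))
      = (\<Sum>b\<in>Basis. ?R b \<bullet> b)"
    by (intro orthonormal_trace on)
  have "g p (E i p) (E i p) * g p (curvature A g (E i) Y X p) (E i p) =
      ?G (rep (E i) (\<phi> p)) (rep (E i) (\<phi> p)) * ?G (?R (rep (E i) (\<phi> p))) (rep (E i) (\<phi> p))"
    if i: "i < DIM('a)" for i
  proof -
    have Ei: "vector_field A (W \<inter> W1) (E i)" using W1(4)[OF i] by (auto intro: vector_field_subset)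
    show ?thesis
      unfolding curvature_eq[OF g W2(1,2) Ei XY(2,1) W2(3)] vector_field_cd[OF Ei W2(3) pU]
      using pU by (simp add: local_metric_def)
  qed
  then show ?thesis
    unfolding ricci_def E_def[symmetric] Let_def tr[symmetric] by (intro sum.cong) auto
qed

lemma hessian_eq:
  assumes g: "pseudo_riemannian A g" and W: "open W" "W \<subseteq> U"
    and X: "vector_field A W X" and Y: "vector_field A W Y" and f: "smooth_fun A W f" and p: "p \<in> W"
  shows "hessian A g f X Y p =
    coordinate_hessian (local_metric g) (f \<circ> param) (\<phi> p) (rep X (\<phi> p)) (rep Y (\<phi> p))"
proof -
  have pU: "p \<in> U" using p W by auto
  have n: "smooth_near A p f" by (rule smooth_nearI[OF W p f])
  have "linear (fderiv (f \<circ> param) (\<phi> p))"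
    by (rule has_derivative_linear[OF smooth_near_has_derivative[OF n pU]])
  then show ?thesis
    unfolding hessian_def vector_field_apply_apply[OF W X Y f p] levi_civita_eq[OF g W X Y p] lc_def
        coordinate_hessian_def
    using n by (simp add: chart_derivative_def covariant_derivative_def linear_add)
qed

text \<open>Each diagonal Hessian value is a pairing with the Hessian operator, so the frame sum is
  the trace of that operator.\<close>

lemma laplacian_eq:
  assumes g: "pseudo_riemannian A g" and W: "open W" "W \<subseteq> U" and f: "smooth_fun A W f" and p: "p \<in> W"
  shows "laplacian A g f p = (\<Sum>b\<in>Basis. gradient_derivative (local_metric g) (f \<circ> param) (\<phi> p) b \<bullet> b)"
proof -
  have pU: "p \<in> U" using p W by auto
  have z: "\<phi> p \<in> \<phi> ` W" using p by auto
  define E where "E = (SOME E. orthonormal_frame A g p E)"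
  have "orthonormal_frame A g p E" unfolding E_def by (rule orthonormal_frame_SOME[OF g pU])
  then obtain W1 where W1: "open W1" "W1 \<subseteq> U" "p \<in> W1" "\<And>i. i < DIM('a) \<Longrightarrow> vector_field A W1 (E i)"
    and on: "orthonormal_family (local_metric g (\<phi> p)) DIM('a) (\<lambda>i. rep (E i) (\<phi> p))"
    using orthonormal_frame_coordinates[OF _ pU] by blast
  have W2: "open (W \<inter> W1)" "W \<inter> W1 \<subseteq> U" "p \<in> W \<inter> W1" using W W1 p by auto
  have f': "smooth_fun A (W \<inter> W1) f" by (rule smooth_fun_subset[OF f]) simp
  let ?G = "local_metric g (\<phi> p)" and ?L = "gradient_derivative (local_metric g) (f \<circ> param) (\<phi> p)"
  have G: "smooth_metric_on (\<phi> ` W) (local_metric g)"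
    by (rule smooth_metric_on_subset[OF smooth_local_metric[OF g] open_chart_image_subset[OF W]])
        (use W in auto)
  note F = smooth_funD[OF f W(2)]
  have bil: "bilinear ?G" by (rule smooth_bilinear_onD[OF smooth_metric_on_imp_bilinear[OF G] z])
  have tr: "(\<Sum>i<DIM('a). ?G (rep (E i) (\<phi> p)) (rep (E i) (\<phi> p)) * ?G (?L (rep (E i) (\<phi> p)))
      (rep (E i) (\<phi> p)))
      = (\<Sum>b\<in>Basis. ?L b \<bullet> b)"
    by (intro orthonormal_trace on bil linear_gradient_derivative[OF G z F])
  have "g p (E i p) (E i p) * hessian A g f (E i) (E i) p =
      ?G (rep (E i) (\<phi> p)) (rep (E i) (\<phi> p)) * ?G (?L (rep (E i) (\<phi> p))) (rep (E i) (\<phi> p))"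
    if i: "i < DIM('a)" for i
  proof -
    have Ei: "vector_field A (W \<inter> W1) (E i)" using W1(4)[OF i] by (auto intro: vector_field_subset)
    show ?thesis
      unfolding hessian_eq[OF g W2(1,2) Ei Ei f' W2(3)] gradient_derivative_eq[OF G z F]
          vector_field_cd[OF Ei W2(3) pU]
      using pU by (simp add: local_metric_def)
  qed
  then show ?thesis
    unfolding laplacian_def E_def[symmetric] Let_def tr[symmetric] by (intro sum.cong) auto
qed

lemma gradient_eq:
  assumes g: "pseudo_riemannian A g" and W: "open W" "W \<subseteq> U" and f: "smooth_fun A W f" and p: "p \<in> W"
  shows "gradient A g f p = cd p (coordinate_gradient (local_metric g) (f \<circ> param) (\<phi> p))"
proof -
  have pU: "p \<in> U" using p W by auto
  have z: "\<phi> p \<in> \<phi> ` W" using p by auto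
  have n: "smooth_near A p f" by (rule smooth_nearI[OF W p f])
  have G: "smooth_metric_on (\<phi> ` W) (local_metric g)"
    by (rule smooth_metric_on_subset[OF smooth_local_metric[OF g] open_chart_image_subset[OF W]])
        (use W in auto)
  then have nd: "nondegenerate_form (local_metric g (\<phi> p))" using z unfolding smooth_metric_on_def
      by blast
  note eq = coordinate_gradient_eq[OF G z smooth_funD[OF f W(2)]]
  have cdf: "cd p v f = fderiv (f \<circ> param) (\<phi> p) v" for v
    using n by (simp add: chart_derivative_def)
  show ?thesis
    unfolding gradient_def
  proof (rule the_equality)
    show "cd p (coordinate_gradient (local_metric g) (f \<circ> param) (\<phi> p)) \<in> tangent_space A p \<and>
      (\<forall>y\<in>tangent_space A p. g p (cd p (coordinate_gradient (local_metric g) (f \<circ> param) (\<phi> p))) y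
          = y f)"
      using pU by (auto simp: tangent_space_eq metric_eq eq cdf)
  next
    fix x assume x: "x \<in> tangent_space A p \<and> (\<forall>y\<in>tangent_space A p. g p x y = y f)"
    have "coord_vector x = coordinate_gradient (local_metric g) (f \<circ> param) (\<phi> p)"
    proof (rule nondegenerate_form_eqI[OF nd])
      fix v
      have "local_metric g (\<phi> p) (coord_vector x) v = cd p v f"
        using x metric_eq[OF pU, of x "cd p v" g] pU by simp
      then show "local_metric g (\<phi> p) (coord_vector x) v
          = local_metric g (\<phi> p) (coordinate_gradient (local_metric g) (f \<circ> param) (\<phi> p)) v"
        by (simp add: eq cdf)
    qed
    then show "x = cd p (coordinate_gradient (local_metric g) (f \<circ> param) (\<phi> p))"
      using cd_coord_vector[OF pU] x by metis
  qed
qed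

end

section \<open>Curvature of a base conformal warped product in coordinates\<close>

lemma has_derivative_fst_compose:
  "(f has_derivative f') (at (fst \<zeta>)) \<Longrightarrow> ((\<lambda>\<zeta>. f (fst \<zeta>)) has_derivative (\<lambda>h. f' (fst h))) (at \<zeta>)"
  by (rule has_derivative_compose[OF has_derivative_fst[OF has_derivative_ident]])

lemma has_derivative_snd_compose:
  "(f has_derivative f') (at (snd \<zeta>)) \<Longrightarrow> ((\<lambda>\<zeta>. f (snd \<zeta>)) has_derivative (\<lambda>h. f' (snd h))) (at \<zeta>)"
  by (rule has_derivative_compose[OF has_derivative_snd[OF has_derivative_ident]])

text \<open>The formula for \<open>G\<close> is required on \<open>S \<times> T\<close> only: the
  coefficients of a metric in a chart involve \<open>inv_into\<close>, whose values outside the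
  image of the chart are arbitrary.\<close>

locale warped_coordinates =
  fixes S :: "'a::euclidean_space set" and T :: "'b::euclidean_space set"
    and GB :: "'a \<Rightarrow> 'a \<Rightarrow> 'a \<Rightarrow> real" and GF :: "'b \<Rightarrow> 'b \<Rightarrow> 'b \<Rightarrow> real"
    and C W :: "'a \<Rightarrow> real" and G :: "'a \<times> 'b \<Rightarrow> 'a \<times> 'b \<Rightarrow> 'a \<times> 'b \<Rightarrow> real"
  assumes GB: "smooth_metric_on S GB" and GF: "smooth_metric_on T GF"
    and C: "smooth_on S C" "\<And>z. z \<in> S \<Longrightarrow> C z > 0"
    and W: "smooth_on S W" "\<And>z. z \<in> S \<Longrightarrow> W z > 0"
    and G: "smooth_metric_on (S \<times> T) G"
    and G_eq: "\<And>z s x y. z \<in> S \<Longrightarrow> s \<in> T \<Longrightarrow>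
      G (z, s) x y = (C z)\<^sup>2 * GB z (fst x) (fst y) + (W z)\<^sup>2 * GF s (snd x) (snd y)"
begin

abbreviation "dC z \<equiv> fderiv C z"
abbreviation "dW z \<equiv> fderiv W z"
abbreviation "ddC z h x \<equiv> fderiv (\<lambda>z. dC z x) z h"
abbreviation "ddW z h x \<equiv> fderiv (\<lambda>z. dW z x) z h"
abbreviation "\<Gamma>B \<equiv> christoffel GB"
abbreviation "\<Gamma>F \<equiv> christoffel GF"
abbreviation "P \<equiv> coordinate_gradient GB C"
abbreviation "N \<equiv> coordinate_gradient GB W"

text \<open>The first component is the connection of the conformal metric \<open>c^2 gB\<close>
  together with the second fundamental form of the fibers, the term along \<open>N\<close>; the
  second is the connection of the fiber with mixed terms \<open>dw / w\<close>. Gradients are taken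
  with respect to \<open>GB\<close>, not to the warped metric, which accounts for the factor
  \<open>1 / c^2\<close> in front of \<open>N\<close>.\<close>

definition \<Gamma> :: "'a \<times> 'b \<Rightarrow> 'a \<times> 'b \<Rightarrow> 'a \<times> 'b \<Rightarrow> 'a \<times> 'b" where
  "\<Gamma> \<zeta> \<eta> \<kappa> =
    (\<Gamma>B (fst \<zeta>) (fst \<eta>) (fst \<kappa>)
       + (inverse (C (fst \<zeta>)) * dC (fst \<zeta>) (fst \<eta>)) *\<^sub>R fst \<kappa>
       + (inverse (C (fst \<zeta>)) * dC (fst \<zeta>) (fst \<kappa>)) *\<^sub>R fst \<eta>
       - (inverse (C (fst \<zeta>)) * GB (fst \<zeta>) (fst \<eta>) (fst \<kappa>)) *\<^sub>R P (fst \<zeta>)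
       - (W (fst \<zeta>) * inverse (C (fst \<zeta>)) * inverse (C (fst \<zeta>)) * GF (snd \<zeta>) (snd \<eta>) (snd \<kappa>)) *\<^sub>R N
           (fst \<zeta>),
     \<Gamma>F (snd \<zeta>) (snd \<eta>) (snd \<kappa>)
       + (inverse (W (fst \<zeta>)) * dW (fst \<zeta>) (fst \<eta>)) *\<^sub>R snd \<kappa>
       + (inverse (W (fst \<zeta>)) * dW (fst \<zeta>) (fst \<kappa>)) *\<^sub>R snd \<eta>)"

end

locale warped_point = warped_coordinates +
  fixes z :: 'a and s :: 'b
  assumes z: "z \<in> S" and s: "s \<in> T"
begin

lemma nonzero: "C z \<noteq> 0" "W z \<noteq> 0" using C(2) W(2) z by fastforce+

lemma bilinear_forms: "bilinear (GB z)" "bilinear (GF s)" "bilinear (\<Gamma>B z)" "bilinear (\<Gamma>F s)"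
  by (rule smooth_bilinear_onD[OF smooth_metric_on_imp_bilinear[OF GB] z]
      smooth_bilinear_onD[OF smooth_metric_on_imp_bilinear[OF GF] s]
      smooth_bilinear_onD[OF smooth_bilinear_christoffel[OF GB] z]
      smooth_bilinear_onD[OF smooth_bilinear_christoffel[OF GF] s])+

lemma GB_sym: "GB z x y = GB z y x" and GF_sym: "GF s v u = GF s u v"
  using GB GF z s by (auto simp: smooth_metric_on_def nondegenerate_form_def)

lemma linear_differentials: "linear (dC z)" "linear (dW z)"
  by (rule has_derivative_linear[OF smooth_on_has_derivative[OF C(1) z]]
      has_derivative_linear[OF smooth_on_has_derivative[OF W(1) z]])+

lemma gradient_pairing: "GB z (P z) x = dC z x" "GB z (N z) x = dW z x" "GB z x (P z)
    = dC z x" "GB z x (N z) = dW z x"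
proof -
  show 1: "GB z (P z) x = dC z x" "GB z (N z) x = dW z x"
    by (rule coordinate_gradient_eq[OF GB z C(1)] coordinate_gradient_eq[OF GB z W(1)])+
  show "GB z x (P z) = dC z x" "GB z x (N z) = dW z x"
    using 1 GB_sym by simp_all
qed

lemmas bil_simps =
  bilinear_forms[THEN bilinear_ladd] bilinear_forms[THEN bilinear_radd]
      bilinear_forms[THEN bilinear_lsub] bilinear_forms[THEN bilinear_rsub]
  bilinear_forms[THEN bilinear_lmul] bilinear_forms[THEN bilinear_rmul]
      bilinear_forms[THEN bilinear_lzero] bilinear_forms[THEN bilinear_rzero]
  bilinear_forms[THEN bilinear_lneg] bilinear_forms[THEN bilinear_rneg]
  linear_differentials[THEN linear_add] linear_differentials[THEN linear_diff]
      linear_differentials[THEN linear_scale] linear_differentials[THEN linear_0]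
      linear_differentials[THEN linear_neg]

text \<open>Derivatives of the building blocks of \<open>G\<close> and \<Gamma>, viewed as functions
  on the product, in a form to which the sum and product rules apply mechanically.\<close>

lemma coefficient_derivatives:
  "((\<lambda>\<zeta>. C (fst \<zeta>)) has_derivative (\<lambda>h. dC z (fst h))) (at (z, s))"
  "((\<lambda>\<zeta>. W (fst \<zeta>)) has_derivative (\<lambda>h. dW z (fst h))) (at (z, s))"
  "((\<lambda>\<zeta>. inverse (C (fst \<zeta>))) has_derivative (\<lambda>h. - (inverse (C z) * dC z (fst h) * inverse (C z))))
      (at (z, s))"
  "((\<lambda>\<zeta>. inverse (W (fst \<zeta>))) has_derivative (\<lambda>h. - (inverse (W z) * dW z (fst h) * inverse (W z))))
      (at (z, s))"
  "((\<lambda>\<zeta>. dC (fst \<zeta>) x) has_derivative (\<lambda>h. ddC z (fst h) x)) (at (z, s))"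
  "((\<lambda>\<zeta>. dW (fst \<zeta>) x) has_derivative (\<lambda>h. ddW z (fst h) x)) (at (z, s))"
  "((\<lambda>\<zeta>. GB (fst \<zeta>) x y) has_derivative (\<lambda>h. bilinear_derivative GB z (fst h) x y)) (at (z, s))"
  "((\<lambda>\<zeta>. \<Gamma>B (fst \<zeta>) x y) has_derivative (\<lambda>h. bilinear_derivative \<Gamma>B z (fst h) x y)) (at (z, s))"
  "((\<lambda>\<zeta>. GF (snd \<zeta>) v u) has_derivative (\<lambda>h. bilinear_derivative GF s (snd h) v u)) (at (z, s))"
  "((\<lambda>\<zeta>. \<Gamma>F (snd \<zeta>) v u) has_derivative (\<lambda>h. bilinear_derivative \<Gamma>F s (snd h) v u)) (at (z, s))"
  "((\<lambda>\<zeta>. P (fst \<zeta>)) has_derivative (\<lambda>h. fderiv P z (fst h))) (at (z, s))"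
  "((\<lambda>\<zeta>. N (fst \<zeta>)) has_derivative (\<lambda>h. fderiv N z (fst h))) (at (z, s))"
  by (intro has_derivative_fst_compose has_derivative_snd_compose;
     simp only: fst_conv snd_conv;
     intro has_derivative_bilinear_derivative[OF smooth_metric_on_imp_bilinear[OF GB] z]
       has_derivative_bilinear_derivative[OF smooth_metric_on_imp_bilinear[OF GF] s]
       has_derivative_bilinear_derivative[OF smooth_bilinear_christoffel[OF GB] z]
       has_derivative_bilinear_derivative[OF smooth_bilinear_christoffel[OF GF] s]
       Deriv.has_derivative_inverse nonzero smooth_on_has_derivative[OF _ z]
           smooth_on_frechet_derivative C W smooth_coordinate_gradient[OF GB])+

lemma bilinear_derivative_G:
  "bilinear_derivative G (z, s) h x y =
     2 * C z * dC z (fst h) * GB z (fst x) (fst y) + (C z)\<^sup>2 * bilinear_derivative GB z (fst h)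
         (fst x) (fst y)
   + 2 * W z * dW z (fst h) * GF s (snd x) (snd y) + (W z)\<^sup>2 * bilinear_derivative GF s (snd h)
       (snd x) (snd y)"
proof -
  have o: "open (S \<times> T)" and zs: "(z, s) \<in> S \<times> T" using G z s by (auto simp: smooth_metric_on_def)
  let ?f = "\<lambda>\<zeta>. C (fst \<zeta>) * C (fst \<zeta>) * GB (fst \<zeta>) (fst x) (fst y) + W (fst \<zeta>) * W (fst \<zeta>) * GF
      (snd \<zeta>) (snd x) (snd y)"
  have "(?f has_derivative (\<lambda>h. 
     2 * C z * dC z (fst h) * GB z (fst x) (fst y) + (C z)\<^sup>2 * bilinear_derivative GB z (fst h)
         (fst x) (fst y)
   + 2 * W z * dW z (fst h) * GF s (snd x) (snd y) + (W z)\<^sup>2 * bilinear_derivative GF s (snd h)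
       (snd x) (snd y))) (at (z, s))"
    by (rule has_derivative_eq_rhs, (rule has_derivative_add has_derivative_mult
        coefficient_derivatives)+)
       (auto simp: fun_eq_iff power2_eq_square algebra_simps)
  then have "((\<lambda>\<zeta>. G \<zeta> x y) has_derivative (\<lambda>h. 
     2 * C z * dC z (fst h) * GB z (fst x) (fst y) + (C z)\<^sup>2 * bilinear_derivative GB z (fst h)
         (fst x) (fst y)
   + 2 * W z * dW z (fst h) * GF s (snd x) (snd y) + (W z)\<^sup>2 * bilinear_derivative GF s (snd h)
       (snd x) (snd y))) (at (z, s))"
    by (rule has_derivative_transform_within_open[OF _ o zs]) (auto simp: G_eq power2_eq_square)
  from frechet_derivative_at[OF this, THEN fun_cong, of h] show ?thesis
    by (simp add: bilinear_derivative_def)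
qed

lemma christoffel_warped: "christoffel G (z, s) x y = \<Gamma> (z, s) x y"
proof (rule christoffel_unique[OF G])
  show "(z, s) \<in> S \<times> T" using z s by simp
  show "\<Gamma> (z, s) x y = \<Gamma> (z, s) y x" for x y
    using christoffel_symmetric[OF GB z, of "fst x"] christoffel_symmetric[OF GF s, of "snd x"]
      GB_sym[of "fst x"] GF_sym[of "snd x"] by (simp add: \<Gamma>_def)
  show "bilinear_derivative G (z, s) h x y = G (z, s) (\<Gamma> (z, s) h x) y + G (z, s) x (\<Gamma> (z, s) h y)"
      for h x y
    unfolding bilinear_derivative_G G_eq[OF z s] christoffel_compatible[OF GB z]
        christoffel_compatible[OF GF s] \<Gamma>_def
    by (simp add: bil_simps gradient_pairing GB_sym[of "fst x" "fst h"] GF_sym[of "snd x" "snd h"]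
        power2_eq_square inverse_eq_divide nonzero field_simps)
qed

end

text \<open>Holds at all points of an open set and not just at one, as the curvature differentiates
  the symbols.\<close>

lemma (in warped_coordinates) christoffel_eq_\<Gamma>:
  assumes "\<zeta> \<in> S \<times> T"
  shows "christoffel G \<zeta> x y = \<Gamma> \<zeta> x y"
proof -
  interpret warped_point S T GB GF C W G "fst \<zeta>" "snd \<zeta>"
    by unfold_locales (use assms in auto)
  show ?thesis using christoffel_warped[of x y] by simp
qed

context warped_point
begin

abbreviation "\<iota> \<equiv> inverse (C z)"
abbreviation "P' \<equiv> fderiv P z"
abbreviation "N' \<equiv> fderiv N z"

lemma bilinear_derivative_\<Gamma>:
  "bilinear_derivative (christoffel G) (z, s) h x y =
   (bilinear_derivative \<Gamma>B z (fst h) (fst x) (fst y)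
     + (\<iota> * ddC z (fst h) (fst x) - \<iota> * \<iota> * dC z (fst h) * dC z (fst x)) *\<^sub>R fst y
     + (\<iota> * ddC z (fst h) (fst y) - \<iota> * \<iota> * dC z (fst h) * dC z (fst y)) *\<^sub>R fst x
     - (\<iota> * bilinear_derivative GB z (fst h) (fst x) (fst y) - \<iota> * \<iota> * dC z (fst h) * GB z (fst x)
         (fst y)) *\<^sub>R P z
     - (\<iota> * GB z (fst x) (fst y)) *\<^sub>R P' (fst h)
     - (dW z (fst h) * \<iota> * \<iota> * GF s (snd x) (snd y)
        - 2 * W z * \<iota> * \<iota> * \<iota> * dC z (fst h) * GF s (snd x) (snd y)
        + W z * \<iota> * \<iota> * bilinear_derivative GF s (snd h) (snd x) (snd y)) *\<^sub>R N z
     - (W z * \<iota> * \<iota> * GF s (snd x) (snd y)) *\<^sub>R N' (fst h),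
    bilinear_derivative \<Gamma>F s (snd h) (snd x) (snd y)
     + (inverse (W z) * ddW z (fst h) (fst x) - inverse (W z) * inverse (W z) * dW z (fst h) * dW z
         (fst x)) *\<^sub>R snd y
     + (inverse (W z) * ddW z (fst h) (fst y) - inverse (W z) * inverse (W z) * dW z (fst h) * dW z
         (fst y)) *\<^sub>R snd x)"
  (is "_ = ?D h")
proof -
  have o: "open (S \<times> T)" and zs: "(z, s) \<in> S \<times> T" using G z s by (auto simp: smooth_metric_on_def)
  have "((\<lambda>\<zeta>. \<Gamma> \<zeta> x y) has_derivative ?D) (at (z, s))"
    unfolding \<Gamma>_def
    by (rule has_derivative_eq_rhs,
        (rule has_derivative_Pair has_derivative_add has_derivative_diff has_derivative_scaleR
          has_derivative_mult has_derivative_const coefficient_derivatives)+)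
       (auto simp: fun_eq_iff algebra_simps)
  then have "((\<lambda>\<zeta>. christoffel G \<zeta> x y) has_derivative ?D) (at (z, s))"
    by (rule has_derivative_transform_within_open[OF _ o zs]) (rule christoffel_eq_\<Gamma>[symmetric])
  from frechet_derivative_at[OF this, THEN fun_cong, of h] show ?thesis
    by (simp add: bilinear_derivative_def)
qed

abbreviation "HC \<equiv> coordinate_hessian GB C z"
abbreviation "HW \<equiv> coordinate_hessian GB W z"
abbreviation "DP \<equiv> gradient_derivative GB C z"
abbreviation "DN \<equiv> gradient_derivative GB W z"

lemma christoffel_at: "christoffel G (z, s) x y = \<Gamma> (z, s) x y"
  by (rule christoffel_eq_\<Gamma>) (use z s in simp)

lemma ddC_sym: "ddC z x y = ddC z y x" and ddW_sym: "ddW z x y = ddW z y x"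
  using second_derivative_symmetric[OF _ z C(1)] second_derivative_symmetric[OF _ z W(1)] GB
  by (auto simp: smooth_metric_on_def)

lemma second_derivatives_zero: "ddC z 0 x = 0" "ddC z x 0 = 0" "ddW z 0 x = 0" "ddW z x 0 = 0"
proof -
  have "ddC z 0 y = 0" "ddW z 0 y = 0" for y
    by (rule linear_0 has_derivative_linear smooth_on_has_derivative[OF _ z]
        smooth_on_frechet_derivative C(1) W(1))+
  then show "ddC z 0 x = 0" "ddC z x 0 = 0" "ddW z 0 x = 0" "ddW z x 0 = 0"
    using ddC_sym[of x 0] ddW_sym[of x 0] by simp_all
qed

lemma gradient_derivatives_zero: "P' 0 = 0" "N' 0 = 0"
  by (rule linear_0 has_derivative_linear smooth_on_has_derivative[OF _ z]
      smooth_coordinate_gradient[OF GB] C(1) W(1))+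

text \<open>The curvature is evaluated on vectors with one zero component; these rules remove the
  terms that vanish for this reason.\<close>

lemmas zero_simps = second_derivatives_zero gradient_derivatives_zero
  linear_bilinear_derivative[OF smooth_bilinear_christoffel[OF GB] z, THEN linear_0]
  linear_bilinear_derivative[OF smooth_bilinear_christoffel[OF GF] s, THEN linear_0]
  linear_bilinear_derivative[OF smooth_metric_on_imp_bilinear[OF GB] z, THEN linear_0]
  linear_bilinear_derivative[OF smooth_metric_on_imp_bilinear[OF GF] s, THEN linear_0]

lemma hessian_sym: "HC x y = HC y x" "HW x y = HW y x"
  using ddC_sym ddW_sym christoffel_symmetric[OF GB z, of x y] by (simp_all add: coordinate_hessian_def)

text \<open>The base leaves are totally geodesic, so this is the curvature of the conformal metric
  \<open>c^2 gB\<close>, and \<open>w\<close> does not appear.\<close>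

lemma riemann_base_base:
  "fst (riemann (christoffel G) (z, s) (e, 0) (y, 0) (x, 0)) =
     riemann \<Gamma>B z e y x
     + (\<iota> * HC e x - 2 * \<iota> * \<iota> * dC z e * dC z x) *\<^sub>R y
     - (\<iota> * HC y x - 2 * \<iota> * \<iota> * dC z x * dC z y) *\<^sub>R e
     - (\<iota> * GB z y x) *\<^sub>R DP e + (2 * \<iota> * \<iota> * GB z y x * dC z e) *\<^sub>R P z
     + (\<iota> * GB z e x) *\<^sub>R DP y - (2 * \<iota> * \<iota> * GB z e x * dC z y) *\<^sub>R P z
     - (\<iota> * \<iota> * dC z (P z) * GB z y x) *\<^sub>R e + (\<iota> * \<iota> * dC z (P z) * GB z e x) *\<^sub>R y"
  unfolding riemann_def christoffel_at bilinear_derivative_\<Gamma> \<Gamma>_def christoffel_compatible[OF GB z]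
    gradient_derivative_def coordinate_hessian_def
  \<comment> \<open>Inner products with basis vectors turn the vector identity into one between real
    expressions, whose terms can be sorted and matched.\<close>
  by (rule euclidean_eqI)
     (simp add: bil_simps zero_simps gradient_pairing christoffel_symmetric[OF GB z, of y e]
         ddC_sym[of y e]
      GB_sym[of x y] GB_sym[of x e] GB_sym[of y e] GB_sym[of "\<Gamma>B z _ _"] inner_simps algebra_simps)

text \<open>The factor of \<open>f\<close> is \<open>-1 / w\<close> times the Hessian of
  \<open>w\<close> for \<open>c^2 gB\<close>, written in terms of \<open>gB\<close>.\<close>

lemma riemann_fiber_base:
  "snd (riemann (christoffel G) (z, s) (0, f) (y, 0) (x, 0)) =
     (- inverse (W z) * HW y x + \<iota> * inverse (W z) * (dC z y * dW z x + dC z x * dW z y)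
      - \<iota> * inverse (W z) * GB z y x * dW z (P z)) *\<^sub>R f"
  unfolding riemann_def christoffel_at bilinear_derivative_\<Gamma> \<Gamma>_def coordinate_hessian_def
  by (simp add: bil_simps zero_simps gradient_pairing algebra_simps)

text \<open>A trace uses the two diagonal blocks only, base to base and fiber to fiber; this
  identity and the next one cover both for the mixed Ricci component.\<close>

lemma riemann_base_mixed:
  "fst (riemann (christoffel G) (z, s) (e, 0) (0, v) (x, 0)) = 0"
  unfolding riemann_def christoffel_at bilinear_derivative_\<Gamma> \<Gamma>_def
  by (simp add: bil_simps zero_simps)

text \<open>Only \<open>christoffel GF s f v\<close> times \<open>dW z x / W z\<close> survives in
  the iterated symbols, and it cancels in the antisymmetrization over \<open>f\<close> and
  \<open>v\<close>.\<close>

lemma riemann_fiber_mixed: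
  "snd (riemann (christoffel G) (z, s) (0, f) (0, v) (x, 0)) = 0"
  unfolding riemann_def christoffel_at bilinear_derivative_\<Gamma> \<Gamma>_def
  by (simp add: bil_simps zero_simps christoffel_symmetric[OF GF s, of v f])

text \<open>The bracket is \<open>w\<close> times the covariant derivative along \<open>e\<close> of
  the gradient of \<open>w\<close>, both for \<open>c^2 gB\<close>. That gradient is
  \<open>N / c^2\<close>; the terms beyond \<open>DN\<close> come from differentiating
  \<open>1 / c^2\<close> and from the change of connection.\<close>

lemma riemann_base_fiber:
  "fst (riemann (christoffel G) (z, s) (e, 0) (0, u) (0, v)) =
     - GF s u v *\<^sub>R ((W z * \<iota> * \<iota>) *\<^sub>R DN e - (W z * \<iota> * \<iota> * \<iota> * dC z e) *\<^sub>R N z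
        + (W z * \<iota> * \<iota> * \<iota> * dC z (N z)) *\<^sub>R e - (W z * \<iota> * \<iota> * \<iota> * dW z e) *\<^sub>R P z)"
proof -
  \<comment> \<open>The sorted products keep \<open>w\<close> and \<open>1 / w\<close> apart; the
    rules derived from this cancel them in the arrangements that occur.\<close>
  have w: "W z * inverse (W z) = 1" "inverse (W z) * W z = 1" using nonzero by auto
  then have w': "inverse (W z) * (W z * r) = r" "W z * (inverse (W z) * r) = r" for r
    by (simp_all only: mult.assoc[symmetric] mult_1)
  then have w'': "W z * (\<iota> * (\<iota> * (inverse (W z) * r))) = \<iota> * (\<iota> * r)"
      "inverse (W z) * (p * (W z * r)) = p * r" "inverse (W z) * (W z * r) = r"
      "W z * (\<iota> * (inverse (W z) * r)) = \<iota> * r" for p r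
    by (metis mult.left_commute)+
  show ?thesis
    unfolding riemann_def christoffel_at bilinear_derivative_\<Gamma> \<Gamma>_def gradient_derivative_def
    by (rule euclidean_eqI)
       (simp add: bil_simps zero_simps gradient_pairing inner_simps algebra_simps w'')
qed

text \<open>The Gauss equation for the fibers, which are umbilic:
  \<open>\<iota> * \<iota> * dW z (N z)\<close> is the squared length of the gradient of
  \<open>w\<close> for \<open>c^2 gB\<close>.\<close>

lemma riemann_fiber_fiber:
  "snd (riemann (christoffel G) (z, s) (0, f) (0, u) (0, v)) =
     riemann \<Gamma>F s f u v
     - (\<iota> * \<iota> * dW z (N z)) *\<^sub>R (GF s u v *\<^sub>R f - GF s f v *\<^sub>R u)"
proof -
  have w: "W z * inverse (W z) = 1" "inverse (W z) * W z = 1" using nonzero by auto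
  then have w': "inverse (W z) * (W z * r) = r" "W z * (inverse (W z) * r) = r" for r
    by (simp_all only: mult.assoc[symmetric] mult_1)
  then have w'': "W z * (\<iota> * (\<iota> * (inverse (W z) * r))) = \<iota> * (\<iota> * r)"
      "inverse (W z) * (p * (W z * r)) = p * r" "inverse (W z) * (W z * r) = r"
      "W z * (\<iota> * (inverse (W z) * r)) = \<iota> * r" for p r
    by (metis mult.left_commute)+
  show ?thesis
    unfolding riemann_def christoffel_at bilinear_derivative_\<Gamma> \<Gamma>_def
    by (rule euclidean_eqI)
       (simp add: bil_simps zero_simps gradient_pairing inner_simps algebra_simps w'')
qed

end

text \<open>The curvature formulas above are sums of rank-one terms, multiples of the identity,
  Hessian operators and curvatures of a factor. Their traces supply the scalar terms, the
  dimensions, the Laplacians and the Ricci tensors of the factors.\<close>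

lemma trace_rank_one:
  fixes f :: "'a::euclidean_space \<Rightarrow> real"
  assumes "linear f"
  shows "(\<Sum>b\<in>Basis. (f b *\<^sub>R u) \<bullet> b) = f u"
  using linear_eq_sum_Basis[OF assms, of u] by (simp add: mult.commute)

lemma trace_scalar:
  "(\<Sum>b\<in>(Basis :: 'a::euclidean_space set). (r *\<^sub>R b) \<bullet> b) = r * real DIM('a)"
  by (simp add: inner_Basis)

lemma trace_scaleR: "(\<Sum>b\<in>B. (r *\<^sub>R f b) \<bullet> b) = r * (\<Sum>b\<in>B. f b \<bullet> b)"
  by (simp add: sum_distrib_left)

lemma trace_prod:
  fixes L :: "'a::euclidean_space \<times> 'b::euclidean_space \<Rightarrow> 'a \<times> 'b"
  shows "(\<Sum>b\<in>Basis. L b \<bullet> b) = (\<Sum>b\<in>Basis. fst (L (b, 0)) \<bullet> b) + (\<Sum>b\<in>Basis. snd (L (0, b)) \<bullet> b)"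
  unfolding Basis_prod_def
  by (subst sum.union_disjoint) (auto simp: sum.reindex inj_on_def inner_prod_def[of "L _"]
      nonzero_Basis)

section \<open>Ricci traces of the warped metric\<close>

context warped_point
begin

lemma linear_hessian: "linear (\<lambda>e. HC e x)" "linear (\<lambda>e. HW e x)"
proof -
  have "linear (\<lambda>e. GB z (DP e) x)" "linear (\<lambda>e. GB z (DN e) x)"
    using linear_gradient_derivative[OF GB z C(1)] linear_gradient_derivative[OF GB z W(1)]
    by (auto simp: linear_iff bil_simps)
  then show "linear (\<lambda>e. HC e x)" "linear (\<lambda>e. HW e x)"
    using gradient_derivative_eq[OF GB z C(1)] gradient_derivative_eq[OF GB z W(1)] by simp_all
qed

lemma linear_GB: "linear (\<lambda>e. GB z e x)" and linear_GF: "linear (\<lambda>e. GF s e v)"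
  using bilinear_forms by (auto simp: bilinear_def)

text \<open>Multiples of the identity contribute the dimension \<open>m\<close> and rank-one terms
  the shifts: the Hessian of \<open>c\<close> gets \<open>1 - m + 1\<close>, the product of the
  differentials of \<open>c\<close> gets \<open>2 * m - 2 - 2\<close>, and the squared gradient of
  \<open>c\<close> gets \<open>2 + 1 - m\<close>. The fiber block is a scalar, counted
  \<open>k\<close> times.\<close>

lemma ricci_base:
  "(\<Sum>b\<in>Basis. riemann (christoffel G) (z, s) b (y, 0) (x, 0) \<bullet> b) =
     (\<Sum>b\<in>Basis. riemann \<Gamma>B z b y x \<bullet> b)
     - (real DIM('a) - 2) * \<iota> * HC x y + 2 * (real DIM('a) - 2) * \<iota> * \<iota> * (dC z x * dC z y)
     - ((real DIM('a) - 3) * \<iota> * \<iota> * dC z (P z) + \<iota> * (\<Sum>b\<in>Basis. DP b \<bullet> b)) * GB z x y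
     - real DIM('b) * inverse (W z) * HW x y
     - real DIM('b) * \<iota> * inverse (W z) * dW z (P z) * GB z x y
     + real DIM('b) * \<iota> * inverse (W z) * (dC z x * dW z y + dC z y * dW z x)"
proof -
  have "(\<Sum>b\<in>Basis. fst (riemann (christoffel G) (z, s) (b, 0) (y, 0) (x, 0)) \<bullet> b) =
      (\<Sum>b\<in>Basis. riemann \<Gamma>B z b y x \<bullet> b)
     + (\<Sum>b\<in>Basis. ((\<iota> * HC b x - 2 * \<iota> * \<iota> * dC z b * dC z x) *\<^sub>R y) \<bullet> b)
     - (\<Sum>b\<in>(Basis :: 'a set). ((\<iota> * HC y x - 2 * \<iota> * \<iota> * dC z x * dC z y) *\<^sub>R b) \<bullet> b)
     - (\<Sum>b\<in>Basis. ((\<iota> * GB z y x) *\<^sub>R DP b) \<bullet> b)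
         + (\<Sum>b\<in>Basis. ((2 * \<iota> * \<iota> * GB z y x * dC z b) *\<^sub>R P z) \<bullet> b)
     + (\<Sum>b\<in>Basis. ((\<iota> * GB z b x) *\<^sub>R DP y) \<bullet> b)
         - (\<Sum>b\<in>Basis. ((2 * \<iota> * \<iota> * GB z b x * dC z y) *\<^sub>R P z) \<bullet> b)
     - (\<Sum>b\<in>(Basis :: 'a set). ((\<iota> * \<iota> * dC z (P z) * GB z y x) *\<^sub>R b) \<bullet> b)
     + (\<Sum>b\<in>Basis. ((\<iota> * \<iota> * dC z (P z) * GB z b x) *\<^sub>R y) \<bullet> b)"
    unfolding riemann_base_base by (simp add: inner_add_left inner_diff_left sum.distrib sum_subtractf)
  also have "(\<Sum>b\<in>Basis. ((\<iota> * HC b x - 2 * \<iota> * \<iota> * dC z b * dC z x) *\<^sub>R y) \<bullet> b) = \<iota> * HC y x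
      - 2 * \<iota> * \<iota> * dC z y * dC z x"
    using linear_hessian(1)[of x] linear_differentials by (intro trace_rank_one)
        (auto simp: linear_iff algebra_simps)
  also have "(\<Sum>b\<in>Basis. ((2 * \<iota> * \<iota> * GB z y x * dC z b) *\<^sub>R P z) \<bullet> b) = 2 * \<iota> * \<iota> * GB z y x * dC z
      (P z)"
    using linear_differentials by (intro trace_rank_one) (auto simp: linear_iff algebra_simps)
  also have "(\<Sum>b\<in>Basis. ((\<iota> * GB z b x) *\<^sub>R DP y) \<bullet> b) = \<iota> * GB z (DP y) x"
    using linear_GB by (intro trace_rank_one) (auto simp: linear_iff algebra_simps)
  also have "(\<Sum>b\<in>Basis. ((2 * \<iota> * \<iota> * GB z b x * dC z y) *\<^sub>R P z) \<bullet> b) = 2 * \<iota> * \<iota> * GB z (P z) x *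
      dC z y"
    using linear_GB by (intro trace_rank_one) (auto simp: linear_iff algebra_simps)
  also have "(\<Sum>b\<in>Basis. ((\<iota> * \<iota> * dC z (P z) * GB z b x) *\<^sub>R y) \<bullet> b) = \<iota> * \<iota> * dC z (P z) * GB z y x"
    using linear_GB by (intro trace_rank_one) (auto simp: linear_iff algebra_simps)
  finally have base: "(\<Sum>b\<in>Basis. fst (riemann (christoffel G) (z, s) (b, 0) (y, 0) (x, 0)) \<bullet> b) =
      (\<Sum>b\<in>Basis. riemann \<Gamma>B z b y x \<bullet> b)
     - (real DIM('a) - 2) * \<iota> * HC x y + 2 * (real DIM('a) - 2) * \<iota> * \<iota> * (dC z x * dC z y)
     - ((real DIM('a) - 3) * \<iota> * \<iota> * dC z (P z) + \<iota> * (\<Sum>b\<in>Basis. DP b \<bullet> b)) * GB z x y"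
    unfolding trace_scalar trace_scaleR gradient_derivative_eq[OF GB z C(1)]
    by (simp add: gradient_pairing GB_sym[of y x] hessian_sym[of y x] algebra_simps)
  have fiber: "(\<Sum>b\<in>Basis. snd (riemann (christoffel G) (z, s) (0, b) (y, 0) (x, 0)) \<bullet> b) =
     - real DIM('b) * inverse (W z) * HW x y
     - real DIM('b) * \<iota> * inverse (W z) * dW z (P z) * GB z x y
     + real DIM('b) * \<iota> * inverse (W z) * (dC z x * dW z y + dC z y * dW z x)"
    unfolding riemann_fiber_base trace_scalar
    by (simp add: GB_sym[of y x] hessian_sym[of y x] algebra_simps)
  show ?thesis unfolding trace_prod base fiber by simp
qed

lemma ricci_mixed: "(\<Sum>b\<in>Basis. riemann (christoffel G) (z, s) b (0, v) (x, 0) \<bullet> b) = 0"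
  unfolding trace_prod riemann_base_mixed riemann_fiber_mixed by simp

text \<open>In the base block the pairing of the two gradients arises with weight \<open>m\<close>
  from the identity and with weight -1 from each of two rank-one terms, as \<open>dC z (N z)\<close>
  and as \<open>dW z (P z)\<close>, which are equal. In the fiber block one rank-one term turns
  \<open>k\<close> into \<open>k - 1\<close>.\<close>

lemma ricci_fiber:
  "(\<Sum>b\<in>Basis. riemann (christoffel G) (z, s) b (0, u) (0, v) \<bullet> b) =
     (\<Sum>b\<in>Basis. riemann \<Gamma>F s b u v \<bullet> b)
     - GF s u v * (W z * \<iota> * \<iota> * (\<Sum>b\<in>Basis. DN b \<bullet> b)
        + (real DIM('a) - 2) * W z * \<iota> * \<iota> * \<iota> * dW z (P z)
        + (real DIM('b) - 1) * \<iota> * \<iota> * dW z (N z))"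
proof -
  have "(\<Sum>b\<in>Basis. fst (riemann (christoffel G) (z, s) (b, 0) (0, u) (0, v)) \<bullet> b) =
      - GF s u v * ((\<Sum>b\<in>Basis. ((W z * \<iota> * \<iota>) *\<^sub>R DN b) \<bullet> b)
        - (\<Sum>b\<in>Basis. ((W z * \<iota> * \<iota> * \<iota> * dC z b) *\<^sub>R N z) \<bullet> b)
        + (\<Sum>b\<in>(Basis :: 'a set). ((W z * \<iota> * \<iota> * \<iota> * dC z (N z)) *\<^sub>R b) \<bullet> b)
        - (\<Sum>b\<in>Basis. ((W z * \<iota> * \<iota> * \<iota> * dW z b) *\<^sub>R P z) \<bullet> b))"
    unfolding riemann_base_fiber
    by (simp only: inner_add_left inner_diff_left sum.distrib sum_subtractf trace_scaleR)
  also have "(\<Sum>b\<in>Basis. ((W z * \<iota> * \<iota> * \<iota> * dC z b) *\<^sub>R N z) \<bullet> b) = W z * \<iota> * \<iota> * \<iota> * dC z (N z)"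
    using linear_differentials by (intro trace_rank_one) (auto simp: linear_iff algebra_simps)
  also have "(\<Sum>b\<in>Basis. ((W z * \<iota> * \<iota> * \<iota> * dW z b) *\<^sub>R P z) \<bullet> b) = W z * \<iota> * \<iota> * \<iota> * dW z (P z)"
    using linear_differentials by (intro trace_rank_one) (auto simp: linear_iff algebra_simps)
  finally have base: "(\<Sum>b\<in>Basis. fst (riemann (christoffel G) (z, s) (b, 0) (0, u) (0, v)) \<bullet> b) =
      - GF s u v * (W z * \<iota> * \<iota> * (\<Sum>b\<in>Basis. DN b \<bullet> b) + (real DIM('a) - 2) * W z * \<iota> * \<iota> * \<iota> * dW z
          (P z))"
    unfolding trace_scalar trace_scaleR using gradient_pairing(1)[of "N z"] gradient_pairing(4)[of "P z"]
    by (simp add: algebra_simps)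
  have "(\<Sum>b\<in>Basis. snd (riemann (christoffel G) (z, s) (0, b) (0, u) (0, v)) \<bullet> b) =
      (\<Sum>b\<in>Basis. riemann \<Gamma>F s b u v \<bullet> b)
      - \<iota> * \<iota> * dW z (N z) * ((\<Sum>b\<in>(Basis :: 'b set). (GF s u v *\<^sub>R b) \<bullet> b)
          - (\<Sum>b\<in>Basis. (GF s b v *\<^sub>R u) \<bullet> b))"
    unfolding riemann_fiber_fiber
    by (simp only: inner_add_left inner_diff_left sum.distrib sum_subtractf trace_scaleR)
  also have "(\<Sum>b\<in>Basis. (GF s b v *\<^sub>R u) \<bullet> b) = GF s u v"
    using linear_GF by (intro trace_rank_one)
  finally have fiber: "(\<Sum>b\<in>Basis. snd (riemann (christoffel G) (z, s) (0, b) (0, u) (0, v)) \<bullet> b) =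
      (\<Sum>b\<in>Basis. riemann \<Gamma>F s b u v \<bullet> b) - (real DIM('b) - 1) * \<iota> * \<iota> * dW z (N z) * GF s u v"
    unfolding trace_scalar by (simp add: algebra_simps)
  show ?thesis unfolding trace_prod base fiber by (simp add: algebra_simps)
qed

end

section \<open>Product atlases and lifts\<close>

lemma smooth_on_fst:
  assumes S: "open S" and T: "open T" and f: "smooth_on S f"
  shows "smooth_on (S \<times> T) (\<lambda>z. f (fst z))"
  by (rule smooth_on_compose[OF open_Times[OF S T] S _ f smooth_on_bounded_linear[OF
      bounded_linear_fst]]) auto

lemma smooth_on_snd:
  assumes S: "open S" and T: "open T" and f: "smooth_on T f"
  shows "smooth_on (S \<times> T) (\<lambda>z. f (snd z))"
  by (rule smooth_on_compose[OF open_Times[OF S T] T _ f smooth_on_bounded_linear[OF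
      bounded_linear_snd]]) auto

lemma smooth_on_Pair:
  fixes f :: "'a::euclidean_space \<Rightarrow> 'b::euclidean_space" and g :: "'a \<Rightarrow> 'c::euclidean_space"
  assumes S: "open S" and f: "smooth_on S f" and g: "smooth_on S g"
  shows "smooth_on S (\<lambda>z. (f z, g z))"
proof -
  have l: "bounded_linear (\<lambda>x :: 'b. (x, 0 :: 'c))" "bounded_linear (\<lambda>x :: 'c. (0 :: 'b, x))"
    by (intro bounded_linear_Pair bounded_linear_ident bounded_linear_zero)+
  have "smooth_on S (\<lambda>z. (f z, 0 :: 'c) + (0 :: 'b, g z))"
    by (rule smooth_on_add[OF S smooth_on_bounded_linear_compose[OF l(1) S f]
          smooth_on_bounded_linear_compose[OF l(2) S g]])
  then show ?thesis by simp
qed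

lemma inj_on_map_prod: "inj_on f A \<Longrightarrow> inj_on g B \<Longrightarrow> inj_on (map_prod f g) (A \<times> B)"
  by (auto simp: inj_on_def)

lemma inv_into_map_prod:
  assumes "inj_on f A" "inj_on g B" "x \<in> f ` A" "y \<in> g ` B"
  shows "inv_into (A \<times> B) (map_prod f g) (x, y) = (inv_into A f x, inv_into B g y)"
  by (rule inv_into_f_eq) (use assms in \<open>auto simp: inj_on_map_prod inv_into_into f_inv_into_f\<close>)

lemma (in chart) inj: "inj_on \<phi> U"
  by (rule inj_on_inverseI) (rule param_chart)

text \<open>Covers the inclusions of the leaves and the two projections of a product at once.\<close>
lemma (in chart) differential_cd:
  fixes N :: "('r::{t2_space,second_countable_topology}, 'c::euclidean_space) atlas"
  assumes N: "smooth_atlas N" "(V, \<psi>) \<in> N"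
    and h: "continuous_on U h" "h ` U \<subseteq> V" "\<And>q. q \<in> U \<Longrightarrow> \<psi> (h q) = L (\<phi> q)"
    and L: "smooth_on (\<phi> ` U) L" "(L has_derivative L') (at (\<phi> p))" and p: "p \<in> U"
  shows "differential N h p (cd p v) = chart_derivative N V \<psi> (h p) (L' v)"
proof
  fix f
  interpret N: chart N V \<psi> using N by unfold_locales
  have hp: "h p \<in> V" using h(2) p by auto
  show "differential N h p (cd p v) f = N.cd (h p) (L' v) f"
  proof (cases "smooth_near N (h p) f")
    case True
    obtain W where W: "open W" "h p \<in> W" "W \<subseteq> V" "smooth_fun N W f"
      using N.smooth_nearE[OF True hp N.domain(1)] by blast
    \<comment> \<open>The part of \<open>U\<close> that \<open>h\<close> sends into the region where
      \<open>f\<close> is smooth; there \<open>f \<circ> h\<close> is a composite of smooth maps in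
      the charts.\<close>
    have W1: "open (U \<inter> h -` W)" "U \<inter> h -` W \<subseteq> U" "p \<in> U \<inter> h -` W"
      using continuous_open_preimage[OF h(1) domain(1) W(1)] p W by auto
    note o = open_chart_image_subset[OF W1(1,2)]
    have eq: "(f \<circ> N.param) (L z) = (f \<circ> h \<circ> param) z" if "z \<in> \<phi> ` (U \<inter> h -` W)" for z
      using that h(2) by (auto simp: h(3)[symmetric] image_subset_iff)
    have "L ` \<phi> ` (U \<inter> h -` W) \<subseteq> \<psi> ` W" by (force simp: h(3)[symmetric])
    then have "smooth_on (\<phi> ` (U \<inter> h -` W)) (\<lambda>z. (f \<circ> N.param) (L z))"
      by (rule smooth_on_compose[OF o N.open_chart_image_subset[OF W(1,3)] _ N.smooth_funD[OF W(4,3)]])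
         (rule smooth_on_subset[OF L(1)], auto)
    then have "smooth_on (\<phi> ` (U \<inter> h -` W)) (f \<circ> h \<circ> param)"
      by (rule smooth_on_cong[THEN iffD1, OF o, rotated]) (rule eq)
    \<comment> \<open>Were \<open>f \<circ> h\<close> not smooth near \<open>p\<close>,
      \<open>cd p v\<close> would assign it the default value 0.\<close>
    then have sn: "smooth_near A p (f \<circ> h)"
      by (rule smooth_nearI[OF W1 smooth_funI[OF W1(1,2)]])
    have "((f \<circ> N.param) has_derivative fderiv (f \<circ> N.param) (\<psi> (h p))) (at (L (\<phi> p)))"
      using N.smooth_near_has_derivative[OF True hp] h(3)[OF p] by simp
    then have "((f \<circ> h \<circ> param) has_derivative
        (\<lambda>x. fderiv (f \<circ> N.param) (\<psi> (h p)) (L' x))) (at (\<phi> p))"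
      by (rule has_derivative_transform_within_open[OF has_derivative_compose[OF L(2)] o])
         (use W1(3) eq in auto)
    from frechet_derivative_at[OF this, THEN fun_cong, of v] show ?thesis
      using True sn by (simp add: differential_def chart_derivative_def)
  qed (simp add: differential_def chart_derivative_def)
qed

lemma smooth_atlas_product:
  assumes A: "smooth_atlas A" and A': "smooth_atlas A'"
  shows "smooth_atlas (product_atlas A A')"
proof -
  have "open W \<and> open (\<theta> ` W) \<and> homeomorphism W (\<theta> ` W) \<theta> (inv_into W \<theta>)"
    if W\<theta>: "(W, \<theta>) \<in> product_atlas A A'" for W \<theta>
  proof (intro conjI)
    from W\<theta> obtain U \<phi> V \<psi> where W: "W = U \<times> V" "\<theta> = map_prod \<phi> \<psi>" "(U, \<phi>) \<in> A" "(V, \<psi>) \<in> A'"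
      by (auto simp: product_atlas_def)
    interpret B: chart A U \<phi> using A W by unfold_locales
    interpret F: chart A' V \<psi> using A' W by unfold_locales
    have im: "\<theta> ` W = \<phi> ` U \<times> \<psi> ` V" unfolding W by (rule map_prod_surj_on[OF refl refl])
    have inv: "inv_into W \<theta> z = (B.param (fst z), F.param (snd z))" if "z \<in> \<phi> ` U \<times> \<psi> ` V" for z
      using that inv_into_map_prod[OF B.inj F.inj] W by (cases z) auto
    show "open W" "open (\<theta> ` W)"
      unfolding im unfolding W using B.domain F.domain by (auto intro: open_Times)
    have cont: "continuous_on U \<phi>" "continuous_on V \<psi>" "continuous_on (\<phi> ` U) B.param"
        "continuous_on (\<psi> ` V) F.param"
      using B.domain(3) F.domain(3) by (auto simp: homeomorphism_def)
    show "homeomorphism W (\<theta> ` W) \<theta> (inv_into W \<theta>)"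
    proof (rule homeomorphismI)
      show "continuous_on W \<theta>"
        unfolding W map_prod_def case_prod_unfold
        by (intro continuous_on_Pair continuous_on_compose2[OF cont(1)] continuous_on_compose2[OF
            cont(2)]
            continuous_on_fst continuous_on_snd continuous_on_id) auto
      have "continuous_on (\<phi> ` U \<times> \<psi> ` V) (\<lambda>z. (B.param (fst z), F.param (snd z)))"
        by (intro continuous_on_Pair continuous_on_compose2[OF cont(3)] continuous_on_compose2[OF
            cont(4)]
            continuous_on_fst continuous_on_snd continuous_on_id) auto
      then show "continuous_on (\<theta> ` W) (inv_into W \<theta>)"
        unfolding im by (rule continuous_on_eq) (rule inv[symmetric])
      have "inj_on \<theta> W" unfolding W by (rule inj_on_map_prod[OF B.inj F.inj])
      then show "inv_into W \<theta> (\<theta> x) = x" if "x \<in> W" for x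
        using that by simp
    qed (auto simp: f_inv_into_f inv_into_into)
  qed
  moreover have "smooth_on (\<theta> ` (W \<inter> W')) (\<theta>' \<circ> inv_into W \<theta>)"
    if W\<theta>: "(W, \<theta>) \<in> product_atlas A A'" "(W', \<theta>') \<in> product_atlas A A'" for W \<theta> W' \<theta>'
  proof -
    from W\<theta> obtain U \<phi> V \<psi> U' \<phi>' V' \<psi>'
      where W: "W = U \<times> V" "\<theta> = map_prod \<phi> \<psi>" "(U, \<phi>) \<in> A" "(V, \<psi>) \<in> A'"
        and W': "W' = U' \<times> V'" "\<theta>' = map_prod \<phi>' \<psi>'" "(U', \<phi>') \<in> A" "(V', \<psi>') \<in> A'"
      by (auto simp: product_atlas_def)
    interpret B: chart A U \<phi> using A W by unfold_locales
    interpret F: chart A' V \<psi> using A' W by unfold_locales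
    interpret B': chart A U' \<phi>' using A W' by unfold_locales
    interpret F': chart A' V' \<psi>' using A' W' by unfold_locales
    have im: "\<theta> ` (W \<inter> W') = \<phi> ` (U \<inter> U') \<times> \<psi> ` (V \<inter> V')"
      unfolding W W' Times_Int_Times by (rule map_prod_surj_on[OF refl refl])
    note oB = B.open_chart_image[OF B'.domain(1)] and oF = F.open_chart_image[OF F'.domain(1)]
    have "smooth_on (\<phi> ` (U \<inter> U') \<times> \<psi> ` (V \<inter> V')) (\<lambda>z. (\<phi>' (B.param (fst z)), \<psi>' (F.param (snd z))))"
      by (rule smooth_on_Pair[OF open_Times[OF oB oF] smooth_on_fst[OF oB oF B'.smooth_transition[OF
          W(3)]]
            smooth_on_snd[OF oB oF F'.smooth_transition[OF W(4)]]])
    then show "smooth_on (\<theta> ` (W \<inter> W')) (\<theta>' \<circ> inv_into W \<theta>)"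
      unfolding im
    proof (rule smooth_on_cong[THEN iffD1, OF open_Times[OF oB oF], rotated])
      fix z assume "z \<in> \<phi> ` (U \<inter> U') \<times> \<psi> ` (V \<inter> V')"
      then have "inv_into W \<theta> z = (B.param (fst z), F.param (snd z))"
        using inv_into_map_prod[OF B.inj F.inj, of "fst z" "snd z"] W by auto
      then show "(\<phi>' (B.param (fst z)), \<psi>' (F.param (snd z))) = (\<theta>' \<circ> inv_into W \<theta>) z"
        by (simp add: W')
    qed
  qed
  ultimately show ?thesis unfolding smooth_atlas_def by blast
qed

section \<open>Product charts and lifted fields\<close>

locale product_chart =
  B: chart A U \<phi> + F: chart A' V \<psi>
  for A :: "('p::{t2_space,second_countable_topology}, 'a::euclidean_space) atlas" and U \<phi>
    and A' :: "('q::{t2_space,second_countable_topology}, 'b::euclidean_space) atlas" and V \<psi>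

sublocale product_chart \<subseteq> M: chart "product_atlas A A'" "U \<times> V" "map_prod \<phi> \<psi>"
proof unfold_locales
  show "smooth_atlas (product_atlas A A')" by (rule smooth_atlas_product[OF B.atlas F.atlas])
  show "(U \<times> V, map_prod \<phi> \<psi>) \<in> product_atlas A A'"
    using B.in_atlas F.in_atlas by (auto simp: product_atlas_def)
qed

context product_chart
begin

abbreviation "M \<equiv> product_atlas A A'"

lemma image_product: "map_prod \<phi> \<psi> ` (U \<times> V) = \<phi> ` U \<times> \<psi> ` V"
  by (rule map_prod_surj_on[OF refl refl])

lemma param_product: "z \<in> \<phi> ` U \<Longrightarrow> s \<in> \<psi> ` V \<Longrightarrow> M.param (z, s) = (B.param z, F.param s)"
  by (rule inv_into_map_prod[OF B.inj F.inj])

text \<open>In charts the inclusion of the leaf is \<open>z \<mapsto> (z, \<psi> q)\<close>, whose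
  derivative pads with a zero fiber component.\<close>

lemma lift_base_eq:
  assumes X: "X p \<in> tangent_space A p" and p: "p \<in> U" and q: "q \<in> V"
  shows "lift_base A A' X (p, q) = M.cd (p, q) (B.coord_vector (X p), 0)"
proof -
  have sm: "smooth_on (\<phi> ` U) (\<lambda>z. (z, \<psi> q))"
    by (intro smooth_on_Pair B.domain smooth_on_const smooth_on_bounded_linear bounded_linear_ident)
  have "differential M (\<lambda>p'. (p', q)) p (B.cd p x) = M.cd (p, q) (x, 0)" for x
  proof (rule B.differential_cd[where L = "\<lambda>z. (z, \<psi> q)" and L' = "\<lambda>h. (h, 0)",
      OF M.atlas M.in_atlas _ _ _ sm _ p])
    show "continuous_on U (\<lambda>p'. (p', q))" by (intro continuous_intros)
    show "((\<lambda>z. (z, \<psi> q)) has_derivative (\<lambda>h. (h, 0))) (at (\<phi> p))"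
      by (intro has_derivative_Pair has_derivative_ident has_derivative_const)
    show "(\<lambda>p'. (p', q)) ` U \<subseteq> U \<times> V" using q by blast
  qed simp
  from this[of "B.coord_vector (X p)"] show ?thesis
    by (simp add: lift_base_def B.cd_coord_vector[OF p X])
qed

lemma lift_fiber_eq:
  assumes X: "X q \<in> tangent_space A' q" and p: "p \<in> U" and q: "q \<in> V"
  shows "lift_fiber A A' X (p, q) = M.cd (p, q) (0, F.coord_vector (X q))"
proof -
  have sm: "smooth_on (\<psi> ` V) (\<lambda>s. (\<phi> p, s))"
    by (intro smooth_on_Pair F.domain smooth_on_const smooth_on_bounded_linear bounded_linear_ident)
  have "differential M (\<lambda>q'. (p, q')) q (F.cd q x) = M.cd (p, q) (0, x)" for x
  proof (rule F.differential_cd[where L = "\<lambda>s. (\<phi> p, s)" and L' = "\<lambda>h. (0, h)",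
      OF M.atlas M.in_atlas _ _ _ sm _ q])
    show "continuous_on V (\<lambda>q'. (p, q'))" by (intro continuous_intros)
    show "((\<lambda>s. (\<phi> p, s)) has_derivative (\<lambda>h. (0, h))) (at (\<psi> q))"
      by (intro has_derivative_Pair has_derivative_ident has_derivative_const)
    show "(\<lambda>q'. (p, q')) ` V \<subseteq> U \<times> V" using p by blast
  qed simp
  from this[of "F.coord_vector (X q)"] show ?thesis
    by (simp add: lift_fiber_def F.cd_coord_vector[OF q X])
qed

lemma differential_projections:
  assumes p: "p \<in> U" and q: "q \<in> V"
  shows "differential A fst (p, q) (M.cd (p, q) x) = B.cd p (fst x)"
    and "differential A' snd (p, q) (M.cd (p, q) x) = F.cd q (snd x)"
proof -
  have pq: "(p, q) \<in> U \<times> V" using p q by simp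
  have "differential A fst (p, q) (M.cd (p, q) x) = B.cd (fst (p, q)) (fst x)"
    by (rule M.differential_cd[where h = fst and L = fst and L' = fst, OF B.atlas B.in_atlas _ _ _
          smooth_on_bounded_linear[OF bounded_linear_fst] bounded_linear_imp_has_derivative[OF
              bounded_linear_fst] pq])
       (auto simp: continuous_on_fst)
  moreover have "differential A' snd (p, q) (M.cd (p, q) x) = F.cd (snd (p, q)) (snd x)"
    by (rule M.differential_cd[where h = snd and L = snd and L' = snd, OF F.atlas F.in_atlas _ _ _
          smooth_on_bounded_linear[OF bounded_linear_snd] bounded_linear_imp_has_derivative[OF
              bounded_linear_snd] pq])
       (auto simp: continuous_on_snd)
  ultimately show "differential A fst (p, q) (M.cd (p, q) x) = B.cd p (fst x)"
    "differential A' snd (p, q) (M.cd (p, q) x) = F.cd q (snd x)" by simp_all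
qed

lemma rep_lift_base:
  assumes X: "vector_field A U X" and z: "z \<in> \<phi> ` U" and s: "s \<in> \<psi> ` V"
  shows "M.rep (lift_base A A' X) (z, s) = (B.rep X z, 0)"
proof -
  obtain p q where pq: "p \<in> U" "q \<in> V" "z = \<phi> p" "s = \<psi> q" using z s by auto
  have Xp: "X p \<in> tangent_space A p" using X pq by (simp add: vector_field_def)
  have "M.rep (lift_base A A' X) (map_prod \<phi> \<psi> (p, q)) = (B.coord_vector (X p), 0)"
    by (rule M.rep_eqI[where X = "lift_base A A' X", OF _ lift_base_eq[where X = X, OF Xp pq(1,2)]])
        (use pq in simp)
  then show ?thesis using pq by (simp add: B.rep_def)
qed

lemma rep_lift_fiber:
  assumes X: "vector_field A' V X" and z: "z \<in> \<phi> ` U" and s: "s \<in> \<psi> ` V"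
  shows "M.rep (lift_fiber A A' X) (z, s) = (0, F.rep X s)"
proof -
  obtain p q where pq: "p \<in> U" "q \<in> V" "z = \<phi> p" "s = \<psi> q" using z s by auto
  have Xq: "X q \<in> tangent_space A' q" using X pq by (simp add: vector_field_def)
  have "M.rep (lift_fiber A A' X) (map_prod \<phi> \<psi> (p, q)) = (0, F.coord_vector (X q))"
    by (rule M.rep_eqI[where X = "lift_fiber A A' X", OF _ lift_fiber_eq[where X = X,
        OF Xq pq(1,2)]]) (use pq in simp)
  then show ?thesis using pq by (simp add: F.rep_def)
qed

lemma vector_field_lift_base:
  assumes X: "vector_field A U X"
  shows "vector_field M (U \<times> V) (lift_base A A' X)"
proof (rule M.vector_fieldI[OF M.domain(1) subset_refl])
  fix r assume r: "r \<in> U \<times> V"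
  then have "X (fst r) \<in> tangent_space A (fst r)" using X by (auto simp: vector_field_def)
  then show "lift_base A A' X r \<in> tangent_space M r"
    using lift_base_eq[of X "fst r" "snd r"] r by (cases r) simp
next
  have "smooth_on (\<phi> ` U \<times> \<psi> ` V) (\<lambda>z. (B.rep X (fst z), 0 :: 'b))"
    by (intro smooth_on_Pair smooth_on_const smooth_on_fst open_Times B.domain F.domain
        B.smooth_rep[OF B.domain(1) subset_refl X])
  then show "smooth_on (map_prod \<phi> \<psi> ` (U \<times> V)) (M.rep (lift_base A A' X))"
    unfolding image_product
    by (rule smooth_on_cong[THEN iffD1, OF open_Times[OF B.domain(2) F.domain(2)], rotated])
       (auto simp: rep_lift_base[OF X])
qed

lemma vector_field_lift_fiber:
  assumes X: "vector_field A' V X"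
  shows "vector_field M (U \<times> V) (lift_fiber A A' X)"
proof (rule M.vector_fieldI[OF M.domain(1) subset_refl])
  fix r assume r: "r \<in> U \<times> V"
  then have "X (snd r) \<in> tangent_space A' (snd r)" using X by (auto simp: vector_field_def)
  then show "lift_fiber A A' X r \<in> tangent_space M r"
    using lift_fiber_eq[of X "snd r" "fst r"] r by (cases r) simp
next
  have "smooth_on (\<phi> ` U \<times> \<psi> ` V) (\<lambda>z. (0 :: 'a, F.rep X (snd z)))"
    by (intro smooth_on_Pair smooth_on_const smooth_on_snd open_Times B.domain F.domain
        F.smooth_rep[OF F.domain(1) subset_refl X])
  then show "smooth_on (map_prod \<phi> \<psi> ` (U \<times> V)) (M.rep (lift_fiber A A' X))"
    unfolding image_product
    by (rule smooth_on_cong[THEN iffD1, OF open_Times[OF B.domain(2) F.domain(2)], rotated])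
       (auto simp: rep_lift_fiber[OF X])
qed

lemma local_metric_warped:
  assumes z: "z \<in> \<phi> ` U" and s: "s \<in> \<psi> ` V"
  shows "M.local_metric (base_conformal_warped A A' c w g g') (z, s) x y =
    ((c \<circ> B.param) z)\<^sup>2 * B.local_metric g z (fst x) (fst y)
    + ((w \<circ> B.param) z)\<^sup>2 * F.local_metric g' s (snd x) (snd y)"
proof -
  have "B.param z \<in> U" "F.param s \<in> V" using z s by auto
  then show ?thesis
    unfolding M.local_metric_def base_conformal_warped_def param_product[OF z s]
    by (simp add: differential_projections B.local_metric_def F.local_metric_def)
qed

end

text \<open>Positivity of \<open>C\<close> and \<open>W\<close> enters through nondegeneracy:
  pairing with \<open>(y, 0)\<close> and \<open>(0, y)\<close> isolates the two summands, whose
  factors are nonzero.\<close>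

lemma smooth_metric_warped:
  fixes GB :: "'a::euclidean_space \<Rightarrow> 'a \<Rightarrow> 'a \<Rightarrow> real" and GF :: "'b::euclidean_space \<Rightarrow> 'b \<Rightarrow> 'b \<Rightarrow> real"
  assumes GB: "smooth_metric_on S GB" and GF: "smooth_metric_on T GF"
    and C: "smooth_on S C" "\<And>z. z \<in> S \<Longrightarrow> C z > 0"
    and W: "smooth_on S W" "\<And>z. z \<in> S \<Longrightarrow> W z > 0"
    and G_eq: "\<And>z s x y. z \<in> S \<Longrightarrow> s \<in> T \<Longrightarrow>
      G (z, s) x y = (C z)\<^sup>2 * GB z (fst x) (fst y) + (W z)\<^sup>2 * GF s (snd x) (snd y)"
  shows "smooth_metric_on (S \<times> T) G"
  unfolding smooth_metric_on_def
proof (intro conjI ballI allI)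
  have S: "open S" and T: "open T" using GB GF by (auto simp: smooth_metric_on_def)
  then show o: "open (S \<times> T)" by (rule open_Times)
  show "nondegenerate_form (G \<zeta>)" if *: "\<zeta> \<in> S \<times> T" for \<zeta>
  proof -
    obtain z s where \<zeta>: "\<zeta> = (z, s)" "z \<in> S" "s \<in> T" using * by blast
    have B: "bilinear (GB z)" "\<And>x y. GB z x y = GB z y x" "\<And>x. (\<forall>y. GB z x y = 0) \<Longrightarrow> x = 0"
      and F: "bilinear (GF s)" "\<And>x y. GF s x y = GF s y x" "\<And>x. (\<forall>y. GF s x y = 0) \<Longrightarrow> x = 0"
      using GB GF \<zeta> unfolding smooth_metric_on_def nondegenerate_form_def by blast+
    note eq = G_eq[OF \<zeta>(2,3)]
    show ?thesis
      unfolding nondegenerate_form_def \<zeta>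
    proof (intro conjI allI impI)
      show "G (z, s) x y = G (z, s) y x" for x y
        unfolding eq using B(2)[of "fst x" "fst y"] F(2)[of "snd x" "snd y"] by simp
      show "bilinear (G (z, s))"
        unfolding bilinear_def linear_iff eq
        by (simp add: bilinear_ladd[OF B(1)] bilinear_radd[OF B(1)] bilinear_lmul[OF B(1)]
            bilinear_rmul[OF B(1)]
            bilinear_ladd[OF F(1)] bilinear_radd[OF F(1)] bilinear_lmul[OF F(1)]
                bilinear_rmul[OF F(1)] algebra_simps)
      fix x assume 0: "\<forall>y. G (z, s) x y = 0"
      have "GB z (fst x) y = 0" for y
        using 0[rule_format, of "(y, 0)"] C(2)[OF \<zeta>(2)] by (simp add: eq bilinear_rzero[OF F(1)])
      moreover have "GF s (snd x) y = 0" for y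
        using 0[rule_format, of "(0, y)"] W(2)[OF \<zeta>(2)] by (simp add: eq bilinear_rzero[OF B(1)])
      ultimately show "x = 0" using B(3) F(3) by (simp add: prod_eq_iff)
    qed
  qed
  fix x y
  have "smooth_on (S \<times> T) (\<lambda>\<zeta>. C (fst \<zeta>) * C (fst \<zeta>) * GB (fst \<zeta>) (fst x) (fst y)
      + W (fst \<zeta>) * W (fst \<zeta>) * GF (snd \<zeta>) (snd x) (snd y))"
    using GB GF unfolding smooth_metric_on_def
    by (intro smooth_on_add smooth_on_mult smooth_on_fst[OF S T] smooth_on_snd[OF S T] o C(1) W(1)) auto
  then show "smooth_on (S \<times> T) (\<lambda>\<zeta>. G \<zeta> x y)"
    by (rule smooth_on_cong[THEN iffD1, OF o, rotated]) (auto simp: G_eq power2_eq_square)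
qed

lemma (in product_chart) warped_coordinates:
  assumes g: "pseudo_riemannian A g" and g': "pseudo_riemannian A' g'"
    and c: "smooth_fun A (points A) c" "\<forall>p\<in>points A. c p > 0"
    and w: "smooth_fun A (points A) w" "\<forall>p\<in>points A. w p > 0"
  shows "warped_coordinates (\<phi> ` U) (\<psi> ` V) (B.local_metric g) (F.local_metric g')
    (c \<circ> B.param) (w \<circ> B.param) (M.local_metric (base_conformal_warped A A' c w g g'))"
proof
  show B: "smooth_metric_on (\<phi> ` U) (B.local_metric g)" by (rule B.smooth_local_metric[OF g])
  show F: "smooth_metric_on (\<psi> ` V) (F.local_metric g')" by (rule F.smooth_local_metric[OF g'])
  show C: "smooth_on (\<phi> ` U) (c \<circ> B.param)" and W: "smooth_on (\<phi> ` U) (w \<circ> B.param)"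
    by (rule B.smooth_funD[OF smooth_fun_subset[OF c(1) B.domain(4)] subset_refl]
        B.smooth_funD[OF smooth_fun_subset[OF w(1) B.domain(4)] subset_refl])+
  show C0: "0 < (c \<circ> B.param) z" and W0: "0 < (w \<circ> B.param) z" if "z \<in> \<phi> ` U" for z
    using that c w B.domain(4) by auto
  show "M.local_metric (base_conformal_warped A A' c w g g') (z, s) x y =
    ((c \<circ> B.param) z)\<^sup>2 * B.local_metric g z (fst x) (fst y)
    + ((w \<circ> B.param) z)\<^sup>2 * F.local_metric g' s (snd x) (snd y)"
    if "z \<in> \<phi> ` U" "s \<in> \<psi> ` V" for z s x y
    by (rule local_metric_warped[OF that])
  show "smooth_metric_on (\<phi> ` U \<times> \<psi> ` V) (M.local_metric (base_conformal_warped A A' c w g g'))"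
    by (rule smooth_metric_warped[OF B F C C0 W W0 local_metric_warped])
qed

lemma pseudo_riemannian_warped:
  assumes g: "pseudo_riemannian A g" and g': "pseudo_riemannian A' g'"
    and c: "smooth_fun A (points A) c" "\<forall>p\<in>points A. c p > 0"
    and w: "smooth_fun A (points A) w" "\<forall>p\<in>points A. w p > 0"
  shows "pseudo_riemannian (product_atlas A A') (base_conformal_warped A A' c w g g')"
proof (rule pseudo_riemannianI)
  show "smooth_atlas (product_atlas A A')"
    by (rule smooth_atlas_product[OF pseudo_riemannian_atlas[OF g] pseudo_riemannian_atlas[OF g']])
  fix W \<theta> assume "(W, \<theta>) \<in> product_atlas A A'"
  then obtain U \<phi> V \<psi> where chart: "W = U \<times> V" "\<theta> = map_prod \<phi> \<psi>" "(U, \<phi>) \<in> A" "(V, \<psi>) \<in> A'"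
    by (auto simp: product_atlas_def)
  interpret product_chart A U \<phi> A' V \<psi>
    using pseudo_riemannian_atlas[OF g] pseudo_riemannian_atlas[OF g'] chart by unfold_locales
  interpret warped_coordinates "\<phi> ` U" "\<psi> ` V" "B.local_metric g" "F.local_metric g'"
    "c \<circ> B.param" "w \<circ> B.param" "M.local_metric (base_conformal_warped A A' c w g g')"
    by (rule warped_coordinates[OF assms])
  show "smooth_metric_on (\<theta> ` W) (chart.local_metric (product_atlas A A') W \<theta> (base_conformal_warped
      A A' c w g g'))"
    unfolding chart image_product by (rule G)
qed

theorem theorem3p13:
  fixes B :: "('p::{t2_space,second_countable_topology}, 'a::euclidean_space) atlas"
    and F :: "('q::{t2_space,second_countable_topology}, 'b::euclidean_space) atlas"
    and gB :: "'p metric" and gF :: "'q metric"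
    and c w :: "'p \<Rightarrow> real"
    and X Y :: "'p vfield" and V W :: "'q vfield"
    and m k :: real
    and M :: "('p \<times> 'q, 'a \<times> 'b) atlas"
    and g :: "('p \<times> 'q) metric"
    and X' Y' V' W' :: "('p \<times> 'q) vfield"
  defines "m \<equiv> real DIM('a)" and "k \<equiv> real DIM('b)"
    and "M \<equiv> product_atlas B F"
    and "g \<equiv> base_conformal_warped B F c w gB gF"
    and "X' \<equiv> lift_base B F X" and "Y' \<equiv> lift_base B F Y"
    and "V' \<equiv> lift_fiber B F V" and "W' \<equiv> lift_fiber B F W"
  assumes "pseudo_riemannian B gB" and "pseudo_riemannian F gF"
    and "smooth_fun B (points B) c" and "\<forall>p\<in>points B. c p > 0"
    and "smooth_fun B (points B) w" and "\<forall>p\<in>points B. w p > 0"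
    and "vector_field B (points B) X" and "vector_field B (points B) Y"
    and "vector_field F (points F) V" and "vector_field F (points F) W"
  shows "\<forall>p\<in>points B. \<forall>q\<in>points F.
      ricci M g X' Y' (p, q) =
        ricci B gB X Y p
        - (m - 2) * (1 / c p) * hessian B gB c X Y p
        + 2 * (m - 2) * (1 / (c p)\<^sup>2) * (X p c * Y p c)
        - ((m - 3) * (gB p (gradient B gB c p) (gradient B gB c p) / (c p)\<^sup>2)
            + laplacian B gB c p / c p) * gB p (X p) (Y p)
        - k * (1 / w p) * hessian B gB w X Y p
        - k * (gB p (gradient B gB w p) (gradient B gB c p) / (w p * c p)) * gB p (X p) (Y p)
        + k * (X p c / c p) * (Y p w / w p)
        + k * (Y p c / c p) * (X p w / w p)
    \<and> ricci M g X' V' (p, q) = 0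
    \<and> ricci M g V' W' (p, q) =
        ricci F gF V W q
        - ((w p)\<^sup>2 / (c p)\<^sup>2) * gF q (V q) (W q) *
            ((m - 2) * (gB p (gradient B gB w p) (gradient B gB c p) / (w p * c p))
              + laplacian B gB w p / w p
              + (k - 1) * (gB p (gradient B gB w p) (gradient B gB w p) / (w p)\<^sup>2))"
proof (intro ballI, goal_cases)
  case (1 p q)
  note p = 1(1) and q = 1(2)
  note gB = \<open>pseudo_riemannian B gB\<close> and gF = \<open>pseudo_riemannian F gF\<close>
  note c = \<open>smooth_fun B (points B) c\<close> \<open>\<forall>p\<in>points B. c p > 0\<close>
    and w = \<open>smooth_fun B (points B) w\<close> \<open>\<forall>p\<in>points B. w p > 0\<close>
  obtain U \<phi> where U: "(U, \<phi>) \<in> B" and pU: "p \<in> U" using p by (rule points_chart)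
  obtain U' \<psi> where U': "(U', \<psi>) \<in> F" and qU': "q \<in> U'" using q by (rule points_chart)
  interpret pc: product_chart B U \<phi> F U' \<psi>
    using pseudo_riemannian_atlas[OF gB] pseudo_riemannian_atlas[OF gF] U U' by unfold_locales
  interpret wc: warped_coordinates "\<phi> ` U" "\<psi> ` U'" "pc.B.local_metric gB" "pc.F.local_metric gF"
    "c \<circ> pc.B.param" "w \<circ> pc.B.param" "pc.M.local_metric (base_conformal_warped B F c w gB gF)"
    by (rule pc.warped_coordinates[OF gB gF c w])
  interpret wp: warped_point "\<phi> ` U" "\<psi> ` U'" "pc.B.local_metric gB" "pc.F.local_metric gF"
    "c \<circ> pc.B.param" "w \<circ> pc.B.param" "pc.M.local_metric (base_conformal_warped B F c w gB gF)" "\<phi>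
        p" "\<psi> q"
    by unfold_locales (use pU qU' in auto)
  \<comment> \<open>The chart formulas for the Ricci tensor of the product rest on the existence of
    its connection and frames, hence on the warped metric being pseudo-Riemannian.\<close>
  have M: "pseudo_riemannian M g"
    unfolding M_def g_def by (rule pseudo_riemannian_warped[OF gB gF c w])
  have X: "vector_field B U X" and Y: "vector_field B U Y"
    using assms pc.B.domain(4) by (auto intro: vector_field_subset)
  have V: "vector_field F U' V" and W: "vector_field F U' W"
    using assms pc.F.domain(4) by (auto intro: vector_field_subset)
  have lifts: "vector_field M (U \<times> U') X'" "vector_field M (U \<times> U') Y'"
    "vector_field M (U \<times> U') V'" "vector_field M (U \<times> U') W'"
    unfolding M_def X'_def Y'_def V'_def W'_def
    by (rule pc.vector_field_lift_base[OF X] pc.vector_field_lift_base[OF Y]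
        pc.vector_field_lift_fiber[OF V] pc.vector_field_lift_fiber[OF W])+
  have pq: "(p, q) \<in> U \<times> U'" using pU qU' by simp
  have im: "\<phi> p \<in> \<phi> ` U" "\<psi> q \<in> \<psi> ` U'" using pU qU' by auto
  note reps = pc.rep_lift_base[OF X im] pc.rep_lift_base[OF Y im] pc.rep_lift_fiber[OF V im]
      pc.rep_lift_fiber[OF W im]
  note ricM = pc.M.ricci_eq[OF M[unfolded M_def] pc.M.domain(1) subset_refl, OF _ _ pq, unfolded
      map_prod_simp]
  note UB = pc.B.domain(1) subset_refl[of U] and UF = pc.F.domain(1) subset_refl[of U']
  have cU: "smooth_fun B U c" and wU: "smooth_fun B U w"
    using c w pc.B.domain(4) by (auto intro: smooth_fun_subset)
  have fields: "X p c = wc.dC (\<phi> p) (pc.B.rep X (\<phi> p))" "Y p c = wc.dC (\<phi> p) (pc.B.rep Y (\<phi> p))"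
    "X p w = wc.dW (\<phi> p) (pc.B.rep X (\<phi> p))" "Y p w = wc.dW (\<phi> p) (pc.B.rep Y (\<phi> p))"
    by (rule pc.B.vector_field_apply[OF X pU pU pc.B.smooth_nearI[OF UB pU cU]]
        pc.B.vector_field_apply[OF Y pU pU pc.B.smooth_nearI[OF UB pU cU]]
        pc.B.vector_field_apply[OF X pU pU pc.B.smooth_nearI[OF UB pU wU]]
        pc.B.vector_field_apply[OF Y pU pU pc.B.smooth_nearI[OF UB pU wU]])+
  have gXY: "gB p (X p) (Y p) = pc.B.local_metric gB (\<phi> p) (pc.B.rep X (\<phi> p)) (pc.B.rep Y (\<phi> p))"
    unfolding pc.B.vector_field_cd[OF X pU pU] pc.B.vector_field_cd[OF Y pU pU] pc.B.local_metric_def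
    using pU by simp
  have gVW: "gF q (V q) (W q) = pc.F.local_metric gF (\<psi> q) (pc.F.rep V (\<psi> q)) (pc.F.rep W (\<psi> q))"
    unfolding pc.F.vector_field_cd[OF V qU' qU'] pc.F.vector_field_cd[OF W qU' qU'] pc.F.local_metric_def
    using qU' by simp
  have grads: "gB p (gradient B gB c p) (gradient B gB c p) = wc.dC (\<phi> p) (wc.P (\<phi> p))"
    "gB p (gradient B gB w p) (gradient B gB c p) = wc.dW (\<phi> p) (wc.P (\<phi> p))"
    "gB p (gradient B gB w p) (gradient B gB w p) = wc.dW (\<phi> p) (wc.N (\<phi> p))"
    unfolding pc.B.gradient_eq[OF gB UB cU pU] pc.B.gradient_eq[OF gB UB wU pU]
        wp.gradient_pairing(1,2)[symmetric]
      pc.B.local_metric_def using pU by simp_all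
  have pos: "c p > 0" "w p > 0" using c w p by auto
  \<comment> \<open>The trace comes out as expanded products of inverses; this identity collects
    them into \<open>w\<^sup>2 / c\<^sup>2\<close> times the bracket of the claim.\<close>
  have fiber_coefficients: "r * (w * inverse c * inverse c * l + (m - 2) * w * inverse c * inverse c
      * inverse c * a
        + (k - 1) * inverse c * inverse c * n)
      = w\<^sup>2 / c\<^sup>2 * r * ((m - 2) * (a / (w * c)) + l / w + (k - 1) * (n / w\<^sup>2))"
    if "c > 0" "w > 0" for c w r l a n m k :: real
  proof -
    have "w\<^sup>2 / c\<^sup>2 * (a / (w * c)) = w * inverse c * inverse c * inverse c * a"
      "w\<^sup>2 / c\<^sup>2 * (l / w) = w * inverse c * inverse c * l"
      "w\<^sup>2 / c\<^sup>2 * (n / w\<^sup>2) = inverse c * inverse c * n"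
      using that by (simp_all add: field_simps power2_eq_square)
    then show ?thesis by algebra
  qed
  \<comment> \<open>The Ricci tensor at \<open>V\<close>, \<open>W\<close> is the trace of
    \<open>R(e, W)V\<close>, so the fiber metric appears with its arguments exchanged.\<close>
  have Gsym: "pc.F.local_metric gF (\<psi> q) u v = pc.F.local_metric gF (\<psi> q) v u" for u v
    by (rule wp.GF_sym)
  note ricB = pc.B.ricci_eq[OF gB UB X Y pU] and ricF = pc.F.ricci_eq[OF gF UF V W qU']
  note hess = pc.B.hessian_eq[OF gB UB X Y cU pU] pc.B.hessian_eq[OF gB UB X Y wU pU]
  note lap = pc.B.laplacian_eq[OF gB UB cU pU] pc.B.laplacian_eq[OF gB UB wU pU]
  note mixed_simps = reps M_def g_def X'_def Y'_def V'_def W'_def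
  show ?case
  proof (intro conjI, goal_cases)
    case 1
    have "ricci M g X' Y' (p, q) = (\<Sum>b\<in>Basis. riemann (christoffel (pc.M.local_metric g)) (\<phi> p, \<psi> q) b
        (pc.B.rep Y (\<phi> p), 0) (pc.B.rep X (\<phi> p), 0) \<bullet> b)"
      using ricM[OF lifts(1,2)[unfolded M_def]] by (simp add: mixed_simps)
    then show ?case
      unfolding g_def wp.ricci_base ricB hess lap fields gXY grads m_def k_def
      using pU pos by (simp add: power2_eq_square divide_inverse algebra_simps)
  next
    case 2
    show ?case
      using ricM[OF lifts(1,3)[unfolded M_def]] wp.ricci_mixed by (simp add: mixed_simps)
  next
    case 3
    have "ricci M g V' W' (p, q) = (\<Sum>b\<in>Basis. riemann (christoffel (pc.M.local_metric g)) (\<phi> p, \<psi> q) b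
        (0, pc.F.rep W (\<psi> q)) (0, pc.F.rep V (\<psi> q)) \<bullet> b)"
      using ricM[OF lifts(3,4)[unfolded M_def]] by (simp add: mixed_simps)
    then show ?case
      unfolding g_def wp.ricci_fiber ricF lap gVW grads m_def k_def Gsym[of "pc.F.rep W (\<psi> q)"]
      using pU by (simp add: fiber_coefficients[OF pos])
  qed
qed

end
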